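(* (a) For any $X:=\{x_i\}_{i\in[n]}$ in $\mathbb{R}^d$, any $k,s,\ell\in\mathbb{N}$ (with $2\le k\le s$) and $\epsilon>0$, the random variable $B_H$ computed by the Hoeffding Monte Carlo procedure (see context) satisfies $\operatorname{IP}(X,k)\ge B_H$ with probability at least $1-\epsilon$ (probability over the procedure's randomness). (b) Let $\mu_1,\dots,\mu_k\in\mathbb{R}^d$ be arbitrary, draw $X:=\{x_i\}_{i\in[n]}$ independently from the Gaussian mixture $\mathsf{GMM}(\{(\mu_t,I_d,\frac1k)\}_{t\in[k]})$, let $s,\ell\in\mathbb{N}$, $\epsilon>0$, assume $n\ge s\ge d\ge k$, and compute $B_H$. If $s\ge 15d\log d$ and $\ell\ge 128(d+3\log n)^2\log(1/\epsilon)$, then \[B_H\ge \frac{d-6k-2}{d+1}\cdot\operatorname{IP}(X,k)\] with probability at least $1-\frac1n-e^{-\Omega(n/(d+\log n)^2)}-\epsilon$ (probability over both $X$ and the procedure), where $\Omega(\cdot)$ hides an absolute positive constant.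
   Context: For a tuple $Y=\{y_j\}_{j\in[m]}$ in $\mathbb{R}^d$ (repeats allowed), $m\ge k$: $\operatorname{IP}(Y,k):=\min_{\Gamma}\frac1m\sum_{S\in\Gamma}\sum_{j\in S}\|y_j-c_S\|^2$ over partitions $\Gamma$ of $[m]$ into $k$ nonempty sets, $c_S$ the mean of $\{y_j\}_{j\in S}$; $\operatorname{SDP}(Y,k):=\min\{\frac1{2m}\operatorname{tr}(D_YZ): Z\in\mathbb{R}^{m\times m}, Z\mathbf1=\mathbf1, \operatorname{tr}Z=k, Z\ge0 \text{ entrywise}, Z\succeq0\}$ where $(D_Y)_{ij}=\|y_i-y_j\|^2$. Deterministic $k$-means++ initialization: $i_1:=1$, and iteratively $i_{t+1}\in\arg\max_{i\in[n]}\min_{j\in[t]}\|x_i-x_{i_j}\|$ for $t<k$. Hoeffding Monte Carlo procedure: run deterministic $k$-means++ initialization and set $b:=\max_{i\in[n]}\min_{j\in[k]}\|x_i-x_{i_j}\|^2$; draw $Y_1,\dots,Y_\ell$ independently, each consisting of $s$ points drawn uniformly from $X$ with replacement; output $B_H:=\frac1\ell\sum_{i\in[\ell]}\operatorname{SDP}(Y_i,k)-\big(\frac{b^2}{2\ell}\log\frac1\epsilon\big)^{1/2}$. $x\sim\mathsf{GMM}(\{(\mu_t,I_d,\frac1k)\}_{t\in[k]})$ means: draw $T$ uniformly from $[k]$, then $x\sim\mathsf N(\mu_T,I_d)$. Logarithms are natural. *)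

theory Defs
  imports "HOL-Probability.Probability" "HOL-Library.Disjoint_Sets"
begin

text \<open>Points of R^d are represented as functions nat => real; only the coordinates
  0..d-1 matter. A tuple of m points is a function nat => (nat => real) indexed by 0..m-1.\<close>

definition sqdist :: "nat \<Rightarrow> (nat \<Rightarrow> real) \<Rightarrow> (nat \<Rightarrow> real) \<Rightarrow> real" where
  "sqdist d x y = (\<Sum>i<d. (x i - y i)^2)"

definition edist :: "nat \<Rightarrow> (nat \<Rightarrow> real) \<Rightarrow> (nat \<Rightarrow> real) \<Rightarrow> real" where
  "edist d x y = sqrt (sqdist d x y)"

definition centroid :: "(nat \<Rightarrow> nat \<Rightarrow> real) \<Rightarrow> nat set \<Rightarrow> (nat \<Rightarrow> real)" where
  "centroid Y S = (\<lambda>i. (\<Sum>j\<in>S. Y j i) / real (card S))"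

definition kmeans_cost :: "nat \<Rightarrow> (nat \<Rightarrow> nat \<Rightarrow> real) \<Rightarrow> nat \<Rightarrow> nat set set \<Rightarrow> real" where
  "kmeans_cost d Y m P = (1 / real m) * (\<Sum>S\<in>P. \<Sum>j\<in>S. sqdist d (Y j) (centroid Y S))"

definition IP :: "nat \<Rightarrow> (nat \<Rightarrow> nat \<Rightarrow> real) \<Rightarrow> nat \<Rightarrow> nat \<Rightarrow> real" where
  "IP d Y m k = Min {kmeans_cost d Y m P | P. partition_on {..<m} P \<and> card P = k}"

definition psd :: "nat \<Rightarrow> (nat \<Rightarrow> nat \<Rightarrow> real) \<Rightarrow> bool" where
  "psd m Z \<longleftrightarrow> (\<forall>i<m. \<forall>j<m. Z i j = Z j i) \<and>
     (\<forall>v :: nat \<Rightarrow> real. 0 \<le> (\<Sum>i<m. \<Sum>j<m. v i * Z i j * v j))"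

definition sdp_feasible :: "nat \<Rightarrow> nat \<Rightarrow> (nat \<Rightarrow> nat \<Rightarrow> real) \<Rightarrow> bool" where
  "sdp_feasible m k Z \<longleftrightarrow> (\<forall>i<m. (\<Sum>j<m. Z i j) = 1) \<and> (\<Sum>i<m. Z i i) = real k \<and>
     (\<forall>i<m. \<forall>j<m. 0 \<le> Z i j) \<and> psd m Z"

definition SDP :: "nat \<Rightarrow> (nat \<Rightarrow> nat \<Rightarrow> real) \<Rightarrow> nat \<Rightarrow> nat \<Rightarrow> real" where
  "SDP d Y m k = Inf {(1 / (2 * real m)) * (\<Sum>i<m. \<Sum>j<m. sqdist d (Y i) (Y j) * Z j i) | Z.
                       sdp_feasible m k Z}"

text \<open>Deterministic k-means++ initialization (0-based: i_1 is index 0; idx t is i_{t+1}).\<close>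
definition kmpp_init :: "nat \<Rightarrow> nat \<Rightarrow> nat \<Rightarrow> (nat \<Rightarrow> nat \<Rightarrow> real) \<Rightarrow> (nat \<Rightarrow> nat) \<Rightarrow> bool" where
  "kmpp_init d n k X idx \<longleftrightarrow> idx 0 = 0 \<and>
     (\<forall>t. 0 < t \<and> t < k \<longrightarrow> idx t < n \<and>
        (\<forall>i<n. Min ((\<lambda>j. edist d (X i) (X (idx j))) ` {..<t})
               \<le> Min ((\<lambda>j. edist d (X (idx t)) (X (idx j))) ` {..<t})))"

definition kmpp_b :: "nat \<Rightarrow> nat \<Rightarrow> nat \<Rightarrow> (nat \<Rightarrow> nat \<Rightarrow> real) \<Rightarrow> (nat \<Rightarrow> nat) \<Rightarrow> real" where
  "kmpp_b d n k X idx = Max ((\<lambda>i. (Min ((\<lambda>j. edist d (X i) (X (idx j))) ` {..<k}))^2) ` {..<n})"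

text \<open>Randomness of the procedure: sigma i j is the index of the j-th point of Y_{i+1},
  all i.i.d. uniform on [n].\<close>
definition sampler :: "nat \<Rightarrow> nat \<Rightarrow> nat \<Rightarrow> (nat \<Rightarrow> nat \<Rightarrow> nat) pmf" where
  "sampler n s l = Pi_pmf {..<l} (\<lambda>_. 0) (\<lambda>_. Pi_pmf {..<s} 0 (\<lambda>_. pmf_of_set {..<n}))"

definition B_H :: "nat \<Rightarrow> nat \<Rightarrow> nat \<Rightarrow> nat \<Rightarrow> nat \<Rightarrow> real \<Rightarrow> (nat \<Rightarrow> nat \<Rightarrow> real)
     \<Rightarrow> (nat \<Rightarrow> nat) \<Rightarrow> (nat \<Rightarrow> nat \<Rightarrow> nat) \<Rightarrow> real" where
  "B_H d n k s l \<epsilon> X idx \<sigma> =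
     (1 / real l) * (\<Sum>i<l. SDP d (\<lambda>j. X (\<sigma> i j)) s k)
     - sqrt ((kmpp_b d n k X idx)^2 / (2 * real l) * ln (1 / \<epsilon>))"

definition gauss :: "nat \<Rightarrow> (nat \<Rightarrow> real) \<Rightarrow> (nat \<Rightarrow> real) measure" where
  "gauss d mu = PiM {..<d} (\<lambda>i. density lborel (normal_density (mu i) 1))"

definition gmm :: "nat \<Rightarrow> nat \<Rightarrow> (nat \<Rightarrow> nat \<Rightarrow> real) \<Rightarrow> (nat \<Rightarrow> real) measure" where
  "gmm d k mu = bind (measure_pmf (pmf_of_set {..<k})) (\<lambda>t. gauss d (mu t))"

definition gmm_data :: "nat \<Rightarrow> nat \<Rightarrow> nat \<Rightarrow> (nat \<Rightarrow> nat \<Rightarrow> real) \<Rightarrow> (nat \<Rightarrow> nat \<Rightarrow> real) measure" where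
  "gmm_data d n k mu = PiM {..<n} (\<lambda>_. gmm d k mu)"

end

theory Submission
  imports Defs
begin

text \<open>
  \<^bold>\<open>(a)\<close> The relaxation of a sample is at most the average squared distance of the sample to any
  k centres. With the optimal centres of X this gives that its mean is at most IP(X, k); with the
  initialization centres it gives values in [0, b]. Hoeffding's inequality does the rest. Ties in
  the initialization are harmless, since only the smallest possible b matters.

  \<^bold>\<open>(b)\<close> Write every point as a mean plus a standard Gaussian noise vector. With probability at
  least 1 - 1/n all noise vectors have squared norm below R = 2 d + 6 ln n, so b \<open>\<le>\<close> 4 R and the
  correction term of \<open>B_H\<close> is at most 1/2.

  If d < 6 k + 2, the factor of IP is negative and it suffices that IP is not too small. This is a
  union bound over all assignments; for a fixed one, adding the points one by one and conditioning
  on the past bounds the Laplace transform of the cost.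

  If d \<open>\<ge>\<close> 6 k + 2, projecting away the span of the means shows that the relaxation of a sample is
  at least its average squared noise norm, minus the part of it inside the span (about k), minus k
  times the operator norm of the empirical noise covariance. The mean of this operator norm over
  the sampling is at most 4.5: points drawn at most r = 2 ln d times are handled by a moment
  generating function over a grid, the few others by their trace. As a function of the data this
  mean has bounded differences after truncating the noise at R, so McDiarmid's inequality
  concentrates it if n is large against (d + ln n)^2; otherwise Markov's inequality suffices,
  because a failure probability bounded away from 1 is enough there. If n < 3200 d there is
  nothing to prove.
\<close>

subsection \<open>Partitions and the semidefinite relaxation\<close>

text \<open>The constants fit together as follows. In high dimension the relaxation of a sample has
  mean at least (d - 1) - 5k/4 - 19k/4 = d - 1 - 6k over the draws: noise norm, its part inside the
  span of the means, k times the operator norm. The deviation of the sample mean costs 1/8 and the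
  correction term 1/2, so \<open>B_H\<close> is at least d - 6k - 2, while \<open>IP\<close> is at
  most d + 1; their quotient is the claimed factor. This leaves no room for the constant that a
  standard net argument loses, hence rounding to a grid with explicit constants. Sampling with
  replacement repeats points, and a point drawn m times enters the covariance with weight m. Large
  weights shrink the range in which exponential moments exist, hence the cap r; its price of about
  12 d ln d is what s \<ge> 15 d ln d pays for. The means are arbitrary and are never estimated.
  Upper bounds on costs use the true labels as an assignment; lower bounds use that a Gaussian
  Laplace transform of a squared distance is largest when the Gaussian is centred at the
  target.\<close>

lemma sqdist_nonneg: "0 \<le> sqdist d x y"
  by (simp add: sqdist_def sum_nonneg)

lemma sqdist_commute: "sqdist d x y = sqdist d y x"
  by (simp add: sqdist_def power2_commute)

section \<open>Assignments and partitions with exactly k blocks\<close>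

lemma exists_onto_refinement:
  assumes "k \<le> m" and "\<forall>j<m. a j < k"
  shows "\<exists>a'. a' ` {..<m} = {..<k::nat} \<and> (\<forall>i<m. \<forall>j<m. a' i = a' j \<longrightarrow> a i = (a j :: nat))"
proof -
  have "\<exists>a'. a' ` {..<m} \<subseteq> {..<k} \<and> card (a' ` {..<m}) = card (a ` {..<m}) + q \<and>
      (\<forall>i<m. \<forall>j<m. a' i = a' j \<longrightarrow> a i = (a j :: nat))" if "card (a ` {..<m}) + q \<le> k" for q
    using that
  proof (induction q)
    case 0
    then show ?case using assms by (intro exI[of _ a]) auto
  next
    case (Suc q)
    have "card (a ` {..<m}) + q \<le> k" using Suc.prems by simp
    from Suc.IH[OF this] obtain a' where a': "a' ` {..<m} \<subseteq> {..<k}" "card (a' ` {..<m}) = card (a ` {..<m}) + q"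
      "\<forall>i<m. \<forall>j<m. a' i = a' j \<longrightarrow> a i = (a j :: nat)" by blast
    have lt: "card (a' ` {..<m}) < k" using Suc.prems a'(2) by simp
    then have "card (a' ` {..<m}) < card {..<m}" using assms by simp
    then have "\<not> inj_on a' {..<m}" using card_image by fastforce
    then obtain i j where ij: "i < m" "j < m" "i \<noteq> j" "a' i = a' j" by (auto simp: inj_on_def)
    have "a' ` {..<m} \<noteq> {..<k}" using lt by auto
    then obtain t where t: "t < k" "t \<notin> a' ` {..<m}" using a'(1) by blast
    let ?b = "a'(i := t)"
    have im: "?b ` {..<m} = insert t (a' ` {..<m})"
    proof -
      have "a' x \<in> ?b ` {..<m}" if "x < m" for x
      proof (cases "x = i")
        case True
        then have "a' x = ?b j" using ij by simp
        then show ?thesis using ij by blast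
      next
        case False
        then have "a' x = ?b x" by simp
        then show ?thesis using that by blast
      qed
      moreover have "t \<in> ?b ` {..<m}" using ij by (intro image_eqI[of _ _ i]) auto
      ultimately show ?thesis by auto
    qed
    show ?case
    proof (intro exI[of _ ?b] conjI allI impI)
      show "?b ` {..<m} \<subseteq> {..<k}" using im t a'(1) by auto
      show "card (?b ` {..<m}) = card (a ` {..<m}) + Suc q" using im t a'(2) by simp
      fix x y assume xy: "x < m" "y < m" "?b x = ?b y"
      have "a' x \<noteq> t" "a' y \<noteq> t" using t(2) xy by auto
      then have "a' x = a' y" using xy(3) by (cases "x = i"; cases "y = i") simp_all
      then show "a x = a y" using a'(3) xy by blast
    qed
  qed
  moreover have "card (a ` {..<m}) \<le> k"
    using card_mono[of "{..<k}" "a ` {..<m}"] assms by auto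
  ultimately obtain a' where a': "a' ` {..<m} \<subseteq> {..<k}" "card (a' ` {..<m}) = k"
      "\<forall>i<m. \<forall>j<m. a' i = a' j \<longrightarrow> a i = (a j :: nat)"
    by (metis le_add_diff_inverse order_refl)
  then show ?thesis by (metis card_lessThan card_subset_eq finite_lessThan)
qed

lemma exists_refining_partition:
  assumes "k \<le> m" and "\<forall>j<m. a j < k"
  shows "\<exists>P. partition_on {..<m} P \<and> card P = k \<and> (\<forall>S\<in>P. \<exists>t::nat. \<forall>j\<in>S. a j = t)"
proof -
  obtain a' where a': "a' ` {..<m} = {..<k}" "\<forall>i<m. \<forall>j<m. a' i = a' j \<longrightarrow> a i = a j"
    using exists_onto_refinement[OF assms] by blast
  define F where "F t = {j. j < m \<and> a' j = t}" for t
  have ne: "F t \<noteq> {}" if "t < k" for t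
  proof -
    have "t \<in> a' ` {..<m}" using that a' by simp
    then show ?thesis by (auto simp: F_def)
  qed
  have inj: "inj_on F {..<k}"
  proof (rule inj_onI)
    fix x y assume xy: "x \<in> {..<k}" "y \<in> {..<k}" "F x = F y"
    then obtain i where i: "i \<in> F x" using ne[of x] by auto
    then have "i \<in> F y" using xy by simp
    with i show "x = y" by (simp add: F_def)
  qed
  show ?thesis
  proof (intro exI[of _ "F ` {..<k}"] conjI)
    show "partition_on {..<m} (F ` {..<k})"
    proof (rule partition_onI)
      have "a' j < k" if "j < m" for j using a'(1) that by blast
      then show "\<Union> (F ` {..<k}) = {..<m}" by (auto simp: F_def)
      show "{} \<notin> F ` {..<k}" using ne by (metis imageE lessThan_iff)
      show "disjnt p p'" if "p \<in> F ` {..<k}" "p' \<in> F ` {..<k}" "p \<noteq> p'" for p p'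
      proof -
        note prems = that
        obtain x y where "p = F x" "p' = F y" using prems by blast
        then show ?thesis using prems(3) by (auto simp: F_def disjnt_def)
      qed
    qed
    show "card (F ` {..<k}) = k" using inj by (simp add: card_image)
    show "\<forall>S\<in>F ` {..<k}. \<exists>t. \<forall>j\<in>S. a j = t"
    proof
      fix S assume "S \<in> F ` {..<k}"
      then obtain t where S: "S = F t" "t < k" by auto
      then obtain i where "i \<in> S" using ne by blast
      then have "a j = a i" if "j \<in> S" for j
        using a'(2)[rule_format, of j i] that S by (simp add: F_def)
      then show "\<exists>t. \<forall>j\<in>S. a j = t" by blast
    qed
  qed
qed

section \<open>Sums of squares about a mean\<close>

lemma sum_sq_pairs:
  fixes x :: "'a \<Rightarrow> real"
  assumes "finite S"
  shows "(\<Sum>i\<in>S. \<Sum>j\<in>S. (x i - x j)\<^sup>2) = 2 * real (card S) * (\<Sum>i\<in>S. (x i)\<^sup>2) - 2 * (\<Sum>i\<in>S. x i)\<^sup>2"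
proof -
  have "(\<Sum>i\<in>S. \<Sum>j\<in>S. (x i - x j)\<^sup>2)
      = (\<Sum>i\<in>S. \<Sum>j\<in>S. (x i)\<^sup>2 + (x j)\<^sup>2 - 2 * (x i * x j))"
    by (simp add: power2_diff algebra_simps)
  also have "\<dots> = 2 * real (card S) * (\<Sum>i\<in>S. (x i)\<^sup>2) - 2 * (\<Sum>i\<in>S. x i)\<^sup>2"
    by (simp add: sum.distrib sum_subtractf sum_distrib_left[symmetric] power2_eq_square sum_product)
  finally show ?thesis .
qed

text \<open>The parallel axis (Steiner) identity. It gives both the optimality of centroids and the
  update formula for a class that gains a point.\<close>

lemma sum_sq_about:
  fixes x :: "'a \<Rightarrow> real"
  assumes "finite S" "S \<noteq> {}"
  shows "(\<Sum>i\<in>S. (x i - c)\<^sup>2) = (\<Sum>i\<in>S. (x i - (\<Sum>j\<in>S. x j) / real (card S))\<^sup>2)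
     + real (card S) * ((\<Sum>j\<in>S. x j) / real (card S) - c)\<^sup>2"
proof -
  define m where "m = (\<Sum>j\<in>S. x j) / real (card S)"
  have c: "real (card S) > 0" using assms by (simp add: card_gt_0_iff)
  have m: "(\<Sum>j\<in>S. x j) = real (card S) * m" using c by (simp add: m_def)
  have "(\<Sum>i\<in>S. (x i - c)\<^sup>2) = (\<Sum>i\<in>S. (x i - m)\<^sup>2 + (m - c)\<^sup>2 + 2 * (m - c) * (x i - m))"
    by (intro sum.cong refl) (simp add: power2_eq_square algebra_simps)
  also have "\<dots> = (\<Sum>i\<in>S. (x i - m)\<^sup>2) + real (card S) * (m - c)\<^sup>2 + 2 * (m - c) * ((\<Sum>i\<in>S. x i) - real (card S) * m)"
    by (simp add: sum.distrib sum_distrib_left[symmetric] sum_subtractf)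
  finally show ?thesis unfolding m_def[symmetric] using m by simp
qed

lemma sum_sqdist_swap: "(\<Sum>j\<in>S. sqdist d (Y j) c) = (\<Sum>i<d. \<Sum>j\<in>S. (Y j i - c i)\<^sup>2)"
  unfolding sqdist_def by (rule sum.swap)

lemma sqdist_centroid_le:
  assumes "finite S"
  shows "(\<Sum>j\<in>S. sqdist d (Y j) (centroid Y S)) \<le> (\<Sum>j\<in>S. sqdist d (Y j) c)"
proof (cases "S = {}")
  case False
  have "(\<Sum>j\<in>S. sqdist d (Y j) (centroid Y S)) = (\<Sum>i<d. \<Sum>j\<in>S. (Y j i - centroid Y S i)\<^sup>2)"
    by (rule sum_sqdist_swap)
  also have "\<dots> \<le> (\<Sum>i<d. \<Sum>j\<in>S. (Y j i - c i)\<^sup>2)"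
  proof (rule sum_mono)
    fix i
    show "(\<Sum>j\<in>S. (Y j i - centroid Y S i)\<^sup>2) \<le> (\<Sum>j\<in>S. (Y j i - c i)\<^sup>2)"
      unfolding sum_sq_about[OF assms False, of "\<lambda>j. Y j i" "c i"] by (simp add: centroid_def)
  qed
  also have "\<dots> = (\<Sum>j\<in>S. sqdist d (Y j) c)" by (rule sum_sqdist_swap[symmetric])
  finally show ?thesis .
qed simp

text \<open>Links the pairwise distances in the objective of \<open>SDP\<close> to the centroids in
  that of \<open>IP\<close>; the 2 here is the 2 in the normalisation 1/(2m).\<close>

lemma sqdist_pairs_centroid:
  assumes "finite S" "S \<noteq> {}"
  shows "(\<Sum>i\<in>S. \<Sum>j\<in>S. sqdist d (Y i) (Y j)) = 2 * real (card S) * (\<Sum>j\<in>S. sqdist d (Y j) (centroid Y S))"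
proof -
  have c: "real (card S) > 0" using assms by (simp add: card_gt_0_iff)
  have *: "(\<Sum>i\<in>S. \<Sum>j\<in>S. (Y i l - Y j l)\<^sup>2) = 2 * real (card S) * (\<Sum>j\<in>S. (Y j l - centroid Y S l)\<^sup>2)" for l
  proof -
    have "(\<Sum>i\<in>S. (Y i l)\<^sup>2) = (\<Sum>j\<in>S. (Y j l - centroid Y S l)\<^sup>2) + real (card S) * (centroid Y S l)\<^sup>2"
      using sum_sq_about[OF assms, of "\<lambda>i. Y i l" 0] by (simp add: centroid_def)
    moreover have "(\<Sum>i\<in>S. Y i l) = real (card S) * centroid Y S l" using c by (simp add: centroid_def)
    ultimately have "(\<Sum>i\<in>S. \<Sum>j\<in>S. (Y i l - Y j l)\<^sup>2) = 2 * real (card S) *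
        ((\<Sum>j\<in>S. (Y j l - centroid Y S l)\<^sup>2) + real (card S) * (centroid Y S l)\<^sup>2) - 2 * (real (card S) * centroid Y S l)\<^sup>2"
      by (simp only: sum_sq_pairs[OF assms(1)])
    then show ?thesis by (simp only: power2_eq_square[of "real (card S) * _"] power2_eq_square[of "centroid Y S l"]) (simp add: algebra_simps)
  qed
  have "(\<Sum>i\<in>S. \<Sum>j\<in>S. sqdist d (Y i) (Y j)) = (\<Sum>i\<in>S. \<Sum>l<d. \<Sum>j\<in>S. (Y i l - Y j l)\<^sup>2)"
    unfolding sqdist_def by (rule sum.cong[OF refl]) (rule sum.swap)
  also have "\<dots> = (\<Sum>l<d. \<Sum>i\<in>S. \<Sum>j\<in>S. (Y i l - Y j l)\<^sup>2)" by (rule sum.swap)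
  also have "\<dots> = 2 * real (card S) * (\<Sum>l<d. \<Sum>j\<in>S. (Y j l - centroid Y S l)\<^sup>2)"
    by (simp add: * sum_distrib_left)
  also have "(\<Sum>l<d. \<Sum>j\<in>S. (Y j l - centroid Y S l)\<^sup>2) = (\<Sum>j\<in>S. sqdist d (Y j) (centroid Y S))"
    by (rule sum_sqdist_swap[symmetric])
  finally show ?thesis .
qed

section \<open>Partition matrices as feasible points\<close>

text \<open>For a partition this is the orthogonal projection onto the span of the block indicators,
  so its trace is the number of blocks.\<close>

definition partition_matrix :: "nat set set \<Rightarrow> nat \<Rightarrow> nat \<Rightarrow> real" where
  "partition_matrix P i j = (\<Sum>S\<in>P. indicat_real S i * indicat_real S j / real (card S))"

lemma partition_on_lessThanD:
  assumes "partition_on {..<m::nat} P" "S \<in> P"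
  shows "finite P" "finite S" "S \<noteq> {}" "S \<subseteq> {..<m}" "real (card S) > 0"
proof -
  show "finite P" using assms finite_elements by blast
  show S: "S \<subseteq> {..<m}" using assms by (auto simp: partition_on_def)
  then show "finite S" using finite_subset by blast
  moreover show "S \<noteq> {}" using assms by (auto simp: partition_on_def)
  ultimately show "real (card S) > 0" by (simp add: card_gt_0_iff)
qed

lemma sum_indicator_subset:
  fixes f :: "nat \<Rightarrow> real"
  assumes "S \<subseteq> {..<m}"
  shows "(\<Sum>i<m. indicat_real S i * f i) = (\<Sum>i\<in>S. f i)"
proof -
  have "(\<Sum>i<m. indicat_real S i * f i) = (\<Sum>i\<in>S. indicat_real S i * f i)"
    using assms by (intro sum.mono_neutral_right) (auto simp: indicator_def)
  also have "\<dots> = (\<Sum>i\<in>S. f i)" by (intro sum.cong) auto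
  finally show ?thesis .
qed

lemma partition_matrix_sum:
  assumes P: "partition_on {..<m} P"
  shows "(\<Sum>i<m. \<Sum>j<m. f i j * partition_matrix P i j) = (\<Sum>S\<in>P. (\<Sum>i\<in>S. \<Sum>j\<in>S. f i j) / real (card S))"
proof -
  have "(\<Sum>i<m. \<Sum>j<m. f i j * partition_matrix P i j)
    = (\<Sum>i<m. \<Sum>j<m. \<Sum>S\<in>P. f i j * (indicat_real S i * indicat_real S j / real (card S)))"
    unfolding partition_matrix_def by (simp only: sum_distrib_left)
  also have "\<dots> = (\<Sum>i<m. \<Sum>S\<in>P. \<Sum>j<m. f i j * (indicat_real S i * indicat_real S j / real (card S)))"
    by (intro sum.cong refl, rule sum.swap)
  also have "\<dots> = (\<Sum>S\<in>P. \<Sum>i<m. \<Sum>j<m. f i j * (indicat_real S i * indicat_real S j / real (card S)))"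
    by (rule sum.swap)
  also have "\<dots> = (\<Sum>S\<in>P. (\<Sum>i\<in>S. \<Sum>j\<in>S. f i j) / real (card S))"
  proof (intro sum.cong refl)
    fix S assume S: "S \<in> P"
    have "(\<Sum>i<m. \<Sum>j<m. f i j * (indicat_real S i * indicat_real S j / real (card S)))
        = (\<Sum>i<m. indicat_real S i * (\<Sum>j<m. indicat_real S j * (f i j / real (card S))))"
      by (simp only: sum_distrib_left) (intro sum.cong refl, simp)
    also have "\<dots> = (\<Sum>i\<in>S. \<Sum>j\<in>S. f i j) / real (card S)"
      by (simp only: sum_indicator_subset[OF partition_on_lessThanD(4)[OF P S]] sum_divide_distrib)
    finally show "(\<Sum>i<m. \<Sum>j<m. f i j * (indicat_real S i * indicat_real S j / real (card S)))
       = (\<Sum>i\<in>S. \<Sum>j\<in>S. f i j) / real (card S)" .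
  qed
  finally show ?thesis .
qed

lemma sdp_feasible_partition_matrix:
  assumes P: "partition_on {..<m} P" and k: "card P = k"
  shows "sdp_feasible m k (partition_matrix P)"
  unfolding sdp_feasible_def psd_def
proof (intro conjI allI impI)
  note D = partition_on_lessThanD[OF P]
  fix i assume i: "i < m"
  have "(\<Sum>j<m. partition_matrix P i j) = (\<Sum>S\<in>P. \<Sum>j<m. indicat_real S j * (indicat_real S i / real (card S)))"
    unfolding partition_matrix_def by (subst sum.swap) (simp add: mult_ac)
  also have "\<dots> = (\<Sum>S\<in>P. indicat_real S i)"
    using D by (intro sum.cong refl) (simp only: sum_indicator_subset, simp)
  also have "\<dots> = 1"
  proof -
    obtain S where S: "S \<in> P" "i \<in> S" using P i by (auto simp: partition_on_def)
    have "i \<notin> S'" if "S' \<in> P - {S}" for S'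
      using disjointD[OF partition_onD2[OF P], of S S'] S that by auto
    then have "(\<Sum>S\<in>P. indicat_real S i) = (\<Sum>S'\<in>{S}. indicat_real S' i :: real)"
      using S D(1)[OF S(1)] by (intro sum.mono_neutral_right) auto
    then show ?thesis using S by simp
  qed
  finally show "(\<Sum>j<m. partition_matrix P i j) = 1" .
next
  note D = partition_on_lessThanD[OF P]
  have "(\<Sum>i<m. partition_matrix P i i) = (\<Sum>S\<in>P. \<Sum>i<m. indicat_real S i * (1 / real (card S)))"
    unfolding partition_matrix_def by (subst sum.swap) (auto simp: indicator_def intro!: sum.cong)
  also have "\<dots> = (\<Sum>S\<in>P. 1)"
    using D by (intro sum.cong refl) (simp only: sum_indicator_subset, simp)
  finally show "(\<Sum>i<m. partition_matrix P i i) = real k" using k by simp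
next
  fix i j show "0 \<le> partition_matrix P i j" unfolding partition_matrix_def by (intro sum_nonneg) auto
next
  fix i j show "partition_matrix P i j = partition_matrix P j i"
    unfolding partition_matrix_def by (simp add: mult_ac)
next
  fix v :: "nat \<Rightarrow> real"
  have "(\<Sum>i<m. \<Sum>j<m. v i * partition_matrix P i j * v j)
      = (\<Sum>i<m. \<Sum>j<m. (v i * v j) * partition_matrix P i j)" by (simp add: mult_ac)
  also have "\<dots> = (\<Sum>S\<in>P. (\<Sum>i\<in>S. v i)\<^sup>2 / real (card S))"
    by (simp add: partition_matrix_sum[OF P] power2_eq_square sum_product)
  also have "\<dots> \<ge> 0" by (intro sum_nonneg) auto
  finally show "0 \<le> (\<Sum>i<m. \<Sum>j<m. v i * partition_matrix P i j * v j)" .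
qed

lemma sdp_objective_partition_matrix:
  assumes P: "partition_on {..<m} P"
  shows "(1 / (2 * real m)) * (\<Sum>i<m. \<Sum>j<m. sqdist d (Y i) (Y j) * partition_matrix P j i) = kmeans_cost d Y m P"
proof -
  have "(\<Sum>i<m. \<Sum>j<m. sqdist d (Y i) (Y j) * partition_matrix P j i)
      = (\<Sum>i<m. \<Sum>j<m. sqdist d (Y i) (Y j) * partition_matrix P i j)"
    unfolding partition_matrix_def by (simp add: mult_ac)
  also have "\<dots> = (\<Sum>S\<in>P. 2 * (\<Sum>j\<in>S. sqdist d (Y j) (centroid Y S)))"
    unfolding partition_matrix_sum[OF P]
    using partition_on_lessThanD[OF P] by (intro sum.cong refl) (subst sqdist_pairs_centroid, auto)
  finally show ?thesis unfolding kmeans_cost_def by (simp add: sum_distrib_left[symmetric])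
qed

lemma sdp_objective_nonneg:
  assumes "sdp_feasible m k Z"
  shows "0 \<le> (1 / (2 * real m)) * (\<Sum>i<m. \<Sum>j<m. sqdist d (Y i) (Y j) * Z j i)"
  using assms unfolding sdp_feasible_def
  by (intro mult_nonneg_nonneg sum_nonneg) (auto simp: sqdist_nonneg)

section \<open>Comparing relaxation and optimum with assignments\<close>

lemma SDP_le_objective:
  assumes "sdp_feasible m k Z"
  shows "SDP d Y m k \<le> (1 / (2 * real m)) * (\<Sum>i<m. \<Sum>j<m. sqdist d (Y i) (Y j) * Z j i)"
  unfolding SDP_def
proof (rule cInf_lower)
  show "bdd_below {(1 / (2 * real m)) * (\<Sum>i<m. \<Sum>j<m. sqdist d (Y i) (Y j) * Z j i) | Z. sdp_feasible m k Z}"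
    using sdp_objective_nonneg by (intro bdd_belowI[of _ 0]) blast
qed (use assms in blast)

lemma exists_sdp_feasible:
  assumes "0 < k" "k \<le> m" shows "\<exists>Z. sdp_feasible m k Z"
proof -
  obtain P where "partition_on {..<m} P" "card P = k"
    using exists_refining_partition[of k m "\<lambda>_. 0"] assms by auto
  then show ?thesis using sdp_feasible_partition_matrix by blast
qed

text \<open>\<open>SDP\<close> is an infimum of reals, so a lower bound needs a nonempty feasible
  set; this is what the bounds on k provide.\<close>

lemma SDP_geI:
  assumes "0 < k" "k \<le> m"
    and "\<And>Z. sdp_feasible m k Z \<Longrightarrow> L \<le> (1 / (2 * real m)) * (\<Sum>i<m. \<Sum>j<m. sqdist d (Y i) (Y j) * Z j i)"
  shows "L \<le> SDP d Y m k"
  unfolding SDP_def by (rule cInf_greatest) (use assms exists_sdp_feasible in auto)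

lemma SDP_nonneg:
  assumes "0 < k" "k \<le> m" shows "0 \<le> SDP d Y m k"
  by (rule SDP_geI[OF assms]) (rule sdp_objective_nonneg)

lemma SDP_le_kmeans_cost:
  assumes "partition_on {..<m} P" "card P = k"
  shows "SDP d Y m k \<le> kmeans_cost d Y m P"
  using SDP_le_objective[OF sdp_feasible_partition_matrix[OF assms]] sdp_objective_partition_matrix[OF assms(1)]
  by simp

lemma finite_partition_costs: "finite {kmeans_cost d Y m P | P. partition_on {..<m} P \<and> card P = k}"
proof -
  have "{P. partition_on {..<m} P} \<subseteq> Pow (Pow {..<m})" by (auto simp: partition_on_def)
  then have "finite {P. partition_on {..<m} P}" using finite_subset by blast
  then have "finite (kmeans_cost d Y m ` {P. partition_on {..<m} P})" by simp
  then show ?thesis by (rule rev_finite_subset) auto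
qed

lemma IP_le_kmeans_cost:
  assumes "partition_on {..<m} P" "card P = k"
  shows "IP d Y m k \<le> kmeans_cost d Y m P"
  unfolding IP_def by (rule Min_le[OF finite_partition_costs]) (use assms in auto)

lemma IP_attained:
  assumes "0 < k" "k \<le> m"
  shows "\<exists>P. partition_on {..<m} P \<and> card P = k \<and> IP d Y m k = kmeans_cost d Y m P"
proof -
  obtain P where "partition_on {..<m} P" "card P = k"
    using exists_refining_partition[of k m "\<lambda>_. 0"] assms by auto
  then have "{kmeans_cost d Y m P | P. partition_on {..<m} P \<and> card P = k} \<noteq> {}" by auto
  from Min_in[OF finite_partition_costs this] show ?thesis unfolding IP_def by auto
qed

text \<open>All upper bounds on \<open>IP\<close> and \<open>SDP\<close> come from here. Refining
  the classes of \<open>a\<close> keeps one centre per block, and the centroid of a block is at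
  least as good as that centre.\<close>

lemma exists_partition_cost_le_assignment:
  assumes "k \<le> m" and "\<forall>j<m. a j < k"
  shows "\<exists>P. partition_on {..<m} P \<and> card P = k \<and>
     kmeans_cost d Y m P \<le> (1 / real m) * (\<Sum>j<m. sqdist d (Y j) (c (a j)))"
proof -
  obtain P where P: "partition_on {..<m} P" "card P = k" "\<forall>S\<in>P. \<exists>t. \<forall>j\<in>S. a j = t"
    using exists_refining_partition[OF assms] by blast
  note D = partition_on_lessThanD[OF P(1)]
  have "(\<Sum>S\<in>P. \<Sum>j\<in>S. sqdist d (Y j) (centroid Y S)) \<le> (\<Sum>S\<in>P. \<Sum>j\<in>S. sqdist d (Y j) (c (a j)))"
  proof (rule sum_mono)
    fix S assume S: "S \<in> P"
    then obtain t where "\<forall>j\<in>S. a j = t" using P by blast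
    then show "(\<Sum>j\<in>S. sqdist d (Y j) (centroid Y S)) \<le> (\<Sum>j\<in>S. sqdist d (Y j) (c (a j)))"
      using sqdist_centroid_le[of S d Y "c t"] D[OF S] by simp
  qed
  also have "\<dots> = (\<Sum>j<m. sqdist d (Y j) (c (a j)))"
    using sum.Union_disjoint[of P "\<lambda>j. sqdist d (Y j) (c (a j))"] D P(1)
    by (auto simp: partition_on_def disjoint_def)
  finally show ?thesis using P unfolding kmeans_cost_def by (intro exI[of _ P]) (auto intro!: divide_right_mono)
qed

lemma IP_le_assignment:
  assumes "k \<le> m" and "\<forall>j<m. a j < k"
  shows "IP d Y m k \<le> (1 / real m) * (\<Sum>j<m. sqdist d (Y j) (c (a j)))"
  using exists_partition_cost_le_assignment[OF assms, of d Y c] IP_le_kmeans_cost[of m _ k d Y] by force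

lemma SDP_le_assignment:
  assumes "k \<le> m" and "\<forall>j<m. a j < k"
  shows "SDP d Y m k \<le> (1 / real m) * (\<Sum>j<m. sqdist d (Y j) (c (a j)))"
  using exists_partition_cost_le_assignment[OF assms, of d Y c] SDP_le_kmeans_cost[of m _ k d Y] by force

text \<open>Partitions do not pass to a resample with repetitions, but centres with an assignment
  do; this form of the optimum can be evaluated at sampled indices.\<close>

lemma IP_attained_assignment:
  assumes "0 < k" "k \<le> m"
  shows "\<exists>a c. (\<forall>j<m. a j < k) \<and> IP d Y m k = (1 / real m) * (\<Sum>j<m. sqdist d (Y j) (c (a j)))"
proof -
  obtain P where P: "partition_on {..<m} P" "card P = k" "IP d Y m k = kmeans_cost d Y m P"
    using IP_attained[OF assms] by blast
  note D = partition_on_lessThanD[OF P(1)]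
  have "finite P" using P assms card_ge_0_finite by metis
  then obtain h where h: "bij_betw h {..<k} P" using P ex_bij_betw_nat_finite[of P] by (auto simp: atLeast0LessThan)
  define a where "a j = (SOME t. t < k \<and> j \<in> h t)" for j
  have ex: "\<exists>t. t < k \<and> j \<in> h t" if "j < m" for j
  proof -
    have "j \<in> \<Union>P" using P(1) that by (simp add: partition_on_def)
    then obtain S where "S \<in> P" "j \<in> S" by blast
    then show ?thesis using h by (auto simp: bij_betw_def)
  qed
  have a: "a j < k \<and> j \<in> h (a j)" if "j < m" for j
    unfolding a_def by (rule someI_ex[OF ex[OF that]])
  have aS: "h (a j) = S" if "j \<in> S" "S \<in> P" for j S
  proof -
    have "j < m" using that D(4)[OF that(2)] by auto
    then have "h (a j) \<in> P" "j \<in> h (a j)" using a h by (auto simp: bij_betw_def)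
    then show ?thesis using that P(1) by (auto simp: partition_on_def disjoint_def)
  qed
  have "(\<Sum>S\<in>P. \<Sum>j\<in>S. sqdist d (Y j) (centroid Y S)) = (\<Sum>S\<in>P. \<Sum>j\<in>S. sqdist d (Y j) (centroid Y (h (a j))))"
    using aS by (intro sum.cong refl) simp
  also have "\<dots> = (\<Sum>j<m. sqdist d (Y j) (centroid Y (h (a j))))"
    using sum.Union_disjoint[of P "\<lambda>j. sqdist d (Y j) (centroid Y (h (a j)))"] D P(1)
    by (auto simp: partition_on_def disjoint_def)
  finally show ?thesis using P a unfolding kmeans_cost_def
    by (intro exI[of _ a] exI[of _ "\<lambda>t. centroid Y (h t)"]) auto
qed

subsection \<open>Deterministic k-means++ initialization\<close>

lemma edist_nonneg: "0 \<le> edist d x y"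
  by (simp add: edist_def sqdist_nonneg)

lemma edist_commute: "edist d x y = edist d y x"
  by (simp add: edist_def sqdist_commute)

lemma edist_L2: "edist d x y = L2_set (\<lambda>i. x i - y i) {..<d}"
  by (simp add: edist_def sqdist_def L2_set_def)

lemma edist_triangle: "edist d x z \<le> edist d x y + edist d y z"
  using L2_set_triangle_ineq[of "\<lambda>i. x i - y i" "\<lambda>i. y i - z i" "{..<d}"] by (simp add: edist_L2)

lemma edist_power2: "(edist d x y)\<^sup>2 = sqdist d x y"
  by (simp add: edist_def sqdist_nonneg)

lemma kmpp_b_covers:
  assumes "0 < k" "i < n"
  shows "\<exists>j<k. sqdist d (X i) (X (idx j)) \<le> kmpp_b d n k X idx"
proof -
  let ?M = "Min ((\<lambda>j. edist d (X i) (X (idx j))) ` {..<k})"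
  have "?M \<in> (\<lambda>j. edist d (X i) (X (idx j))) ` {..<k}" using assms by (intro Min_in) auto
  then obtain j where j: "j < k" "?M = edist d (X i) (X (idx j))" by auto
  have "?M\<^sup>2 \<le> kmpp_b d n k X idx" unfolding kmpp_b_def using assms by (intro Max_ge) auto
  then show ?thesis using j by (auto simp: edist_power2)
qed

lemma kmpp_b_nonneg:
  assumes "0 < k" "0 < n" shows "0 \<le> kmpp_b d n k X idx"
  using kmpp_b_covers[OF assms, of d X idx] sqdist_nonneg order_trans by blast

lemma kmpp_init_less:
  assumes "kmpp_init d n k X idx" "0 < n" "t < k" shows "idx t < n"
  using assms unfolding kmpp_init_def by (cases "t = 0") auto

text \<open>Greedy farthest-point traversal is a 2-approximation: the chosen points together with a
  farthest one are pairwise at distance at least the square root of b, and two of these k + 1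
  points share a centre.\<close>

lemma kmpp_b_le:
  assumes init: "kmpp_init d n k X idx" and k: "0 < k" and n: "0 < n"
    and T: "\<forall>i<n. T i < k" and \<rho>: "\<forall>i<n. sqdist d (X i) (c (T i)) \<le> \<rho>"
  shows "kmpp_b d n k X idx \<le> 4 * \<rho>"
proof -
  let ?M = "\<lambda>t i. Min ((\<lambda>j. edist d (X i) (X (idx j))) ` {..<t})"
  have "kmpp_b d n k X idx \<in> (\<lambda>i. (?M k i)\<^sup>2) ` {..<n}"
    unfolding kmpp_b_def using n by (intro Max_in) auto
  then obtain i0 where i0: "i0 < n" "kmpp_b d n k X idx = (?M k i0)\<^sup>2" by auto
  define D where "D = ?M k i0"
  define p where "p t = (if t = k then i0 else idx t)" for t
  have p_n: "p t < n" if "t \<le> k" for t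
    using that kmpp_init_less[OF init n, of t] i0 by (auto simp: p_def)
  have far: "D \<le> edist d (X (p t')) (X (p t))" if "t < t'" "t' \<le> k" for t t'
  proof -
    \<comment> \<open>A minimum over fewer chosen points is larger, and the greedy choice at time t'
      maximises exactly this minimum.\<close>
    have "D \<le> ?M t' i0" unfolding D_def using that by (intro Min_antimono) auto
    also have "\<dots> \<le> ?M t' (p t')"
    proof (cases "t' = k")
      case False
      then have "0 < t'" "t' < k" using that by auto
      then show ?thesis using init i0(1) False unfolding kmpp_init_def p_def by auto
    qed (simp add: p_def)
    also have "\<dots> \<le> edist d (X (p t')) (X (idx t))" using that by (intro Min_le) auto
    finally show ?thesis using that by (simp add: p_def)
  qed
  have "\<not> inj_on (\<lambda>t. T (p t)) {..k}"
  proof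
    assume "inj_on (\<lambda>t. T (p t)) {..k}"
    then have "card ((\<lambda>t. T (p t)) ` {..k}) = Suc k" by (simp add: card_image)
    moreover have "(\<lambda>t. T (p t)) ` {..k} \<subseteq> {..<k}" using T p_n by auto
    ultimately show False using card_mono[of "{..<k}" "(\<lambda>t. T (p t)) ` {..k}"] by simp
  qed
  then obtain t1 t2 where tt: "t1 \<le> k" "t2 \<le> k" "t1 \<noteq> t2" "T (p t1) = T (p t2)"
    by (auto simp: inj_on_def)
  obtain t t' where t: "t < t'" "t' \<le> k" "T (p t) = T (p t')"
    using tt by (metis linorder_neqE_nat)
  have sq: "edist d (X i) (c (T i)) \<le> sqrt \<rho>" if "i < n" for i
    using \<rho> that by (simp add: edist_def)
  have "D \<le> edist d (X (p t')) (c (T (p t'))) + edist d (c (T (p t'))) (X (p t))"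
    using far[OF t(1,2)] edist_triangle order_trans by blast
  also have "\<dots> \<le> sqrt \<rho> + sqrt \<rho>"
    using sq[OF p_n, of t'] sq[OF p_n, of t] t by (simp add: edist_commute[of d "c _"])
  finally have "D \<le> 2 * sqrt \<rho>" by simp
  moreover have "0 \<le> D" unfolding D_def using k by (intro Min.boundedI) (auto simp: edist_nonneg)
  ultimately have "D\<^sup>2 \<le> (2 * sqrt \<rho>)\<^sup>2" by (rule power_mono)
  moreover have "0 \<le> \<rho>" using \<rho>[rule_format, OF n] sqdist_nonneg[of d "X 0" "c (T 0)"] by linarith
  ultimately have "D\<^sup>2 \<le> 4 * \<rho>" by (simp add: power_mult_distrib)
  then show ?thesis using i0(2) by (simp only: D_def)
qed

subsection \<open>Lower bound for the semidefinite relaxation\<close>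

definition dot :: "nat \<Rightarrow> (nat \<Rightarrow> real) \<Rightarrow> (nat \<Rightarrow> real) \<Rightarrow> real" where
  "dot d x y = (\<Sum>i<d. x i * y i)"

lemma dot_commute: "dot d x y = dot d y x"
  by (simp add: dot_def mult.commute)

lemma dot_nonneg: "0 \<le> dot d x x"
  by (simp add: dot_def sum_nonneg)

lemma dot_add_left: "dot d (\<lambda>i. x i + y i) z = dot d x z + dot d y z"
  by (simp add: dot_def sum.distrib distrib_right)

lemma dot_diff_left: "dot d (\<lambda>i. x i - y i) z = dot d x z - dot d y z"
  by (simp add: dot_def sum_subtractf left_diff_distrib)

lemma dot_scale_left: "dot d (\<lambda>i. c * x i) z = c * dot d x z"
  by (simp add: dot_def sum_distrib_left mult.assoc)

lemma dot_sum_left: "dot d (\<lambda>i. \<Sum>a\<in>A. f a i) z = (\<Sum>a\<in>A. dot d (f a) z)"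
  unfolding dot_def sum_distrib_right by (rule sum.swap)

lemma dot_diff_right: "dot d z (\<lambda>i. x i - y i) = dot d z x - dot d z y"
  by (simp add: dot_def sum_subtractf right_diff_distrib)

lemma dot_scale_right: "dot d z (\<lambda>i. c * x i) = c * dot d z x"
  by (simp add: dot_def sum_distrib_left mult_ac)

lemma dot_sum_right: "dot d z (\<lambda>i. \<Sum>a\<in>A. f a i) = (\<Sum>a\<in>A. dot d z (f a))"
  unfolding dot_def sum_distrib_left by (rule sum.swap)

lemma dot_cong: "(\<And>i. i < d \<Longrightarrow> x i = x' i) \<Longrightarrow> (\<And>i. i < d \<Longrightarrow> y i = y' i) \<Longrightarrow> dot d x y = dot d x' y'"
  by (simp add: dot_def)

lemma dot_eq_0_iff: "dot d x x = 0 \<longleftrightarrow> (\<forall>i<d. x i = 0)"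
  unfolding dot_def by (subst sum_nonneg_eq_0_iff) auto

lemma dot_Cauchy_Schwarz: "(dot d x y)\<^sup>2 \<le> dot d x x * dot d y y"
proof -
  have "(\<Sum>i<d. x i * y i)\<^sup>2 \<le> (\<Sum>i<d. (x i)\<^sup>2) * (\<Sum>i<d. (y i)\<^sup>2)"
    by (rule Cauchy_Schwarz_ineq_sum)
  then show ?thesis by (simp add: dot_def power2_eq_square)
qed

lemma sqdist_dot: "sqdist d x y = dot d x x + dot d y y - 2 * dot d x y"
  by (simp add: sqdist_def dot_def power2_eq_square algebra_simps sum.distrib sum_subtractf sum_distrib_left)

definition orthonormal :: "nat \<Rightarrow> nat \<Rightarrow> (nat \<Rightarrow> nat \<Rightarrow> real) \<Rightarrow> bool" where
  "orthonormal d q u \<longleftrightarrow> (\<forall>a<q. \<forall>b<q. dot d (u a) (u b) = (if a = b then 1 else 0))"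

text \<open>For orthonormal \<open>u\<close> this is the orthogonal projection onto the complement
  of their span.\<close>

definition residual :: "nat \<Rightarrow> nat \<Rightarrow> (nat \<Rightarrow> nat \<Rightarrow> real) \<Rightarrow> (nat \<Rightarrow> real) \<Rightarrow> nat \<Rightarrow> real" where
  "residual d q u x = (\<lambda>i. x i - (\<Sum>a<q. dot d x (u a) * u a i))"

lemma dot_residual_basis:
  assumes "orthonormal d q u" "b < q"
  shows "dot d (residual d q u x) (u b) = 0"
proof -
  have "dot d (residual d q u x) (u b) = dot d x (u b) - (\<Sum>a<q. dot d x (u a) * dot d (u a) (u b))"
    unfolding residual_def by (simp add: dot_diff_left dot_sum_left dot_scale_left)
  also have "(\<Sum>a<q. dot d x (u a) * dot d (u a) (u b)) = (\<Sum>a<q. if a = b then dot d x (u a) else 0)"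
    using assms by (intro sum.cong refl) (auto simp: orthonormal_def)
  finally show ?thesis using assms by simp
qed

lemma dot_residual:
  assumes "orthonormal d q u"
  shows "dot d (residual d q u x) (residual d q u x) = dot d x x - (\<Sum>a<q. (dot d x (u a))\<^sup>2)"
proof -
  let ?r = "residual d q u x"
  have "dot d ?r (\<lambda>i. x i - (\<Sum>a<q. dot d x (u a) * u a i)) = dot d ?r x - (\<Sum>a<q. dot d x (u a) * dot d ?r (u a))"
    by (simp add: dot_diff_right dot_sum_right dot_scale_right)
  then have "dot d ?r ?r = dot d ?r x"
    using dot_residual_basis[OF assms] by (simp add: residual_def[symmetric])
  also have "\<dots> = dot d x x - (\<Sum>a<q. (dot d x (u a))\<^sup>2)"
    unfolding residual_def by (simp add: dot_diff_left dot_sum_left dot_scale_left power2_eq_square dot_commute)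
  finally show ?thesis .
qed

lemma residual_linear:
  "residual d q u (\<lambda>i. x i - y i) = (\<lambda>i. residual d q u x i - residual d q u y i)"
  by (simp add: residual_def dot_diff_left left_diff_distrib sum_subtractf fun_eq_iff)

lemma residual_sum:
  "residual d q u (\<lambda>i. \<Sum>j\<in>A. w j * x j i) = (\<lambda>i. \<Sum>j\<in>A. w j * residual d q u (x j) i)"
proof
  fix i
  have "(\<Sum>a<q. dot d (\<lambda>i. \<Sum>j\<in>A. w j * x j i) (u a) * u a i) = (\<Sum>a<q. \<Sum>j\<in>A. w j * dot d (x j) (u a) * u a i)"
    by (simp add: dot_sum_left dot_scale_left sum_distrib_right)
  also have "\<dots> = (\<Sum>j\<in>A. \<Sum>a<q. w j * dot d (x j) (u a) * u a i)" by (rule sum.swap)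
  finally show "residual d q u (\<lambda>i. \<Sum>j\<in>A. w j * x j i) i = (\<Sum>j\<in>A. w j * residual d q u (x j) i)"
    by (simp add: residual_def right_diff_distrib sum_subtractf sum_distrib_left mult.assoc)
qed

text \<open>The means may be linearly dependent, so the basis may be shorter than k: a mean with
  zero residual adds nothing, any other adds its normalised residual. Vanishing is claimed below d
  only, because points are total functions whose other coordinates carry no meaning.\<close>

lemma Gram_Schmidt:
  "\<exists>q u. q \<le> k \<and> orthonormal d q u \<and> (\<forall>t<k. \<forall>i<d. residual d q u (\<mu> t) i = 0)"
proof (induction k)
  case 0
  then show ?case by (intro exI[of _ 0]) (simp add: orthonormal_def)
next
  case (Suc k)
  then obtain q u where q: "q \<le> k" and on: "orthonormal d q u"
    and res: "\<forall>t<k. \<forall>i<d. residual d q u (\<mu> t) i = 0" by blast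
  define r where "r = residual d q u (\<mu> k)"
  show ?case
  proof (cases "dot d r r = 0")
    case True
    then have "\<forall>i<d. residual d q u (\<mu> k) i = 0" by (simp add: dot_eq_0_iff r_def)
    then show ?thesis using q on res by (intro exI[of _ q] exI[of _ u]) (auto simp: less_Suc_eq)
  next
    case False
    define \<kappa> where "\<kappa> = 1 / sqrt (dot d r r)"
    have pos: "dot d r r > 0" using False dot_nonneg[of d r] by linarith
    then have kap: "\<kappa> * (\<kappa> * dot d r r) = 1" by (simp add: \<kappa>_def)
    define u' where "u' = u(q := (\<lambda>i. \<kappa> * r i))"
    have old: "u' a = u a" if "a < q" for a using that by (simp add: u'_def)
    have new: "u' q = (\<lambda>i. \<kappa> * r i)" by (simp add: u'_def)
    have ru: "dot d r (u a) = 0" if "a < q" for a using dot_residual_basis[OF on that] by (simp add: r_def)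
    have "orthonormal d (Suc q) u'"
      unfolding orthonormal_def
    proof (intro allI impI)
      fix a b assume "a < Suc q" "b < Suc q"
      then consider "a < q" "b < q" | "a < q" "b = q" | "a = q" "b < q" | "a = q" "b = q" by linarith
      then show "dot d (u' a) (u' b) = (if a = b then 1 else 0)"
      proof cases
        case 1 then show ?thesis using on by (simp add: old orthonormal_def)
      next
        case 2 then show ?thesis using ru by (simp add: old new dot_scale_right dot_commute[of d "u _" r])
      next
        case 3 then show ?thesis using ru by (simp add: old new dot_scale_left)
      next
        case 4 then show ?thesis using kap by (simp add: new dot_scale_left dot_scale_right)
      qed
    qed
    moreover have "residual d (Suc q) u' x i = residual d q u x i - dot d x (u' q) * u' q i" for x i
      unfolding residual_def by (simp add: old)
    moreover have "dot d (\<mu> t) (u' q) = 0" if "t < k" for t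
    proof -
      have "dot d (\<mu> t) r = dot d (\<lambda>i. \<Sum>a<q. dot d (\<mu> t) (u a) * u a i) r"
        using res that by (intro dot_cong) (auto simp: residual_def)
      also have "\<dots> = 0" using ru by (simp add: dot_sum_left dot_scale_left dot_commute[of d "u _" r])
      finally show ?thesis by (simp add: new dot_scale_right)
    qed
    moreover have "dot d (\<mu> k) (u' q) * u' q i = r i" if "i < d" for i
    proof -
      have "dot d (\<mu> k) r = dot d (\<lambda>i. r i + (\<Sum>a<q. dot d (\<mu> k) (u a) * u a i)) r"
        by (intro dot_cong) (auto simp: r_def residual_def)
      also have "\<dots> = dot d r r" using ru by (simp add: dot_add_left dot_sum_left dot_scale_left dot_commute[of d "u _" r])
      finally have "dot d (\<mu> k) (u' q) * u' q i = (\<kappa> * (\<kappa> * dot d r r)) * r i"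
        by (simp add: new dot_scale_right)
      then show ?thesis using kap by simp
    qed
    ultimately show ?thesis using q res
      by (intro exI[of _ "Suc q"] exI[of _ u']) (auto simp: less_Suc_eq r_def)
  qed
qed

section \<open>Gram factorization of positive semidefinite matrices\<close>

text \<open>Along e_i + t e_m the form equals Z_ii + 2 t Z_im, which is linear in t and hence
  unbounded below unless Z_im vanishes.\<close>

lemma psd_zero_diag:
  assumes "psd (Suc m) Z" "Z m m = 0" "i < m" shows "Z i m = 0"
proof (rule ccontr)
  assume z: "Z i m \<noteq> 0"
  define v where "v t = (\<lambda>j. if j = i then 1 else if j = m then t else (0::real))" for t
  have sym: "Z m i = Z i m" using assms by (auto simp: psd_def)
  have "(\<Sum>p<Suc m. \<Sum>j<Suc m. v t p * Z p j * v t j) = Z i i + 2 * t * Z i m" for t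
  proof -
    have inner: "(\<Sum>j<Suc m. v t p * Z p j * v t j) = v t p * (Z p i + Z p m * t)" for p
    proof -
      have "(\<Sum>j<Suc m. v t p * Z p j * v t j) = (\<Sum>j\<in>{i,m}. v t p * Z p j * v t j)"
        using assms(3) by (intro sum.mono_neutral_right) (auto simp: v_def)
      then show ?thesis using assms(3) by (simp add: v_def algebra_simps)
    qed
    have "(\<Sum>p<Suc m. v t p * (Z p i + Z p m * t)) = (\<Sum>p\<in>{i,m}. v t p * (Z p i + Z p m * t))"
      using assms(3) by (intro sum.mono_neutral_right) (auto simp: v_def)
    also have "\<dots> = Z i i + 2 * t * Z i m" using assms(2,3) by (simp add: v_def sym)
    finally show ?thesis unfolding inner .
  qed
  moreover have "0 \<le> (\<Sum>p<Suc m. \<Sum>j<Suc m. v t p * Z p j * v t j)" for t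
    using assms(1) unfolding psd_def by blast
  ultimately have "0 \<le> Z i i + 2 * t * Z i m" for t by (simp only:)
  from this[of "- (Z i i + 1) / (2 * Z i m)"] show False using z by (simp add: field_simps)
qed

text \<open>Cholesky elimination of the last row and column. The smaller matrix stays positive
  semidefinite because its form is the old form minimised over the last coordinate.\<close>

lemma psd_Gram_factorization:
  assumes "psd m Z"
  shows "\<exists>A. \<forall>i<m. \<forall>j<m. Z i j = (\<Sum>r<m. A r i * (A r j :: real))"
  using assms
proof (induction m arbitrary: Z)
  case (Suc m)
  have sym: "Z i j = Z j i" if "i \<le> m" "j \<le> m" for i j using Suc.prems that by (auto simp: psd_def)
  have expand: "(\<Sum>i<Suc m. \<Sum>j<Suc m. v i * Z i j * v j)
     = (\<Sum>i<m. \<Sum>j<m. v i * Z i j * v j) + 2 * v m * (\<Sum>i<m. v i * Z i m) + Z m m * (v m)\<^sup>2" for v :: "nat \<Rightarrow> real"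
  proof -
    have "(\<Sum>j<m. v m * Z m j * v j) = v m * (\<Sum>i<m. v i * Z i m)"
      using sym by (simp add: sum_distrib_left mult_ac)
    moreover have "(\<Sum>i<m. v i * Z i m * v m) = v m * (\<Sum>i<m. v i * Z i m)"
      by (simp add: sum_distrib_left mult_ac)
    ultimately show ?thesis by (simp add: sum.distrib power2_eq_square algebra_simps)
  qed
  have nn: "0 \<le> (\<Sum>i<m. \<Sum>j<m. v i * Z i j * v j) + 2 * v m * (\<Sum>i<m. v i * Z i m) + Z m m * (v m)\<^sup>2" for v
    using Suc.prems unfolding psd_def expand[symmetric] by blast
  have z0: "0 \<le> Z m m" using nn[of "\<lambda>j. if j = m then 1 else 0"] by simp
  \<comment> \<open>The Schur complement of the last entry. For pivot 0, division by zero makes the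
    correction 0, which is right because the last column then vanishes.\<close>
  define Z' where "Z' i j = Z i j - Z i m * Z j m / Z m m" for i j
  have zim: "Z i m = 0" if "Z m m = 0" "i < m" for i using psd_zero_diag[OF Suc.prems] that by blast
  have "psd m Z'"
    unfolding psd_def
  proof (intro conjI allI impI)
    fix i j assume "i < m" "j < m" then show "Z' i j = Z' j i" using sym[of i j] by (simp add: Z'_def)
  next
    fix v :: "nat \<Rightarrow> real"
    let ?b = "\<Sum>i<m. v i * Z i m"
    have Zv: "(\<Sum>i<m. \<Sum>j<m. v i * Z' i j * v j) = (\<Sum>i<m. \<Sum>j<m. v i * Z i j * v j) - ?b\<^sup>2 / Z m m"
    proof -
      have "(\<Sum>i<m. \<Sum>j<m. v i * Z' i j * v j) = (\<Sum>i<m. \<Sum>j<m. v i * Z i j * v j - (v i * Z i m) * (v j * Z j m) / Z m m)"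
        by (intro sum.cong refl) (simp add: Z'_def algebra_simps)
      then show ?thesis
        by (simp add: sum_subtractf power2_eq_square sum_product sum_divide_distrib)
    qed
    \<comment> \<open>The minimiser of the form over the last coordinate.\<close>
    define w where "w = v(m := - ?b / Z m m)"
    have w: "w m = - ?b / Z m m" "\<And>i. i < m \<Longrightarrow> w i = v i" by (auto simp: w_def)
    have sums: "(\<Sum>i<m. w i * Z i m) = ?b" "(\<Sum>i<m. \<Sum>j<m. w i * Z i j * w j) = (\<Sum>i<m. \<Sum>j<m. v i * Z i j * v j)"
      by (intro sum.cong refl; simp add: w(2))+
    have "2 * w m * ?b + Z m m * (w m)\<^sup>2 = - (?b\<^sup>2 / Z m m)"
      unfolding w(1) by (cases "Z m m = 0") (simp_all add: power2_eq_square field_simps)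
    then show "0 \<le> (\<Sum>i<m. \<Sum>j<m. v i * Z' i j * v j)"
      using nn[of w] unfolding Zv sums by linarith
  qed
  from Suc.IH[OF this] obtain A where A: "\<forall>i<m. \<forall>j<m. Z' i j = (\<Sum>r<m. A r i * A r j)" by blast
  define B where "B r i = (if r < m then (if i < m then A r i else 0) else Z i m / sqrt (Z m m))" for r i
  have "Z i j = (\<Sum>r<Suc m. B r i * B r j)" if ij: "i < Suc m" "j < Suc m" for i j
  proof -
    have last: "B m i * B m j = Z i m * Z j m / Z m m" using z0 by (simp add: B_def)
    show ?thesis
    proof (cases "i < m \<and> j < m")
      case True
      then have "(\<Sum>r<m. B r i * B r j) = Z' i j" using A by (simp add: B_def)
      then show ?thesis using last by (simp add: Z'_def)
    next
      case False
      then have *: "(\<Sum>r<m. B r i * B r j) = 0" by (intro sum.neutral) (auto simp: B_def)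
      have "Z i j = Z i m * Z j m / Z m m"
      proof (cases "Z m m = 0")
        case True
        then show ?thesis using False ij zim[OF True] sym[of i j] by (auto simp: less_Suc_eq)
      next
        case nz: False
        then show ?thesis using False ij sym[of m j] by (auto simp: less_Suc_eq)
      qed
      then show ?thesis using * last by simp
    qed
  qed
  then show ?case by blast
qed simp

text \<open>A matrix and its transpose have the same operator norm. With w = \<Sum> a_j g_j,
  Cauchy-Schwarz gives |w|^4 \<le> |a|^2 \<Sum> (w . g_j)^2 \<le> |a|^2 \<Lambda> |w|^2, and |w|^2
  cancels.\<close>

lemma transpose_form_le:
  fixes g :: "nat \<Rightarrow> nat \<Rightarrow> real"
  assumes \<Lambda>: "\<And>v. (\<Sum>j<m. (dot d v (g j))\<^sup>2) \<le> \<Lambda> * dot d v v" and nn: "0 \<le> \<Lambda>"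
  shows "dot d (\<lambda>i. \<Sum>j<m. a j * g j i) (\<lambda>i. \<Sum>j<m. a j * g j i) \<le> \<Lambda> * (\<Sum>j<m. (a j)\<^sup>2)"
proof -
  define w where "w = (\<lambda>i. \<Sum>j<m. a j * g j i)"
  have "dot d w (\<lambda>i. \<Sum>j<m. a j * g j i) = (\<Sum>j<m. a j * dot d w (g j))"
    by (simp add: dot_sum_right dot_scale_right)
  then have "dot d w w = (\<Sum>j<m. a j * dot d w (g j))" by (simp only: w_def[symmetric])
  then have "(dot d w w)\<^sup>2 \<le> (\<Sum>j<m. (a j)\<^sup>2) * (\<Sum>j<m. (dot d w (g j))\<^sup>2)"
    using Cauchy_Schwarz_ineq_sum[of a "\<lambda>j. dot d w (g j)" "{..<m}"] by simp
  also have "\<dots> \<le> (\<Sum>j<m. (a j)\<^sup>2) * (\<Lambda> * dot d w w)"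
    using \<Lambda>[of w] by (intro mult_left_mono) (auto intro: sum_nonneg)
  finally have *: "dot d w w * dot d w w \<le> (\<Lambda> * (\<Sum>j<m. (a j)\<^sup>2)) * dot d w w"
    by (simp add: power2_eq_square mult_ac)
  have "dot d w w \<le> \<Lambda> * (\<Sum>j<m. (a j)\<^sup>2)"
  proof (cases "dot d w w = 0")
    case False
    then have "0 < dot d w w" using dot_nonneg[of d w] by linarith
    then show ?thesis using * by (rule mult_right_le_imp_le[rotated])
  next
    case True
    then show ?thesis using nn by (simp add: sum_nonneg)
  qed
  then show ?thesis by (simp add: w_def)
qed

lemma sdp_objective_dot:
  assumes "sdp_feasible m k Z"
  shows "(\<Sum>i<m. \<Sum>j<m. sqdist d (y i) (y j) * Z j i)
     = 2 * (\<Sum>i<m. dot d (y i) (y i)) - 2 * (\<Sum>i<m. \<Sum>j<m. Z i j * dot d (y i) (y j))"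
proof -
  have sym: "Z i j = Z j i" if "i < m" "j < m" for i j
    using assms that by (auto simp: sdp_feasible_def psd_def)
  have row: "(\<Sum>j<m. Z i j) = 1" if "i < m" for i using assms that by (auto simp: sdp_feasible_def)
  have "(\<Sum>i<m. \<Sum>j<m. sqdist d (y i) (y j) * Z j i)
      = (\<Sum>i<m. \<Sum>j<m. dot d (y i) (y i) * Z i j + dot d (y j) (y j) * Z j i - 2 * (Z i j * dot d (y i) (y j)))"
    by (intro sum.cong refl) (simp add: sqdist_dot sym algebra_simps)
  also have "\<dots> = (\<Sum>i<m. \<Sum>j<m. dot d (y i) (y i) * Z i j) + (\<Sum>i<m. \<Sum>j<m. dot d (y j) (y j) * Z j i)
       - 2 * (\<Sum>i<m. \<Sum>j<m. Z i j * dot d (y i) (y j))"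
    by (simp only: sum.distrib sum_subtractf sum_distrib_left)
  also have "(\<Sum>i<m. \<Sum>j<m. dot d (y j) (y j) * Z j i) = (\<Sum>i<m. \<Sum>j<m. dot d (y i) (y i) * Z i j)"
    by (rule sum.swap)
  also have "(\<Sum>i<m. \<Sum>j<m. dot d (y i) (y i) * Z i j) = (\<Sum>i<m. dot d (y i) (y i))"
    by (intro sum.cong refl) (simp add: row sum_distrib_left[symmetric])
  finally show ?thesis by simp
qed

text \<open>Project away the span of the means: the projection does not increase distances and kills
  the means, and the trace of a Gram matrix of operator norm \<open>\<Lambda>\<close> against Z is at most
  \<open>\<Lambda>\<close> times the trace of Z.\<close>

lemma SDP_ge_noise:
  assumes k: "0 < k" "k \<le> m"
    and y: "\<And>j i. j < m \<Longrightarrow> i < d \<Longrightarrow> y j i = \<mu> (T j) i + g j i" and T: "\<And>j. j < m \<Longrightarrow> T j < k"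
    and on: "orthonormal d q u" and span: "\<forall>t<k. \<forall>i<d. residual d q u (\<mu> t) i = 0"
    and \<Lambda>: "\<And>v. (\<Sum>j<m. (dot d v (g j))\<^sup>2) \<le> \<Lambda> * dot d v v" and nn: "0 \<le> \<Lambda>"
  shows "(1 / real m) * ((\<Sum>j<m. dot d (g j) (g j)) - (\<Sum>j<m. \<Sum>a<q. (dot d (g j) (u a))\<^sup>2) - real k * \<Lambda>)
     \<le> SDP d y m k"
proof (rule SDP_geI[OF k])
  fix Z assume Z: "sdp_feasible m k Z"
  define r where "r = residual d q u"
  have rr: "dot d (r x) (r x) = dot d x x - (\<Sum>a<q. (dot d x (u a))\<^sup>2)" for x
    unfolding r_def by (rule dot_residual[OF on])
  have rle: "dot d (r x) (r x) \<le> dot d x x" for x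
    unfolding rr by (simp add: sum_nonneg)
  have ry: "r (y j) i = r (g j) i" if "j < m" "i < d" for i j
  proof -
    have "dot d (y j) (u a) = dot d (\<mu> (T j)) (u a) + dot d (g j) (u a)" for a
      using y[OF that(1)] by (simp add: dot_add_left[symmetric] cong: dot_cong)
    then have "r (y j) i = r (\<mu> (T j)) i + r (g j) i"
      using y[OF that] by (simp add: r_def residual_def distrib_right sum.distrib)
    then show ?thesis using span T[OF that(1)] that by (simp add: r_def)
  qed
  have dist: "sqdist d (r (g i)) (r (g j)) \<le> sqdist d (y i) (y j)" if "i < m" "j < m" for i j
  proof -
    have sq: "sqdist d x x' = dot d (\<lambda>i. x i - x' i) (\<lambda>i. x i - x' i)" for x x'
      by (simp add: sqdist_def dot_def power2_eq_square)
    have "sqdist d (r (g i)) (r (g j)) = sqdist d (r (y i)) (r (y j))"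
      using ry that by (simp add: sqdist_def)
    also have "\<dots> = dot d (r (\<lambda>l. y i l - y j l)) (r (\<lambda>l. y i l - y j l))"
      unfolding sq r_def residual_linear ..
    also have "\<dots> \<le> sqdist d (y i) (y j)" unfolding sq by (rule rle)
    finally show ?thesis .
  qed
  obtain A where A: "\<forall>i<m. \<forall>j<m. Z i j = (\<Sum>c<m. A c i * A c j)"
    using Z psd_Gram_factorization[of m Z] by (auto simp: sdp_feasible_def)
  \<comment> \<open>Z is a sum of squares of the rows of \<open>A\<close>, so its pairing with the
    Gram matrix becomes a sum of squared norms, one per row. The squared lengths of the rows add up
    to the trace k.\<close>
  have "(\<Sum>i<m. \<Sum>j<m. Z i j * dot d (r (g i)) (r (g j)))
      = (\<Sum>c<m. dot d (r (\<lambda>l. \<Sum>j<m. A c j * g j l)) (r (\<lambda>l. \<Sum>j<m. A c j * g j l)))"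
  proof -
    have "(\<Sum>i<m. \<Sum>j<m. Z i j * dot d (r (g i)) (r (g j)))
       = (\<Sum>i<m. \<Sum>j<m. \<Sum>c<m. A c i * A c j * dot d (r (g i)) (r (g j)))"
      using A by (intro sum.cong refl) (simp add: sum_distrib_right)
    also have "\<dots> = (\<Sum>i<m. \<Sum>c<m. \<Sum>j<m. A c i * A c j * dot d (r (g i)) (r (g j)))"
      by (rule sum.cong[OF refl]) (rule sum.swap)
    also have "\<dots> = (\<Sum>c<m. \<Sum>i<m. \<Sum>j<m. A c i * A c j * dot d (r (g i)) (r (g j)))"
      by (rule sum.swap)
    also have "\<dots> = (\<Sum>c<m. dot d (r (\<lambda>l. \<Sum>j<m. A c j * g j l)) (r (\<lambda>l. \<Sum>j<m. A c j * g j l)))"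
      unfolding r_def residual_sum
      by (intro sum.cong refl) (simp add: dot_sum_left dot_sum_right dot_scale_left dot_scale_right sum_distrib_left mult.assoc)
    finally show ?thesis .
  qed
  also have "\<dots> \<le> (\<Sum>c<m. \<Lambda> * (\<Sum>j<m. (A c j)\<^sup>2))"
    by (intro sum_mono order_trans[OF rle] transpose_form_le \<Lambda> nn)
  also have "\<dots> = \<Lambda> * (\<Sum>j<m. \<Sum>c<m. A c j * A c j)"
    unfolding sum_distrib_left[symmetric] power2_eq_square by (subst sum.swap) (rule refl)
  also have "(\<Sum>j<m. \<Sum>c<m. A c j * A c j) = real k"
    using Z A by (simp add: sdp_feasible_def)
  finally have trace: "(\<Sum>i<m. \<Sum>j<m. Z i j * dot d (r (g i)) (r (g j))) \<le> real k * \<Lambda>" by (simp add: mult.commute)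
  have "2 * ((\<Sum>j<m. dot d (g j) (g j)) - (\<Sum>j<m. \<Sum>a<q. (dot d (g j) (u a))\<^sup>2) - real k * \<Lambda>)
      \<le> 2 * (\<Sum>j<m. dot d (r (g j)) (r (g j))) - 2 * (\<Sum>i<m. \<Sum>j<m. Z i j * dot d (r (g i)) (r (g j)))"
    using trace by (simp add: rr sum_subtractf)
  also have "\<dots> = (\<Sum>i<m. \<Sum>j<m. sqdist d (r (g i)) (r (g j)) * Z j i)"
    by (rule sdp_objective_dot[OF Z, symmetric])
  also have "\<dots> \<le> (\<Sum>i<m. \<Sum>j<m. sqdist d (y i) (y j) * Z j i)"
    using Z by (intro sum_mono mult_right_mono dist) (auto simp: sdp_feasible_def)
  finally have *: "2 * ((\<Sum>j<m. dot d (g j) (g j)) - (\<Sum>j<m. \<Sum>a<q. (dot d (g j) (u a))\<^sup>2) - real k * \<Lambda>)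
      \<le> (\<Sum>i<m. \<Sum>j<m. sqdist d (y i) (y j) * Z j i)" .
  have "0 < M \<Longrightarrow> 2 * x \<le> y \<Longrightarrow> (1 / M) * x \<le> (1 / (2 * M)) * y" for M x y :: real
    by (simp add: field_simps)
  moreover have "0 < real m" using k by simp
  ultimately show "(1 / real m) * ((\<Sum>j<m. dot d (g j) (g j)) - (\<Sum>j<m. \<Sum>a<q. (dot d (g j) (u a))\<^sup>2) - real k * \<Lambda>)
     \<le> (1 / (2 * real m)) * (\<Sum>i<m. \<Sum>j<m. sqdist d (y i) (y j) * Z j i)"
    using * by blast
qed

subsection \<open>Sampling and the upper bound\<close>

definition draw :: "nat \<Rightarrow> nat \<Rightarrow> (nat \<Rightarrow> nat) pmf" where
  "draw n s = Pi_pmf {..<s} 0 (\<lambda>_. pmf_of_set {..<n})"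

lemma sampler_draw: "sampler n s l = Pi_pmf {..<l} (\<lambda>_. 0) (\<lambda>_. draw n s)"
  by (simp add: sampler_def draw_def)

lemma set_pmf_draw: "0 < n \<Longrightarrow> set_pmf (draw n s) = PiE_dflt {..<s} 0 (\<lambda>_. {..<n})"
  unfolding draw_def by (subst set_Pi_pmf) (auto simp: lessThan_empty_iff o_def)

lemma finite_set_pmf_draw: "0 < n \<Longrightarrow> finite (set_pmf (draw n s))"
  by (simp add: set_pmf_draw finite_PiE_dflt)

lemma draw_less: "\<tau> \<in> set_pmf (draw n s) \<Longrightarrow> 0 < n \<Longrightarrow> j < s \<Longrightarrow> \<tau> j < n"
  by (auto simp: set_pmf_draw PiE_dflt_def)

lemma integrable_draw: "0 < n \<Longrightarrow> integrable (measure_pmf (draw n s)) (f :: _ \<Rightarrow> real)"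
  by (rule integrable_measure_pmf_finite[OF finite_set_pmf_draw])

lemma expectation_draw_mono:
  fixes f g :: "(nat \<Rightarrow> nat) \<Rightarrow> real"
  assumes "0 < n" "\<And>\<tau>. \<tau> \<in> set_pmf (draw n s) \<Longrightarrow> f \<tau> \<le> g \<tau>"
  shows "measure_pmf.expectation (draw n s) f \<le> measure_pmf.expectation (draw n s) g"
  by (rule integral_mono_AE) (use assms in \<open>auto intro!: integrable_draw AE_pmfI\<close>)

lemma expectation_draw_sum:
  fixes h :: "nat \<Rightarrow> real"
  assumes "0 < n"
  shows "measure_pmf.expectation (draw n s) (\<lambda>\<tau>. \<Sum>j<s. h (\<tau> j)) = real s * (\<Sum>i<n. h i) / real n"
proof -
  have "measure_pmf.expectation (draw n s) (\<lambda>\<tau>. \<Sum>j<s. h (\<tau> j))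
      = (\<Sum>j<s. measure_pmf.expectation (pmf_of_set {..<n}) h)"
    unfolding draw_def using assms
    by (intro expectation_sum_Pi_pmf) (auto intro!: integrable_measure_pmf_finite simp: lessThan_empty_iff)
  also have "measure_pmf.expectation (pmf_of_set {..<n}) h = (\<Sum>i<n. h i) / real n"
    using assms by (subst integral_pmf_of_set) (auto simp: lessThan_empty_iff)
  finally show ?thesis by simp
qed

lemma sampler_in_draw: "\<sigma> \<in> set_pmf (sampler n s l) \<Longrightarrow> i < l \<Longrightarrow> \<sigma> i \<in> set_pmf (draw n s)"
  unfolding sampler_draw by (subst (asm) set_Pi_pmf) (auto simp: PiE_dflt_def)

section \<open>Concentration of the mean over independent batches\<close>

lemma sampler_Hoeffding_ineq:
  fixes f :: "(nat \<Rightarrow> nat) \<Rightarrow> real"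
  assumes bd: "\<And>\<tau>. \<tau> \<in> set_pmf (draw n s) \<Longrightarrow> f \<tau> \<in> {0..B}"
  shows "Hoeffding_ineq (measure_pmf (sampler n s l)) {..<l} (\<lambda>i \<sigma>. f (\<sigma> i)) (\<lambda>_. 0) (\<lambda>_. B)"
proof unfold_locales
  have "prob_space.indep_vars (measure_pmf (sampler n s l)) (\<lambda>_. count_space UNIV) (\<lambda>x f. f x) {..<l}"
    unfolding sampler_draw by (rule indep_vars_Pi_pmf) simp
  then show "prob_space.indep_vars (measure_pmf (sampler n s l)) (\<lambda>_. borel) (\<lambda>i \<sigma>. f (\<sigma> i)) {..<l}"
    by (rule prob_space.indep_vars_compose2[OF prob_space_measure_pmf, where Y = "\<lambda>_. f"]) simp
  show "AE \<sigma> in measure_pmf (sampler n s l). f (\<sigma> i) \<in> {0..B}" if "i \<in> {..<l}" for i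
    using bd sampler_in_draw that by (intro AE_pmfI) (auto simp del: atLeastAtMost_iff)
qed auto

lemma expectation_sampler_component:
  fixes f :: "(nat \<Rightarrow> nat) \<Rightarrow> real"
  assumes "i < l"
  shows "measure_pmf.expectation (sampler n s l) (\<lambda>\<sigma>. f (\<sigma> i)) = measure_pmf.expectation (draw n s) f"
proof -
  have "measure_pmf.expectation (sampler n s l) (\<lambda>\<sigma>. f (\<sigma> i))
      = measure_pmf.expectation (map_pmf (\<lambda>\<sigma>. \<sigma> i) (sampler n s l)) f"
    by (rule integral_map_pmf[symmetric])
  also have "map_pmf (\<lambda>\<sigma>. \<sigma> i) (sampler n s l) = draw n s"
    unfolding sampler_draw using assms by (subst Pi_pmf_component) auto
  finally show ?thesis .
qed

text \<open>\<open>t\<close> is the deviation at which Hoeffding's bound exp(-2 l t^2 / B^2) equals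
  \<epsilon>. The case B = 0 is separate because that bound divides by the squared range; there both
  sides of each inequality are 0 on the support.\<close>

lemma sampler_concentration:
  fixes f :: "(nat \<Rightarrow> nat) \<Rightarrow> real"
  assumes bd: "\<And>\<tau>. \<tau> \<in> set_pmf (draw n s) \<Longrightarrow> f \<tau> \<in> {0..B}" and l: "0 < l" and e: "0 < \<epsilon>" "\<epsilon> \<le> 1" and B: "0 \<le> B"
  defines "t \<equiv> sqrt (B\<^sup>2 / (2 * real l) * ln (1 / \<epsilon>))"
  defines "E \<equiv> measure_pmf.expectation (draw n s) f"
  shows "measure_pmf.prob (sampler n s l) {\<sigma>. (1 / real l) * (\<Sum>i<l. f (\<sigma> i)) > E + t} \<le> \<epsilon>" (is ?upper)
    and "measure_pmf.prob (sampler n s l) {\<sigma>. (1 / real l) * (\<Sum>i<l. f (\<sigma> i)) < E - t} \<le> \<epsilon>" (is ?lower)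
proof -
  let ?P = "measure_pmf (sampler n s l)"
  have pos: ?upper ?lower if B0: "0 < B"
  proof -
    interpret H: Hoeffding_ineq ?P "{..<l}" "\<lambda>i \<sigma>. f (\<sigma> i)" "\<lambda>_. 0" "\<lambda>_. B"
      "\<Sum>i\<in>{..<l}. measure_pmf.expectation (sampler n s l) (\<lambda>\<sigma>. f (\<sigma> i))"
      using sampler_Hoeffding_ineq[of n s f B l] bd by auto
    have mu: "(\<Sum>i\<in>{..<l}. measure_pmf.expectation (sampler n s l) (\<lambda>\<sigma>. f (\<sigma> i))) = real l * E"
      by (simp add: expectation_sampler_component E_def)
    have ln: "0 \<le> ln (1 / \<epsilon>)" using e by simp
    have t: "0 \<le> t" unfolding t_def using ln by (auto intro!: mult_nonneg_nonneg)
    have t2: "t\<^sup>2 = B\<^sup>2 / (2 * real l) * ln (1 / \<epsilon>)" unfolding t_def using ln by simp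
    have var: "(\<Sum>i\<in>{..<l}. (B - 0)\<^sup>2) = real l * B\<^sup>2" by simp
    have lt: "0 \<le> real l * t" using t by simp
    have varpos: "(\<Sum>i\<in>{..<l}. (B - 0)\<^sup>2) > 0" using l B0 by simp
    have ex: "exp (- 2 * (real l * t)\<^sup>2 / (\<Sum>i\<in>{..<l}. (B - 0)\<^sup>2)) = \<epsilon>"
    proof -
      have "- 2 * (real l * t)\<^sup>2 / (real l * B\<^sup>2) = - ln (1 / \<epsilon>)"
        unfolding power_mult_distrib t2 using l B0 by (simp add: field_simps power2_eq_square)
      then show ?thesis unfolding var using e by (simp add: ln_div)
    qed
    have "measure_pmf.prob (sampler n s l) {\<sigma>. (1 / real l) * (\<Sum>i<l. f (\<sigma> i)) > E + t}
      \<le> measure_pmf.prob (sampler n s l) {\<sigma>\<in>space ?P. (\<Sum>i\<in>{..<l}. f (\<sigma> i)) \<ge> real l * E + real l * t}"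
      using l by (intro measure_pmf.finite_measure_mono) (auto simp: field_simps)
    also have "\<dots> \<le> \<epsilon>" using H.Hoeffding_ineq_ge[OF lt varpos] unfolding mu ex .
    finally show ?upper .
    have "measure_pmf.prob (sampler n s l) {\<sigma>. (1 / real l) * (\<Sum>i<l. f (\<sigma> i)) < E - t}
      \<le> measure_pmf.prob (sampler n s l) {\<sigma>\<in>space ?P. (\<Sum>i\<in>{..<l}. f (\<sigma> i)) \<le> real l * E - real l * t}"
      using l by (intro measure_pmf.finite_measure_mono) (auto simp: field_simps)
    also have "\<dots> \<le> \<epsilon>" using H.Hoeffding_ineq_le[OF lt varpos] unfolding mu ex .
    finally show ?lower .
  qed
  have zero: ?upper ?lower if B0: "B = 0"
  proof -
    have f0: "f \<tau> = 0" if "\<tau> \<in> set_pmf (draw n s)" for \<tau> using bd[OF that] B0 by simp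
    then have E0: "E = 0" unfolding E_def by (intro integral_eq_zero_AE AE_pmfI) simp
    have sum0: "(\<Sum>i<l. f (\<sigma> i)) = 0" if "\<sigma> \<in> set_pmf (sampler n s l)" for \<sigma>
      using f0 sampler_in_draw[OF that] by simp
    have "measure_pmf.prob (sampler n s l) {\<sigma>. (1 / real l) * (\<Sum>i<l. f (\<sigma> i)) > E + t} = 0"
      "measure_pmf.prob (sampler n s l) {\<sigma>. (1 / real l) * (\<Sum>i<l. f (\<sigma> i)) < E - t} = 0"
      using sum0 by (auto simp: measure_pmf_zero_iff E0 t_def B0)
    then show ?upper ?lower using e by simp_all
  qed
  have "0 < B \<or> B = 0" using B by auto
  then show ?upper ?lower using pos zero by blast+
qed

lemma prob_pmf_ge_compl:
  assumes "measure_pmf.prob p A \<le> \<epsilon>" "- A \<inter> set_pmf p \<subseteq> G"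
  shows "1 - \<epsilon> \<le> measure_pmf.prob p G"
proof -
  have "1 - measure_pmf.prob p A = measure_pmf.prob p (- A)"
    by (subst measure_pmf.prob_compl[of A p, symmetric]) (simp_all add: Compl_eq_Diff_UNIV)
  also have "\<dots> = measure_pmf.prob p (- A \<inter> set_pmf p)" by (simp add: measure_Int_set_pmf)
  also have "\<dots> \<le> measure_pmf.prob p G" using assms(2) by (intro measure_pmf.finite_measure_mono) auto
  finally show ?thesis using assms(1) by linarith
qed

section \<open>The procedure never exceeds the optimum, up to probability \<epsilon>\<close>

lemma kmpp_b_restrict: "kmpp_b d n k X idx = kmpp_b d n k X (restrict idx {..<k})"
proof -
  have "(\<lambda>j. edist d (X i) (X (idx j))) ` {..<k} = (\<lambda>j. edist d (X i) (X (restrict idx {..<k} j))) ` {..<k}" for i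
    by (intro image_cong) auto
  then show ?thesis unfolding kmpp_b_def by simp
qed

text \<open>The index functions are arbitrary from k on, so there are infinitely many of them, but b
  sees only the first k values. Finiteness makes the smallest b available.\<close>

lemma finite_kmpp_b: "0 < n \<Longrightarrow> finite {kmpp_b d n k X idx | idx. kmpp_init d n k X idx}"
proof (rule finite_subset)
  assume n: "0 < n"
  show "{kmpp_b d n k X idx | idx. kmpp_init d n k X idx} \<subseteq> kmpp_b d n k X ` ({..<k} \<rightarrow>\<^sub>E {..<n})"
  proof clarify
    fix idx assume "kmpp_init d n k X idx"
    then have "restrict idx {..<k} \<in> {..<k} \<rightarrow>\<^sub>E {..<n}" using kmpp_init_less[OF _ n] by auto
    then show "kmpp_b d n k X idx \<in> kmpp_b d n k X ` ({..<k} \<rightarrow>\<^sub>E {..<n})"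
      by (rule image_eqI[rotated]) (rule kmpp_b_restrict)
  qed
  show "finite (kmpp_b d n k X ` ({..<k} \<rightarrow>\<^sub>E {..<n}))" by (intro finite_imageI finite_PiE) auto
qed

lemma SDP_draw_le_kmpp_b:
  assumes "\<tau> \<in> set_pmf (draw n s)" "0 < n" "0 < k" "k \<le> s"
  shows "SDP d (\<lambda>j. X (\<tau> j)) s k \<le> kmpp_b d n k X idx"
proof -
  define a where "a i = (SOME j. j < k \<and> sqdist d (X i) (X (idx j)) \<le> kmpp_b d n k X idx)" for i
  have a: "a i < k \<and> sqdist d (X i) (X (idx (a i))) \<le> kmpp_b d n k X idx" if "i < n" for i
    unfolding a_def by (rule someI_ex) (use kmpp_b_covers[OF assms(3) that] in blast)
  have "SDP d (\<lambda>j. X (\<tau> j)) s k \<le> (1 / real s) * (\<Sum>j<s. sqdist d (X (\<tau> j)) (X (idx (a (\<tau> j)))))"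
    using SDP_le_assignment[of k s "\<lambda>j. a (\<tau> j)" d "\<lambda>j. X (\<tau> j)" "\<lambda>j. X (idx j)"] assms a draw_less[OF assms(1,2)] by auto
  also have "\<dots> \<le> (1 / real s) * (\<Sum>j<s. kmpp_b d n k X idx)"
    using a draw_less[OF assms(1,2)] by (intro mult_left_mono sum_mono) auto
  finally show ?thesis using assms by simp
qed

text \<open>The optimal centres of X are admissible for every sample, and since each sampled index
  is uniform, their mean cost over the draws is exactly the optimum.\<close>

lemma expectation_SDP_le_IP:
  assumes k: "0 < k" "k \<le> s" "k \<le> n"
  shows "measure_pmf.expectation (draw n s) (\<lambda>\<tau>. SDP d (\<lambda>j. X (\<tau> j)) s k) \<le> IP d X n k"
proof -
  have n: "0 < n" using k by simp
  obtain a c where a: "\<forall>j<n. a j < k"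
    and IP: "IP d X n k = (1 / real n) * (\<Sum>j<n. sqdist d (X j) (c (a j)))"
    using IP_attained_assignment[of k n d X] k by blast
  have "measure_pmf.expectation (draw n s) (\<lambda>\<tau>. SDP d (\<lambda>j. X (\<tau> j)) s k)
     \<le> measure_pmf.expectation (draw n s) (\<lambda>\<tau>. (1 / real s) * (\<Sum>j<s. sqdist d (X (\<tau> j)) (c (a (\<tau> j)))))"
  proof (rule expectation_draw_mono[OF n])
    fix \<tau> assume \<tau>: "\<tau> \<in> set_pmf (draw n s)"
    show "SDP d (\<lambda>j. X (\<tau> j)) s k \<le> (1 / real s) * (\<Sum>j<s. sqdist d (X (\<tau> j)) (c (a (\<tau> j))))"
      using SDP_le_assignment[of k s "\<lambda>j. a (\<tau> j)" d "\<lambda>j. X (\<tau> j)" c] k a draw_less[OF \<tau> n] by auto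
  qed
  also have "\<dots> = (1 / real s) * measure_pmf.expectation (draw n s) (\<lambda>\<tau>. (\<Sum>j<s. sqdist d (X (\<tau> j)) (c (a (\<tau> j)))))"
    by simp
  also have "\<dots> = IP d X n k"
    unfolding IP expectation_draw_sum[OF n, of s "\<lambda>i. sqdist d (X i) (c (a i))"] using k by simp
  finally show ?thesis .
qed

theorem B_H_le_IP:
  assumes k: "0 < k" "k \<le> s" "k \<le> n" and e: "0 < \<epsilon>"
  shows "1 - \<epsilon> \<le> measure_pmf.prob (sampler n s l)
              {\<sigma>. \<forall>idx. kmpp_init d n k X idx \<longrightarrow> B_H d n k s l \<epsilon> X idx \<sigma> \<le> IP d X n k}"
    (is "_ \<le> measure_pmf.prob _ ?G")
proof -
  let ?f = "\<lambda>\<tau>. SDP d (\<lambda>j. X (\<tau> j)) s k"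
  let ?b = "{kmpp_b d n k X idx | idx. kmpp_init d n k X idx}"
  have n: "0 < n" using k by simp
  consider "1 \<le> \<epsilon>" | "?b = {}" "\<epsilon> < 1" | "l = 0" "\<epsilon> < 1" | "?b \<noteq> {}" "0 < l" "\<epsilon> < 1" by linarith
  then show ?thesis
  proof cases
    case 1 then show ?thesis using measure_nonneg[of "measure_pmf (sampler n s l)" ?G] by linarith
  next
    case 2 then have "?G = UNIV" by auto
    then show ?thesis using e by simp
  next
    \<comment> \<open>For l = 0, division by zero makes both the mean and the correction 0, so
      \<open>B_H\<close> is 0 and only \<open>IP\<close> \<ge> 0 is at stake.\<close>
    case 3
    have "0 \<le> IP d X n k"
      using expectation_SDP_le_IP[OF k, of d X] SDP_nonneg[OF k(1,2)]
      by (meson Bochner_Integration.integral_nonneg order_trans)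
    then have "?G = UNIV" using 3 by (auto simp: B_H_def)
    then show ?thesis using e by simp
  next
    case 4
    define B where "B = Min ?b"
    have "B \<in> ?b" unfolding B_def by (rule Min_in[OF finite_kmpp_b[OF n] 4(1)])
    then obtain idx0 where idx0: "kmpp_init d n k X idx0" "B = kmpp_b d n k X idx0" by blast
    have B0: "0 \<le> B" using idx0 kmpp_b_nonneg[OF k(1) n] by simp
    have bd: "?f \<tau> \<in> {0..B}" if "\<tau> \<in> set_pmf (draw n s)" for \<tau>
      using SDP_draw_le_kmpp_b[OF that n k(1,2)] SDP_nonneg[OF k(1,2)] idx0 by simp
    let ?E = "measure_pmf.expectation (draw n s) ?f"
    let ?t = "sqrt (B\<^sup>2 / (2 * real l) * ln (1 / \<epsilon>))"
    have "measure_pmf.prob (sampler n s l) {\<sigma>. (1 / real l) * (\<Sum>i<l. ?f (\<sigma> i)) > ?E + ?t} \<le> \<epsilon>"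
      using sampler_concentration(1)[of n s ?f B l \<epsilon>, OF bd 4(2) e _ B0] 4 by simp
    then show ?thesis
    proof (rule prob_pmf_ge_compl, intro subsetI CollectI allI impI)
      fix \<sigma> idx assume "\<sigma> \<in> - {\<sigma>. (1 / real l) * (\<Sum>i<l. ?f (\<sigma> i)) > ?E + ?t} \<inter> set_pmf (sampler n s l)"
        and i: "kmpp_init d n k X idx"
      then have s: "(1 / real l) * (\<Sum>i<l. ?f (\<sigma> i)) \<le> ?E + ?t" by auto
      have "B \<le> kmpp_b d n k X idx" unfolding B_def using i by (intro Min_le finite_kmpp_b[OF n]) auto
      then have "?t \<le> sqrt ((kmpp_b d n k X idx)\<^sup>2 / (2 * real l) * ln (1 / \<epsilon>))"
        using B0 4 e by (intro real_sqrt_le_mono mult_right_mono divide_right_mono power_mono) auto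
      then show "B_H d n k s l \<epsilon> X idx \<sigma> \<le> IP d X n k"
        unfolding B_H_def using s expectation_SDP_le_IP[OF k, of d X] by linarith
    qed
  qed
qed

subsection \<open>Gaussian noise and the mixture\<close>

abbreviation stdn :: "real measure" where
  "stdn \<equiv> density lborel (\<lambda>x. ennreal (std_normal_density x))"

definition noise :: "nat \<Rightarrow> (nat \<Rightarrow> real) measure" where
  "noise d = PiM {..<d} (\<lambda>_. stdn)"

lemma prob_space_stdn: "prob_space stdn"
  by (rule prob_space_normal_density) simp

lemma prob_space_noise: "prob_space (noise d)"
  unfolding noise_def by (intro prob_space_PiM prob_space_stdn)

lemma sets_noise [measurable_cong]: "sets (noise d) = sets (PiM {..<d} (\<lambda>_. borel))"
  unfolding noise_def by (intro sets_PiM_cong) auto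

lemma product_sigma_finite_stdn: "product_sigma_finite (\<lambda>_::nat. stdn)"
  by (intro product_sigma_finite.intro prob_space_imp_sigma_finite prob_space_stdn)

lemma nn_integral_normal_density: "0 < \<sigma> \<Longrightarrow> (\<integral>\<^sup>+x. ennreal (normal_density \<mu> \<sigma> x) \<partial>lborel) = 1"
  by (subst nn_integral_eq_integral) auto

section \<open>One-dimensional Gaussian integrals\<close>

text \<open>Completing the square turns the integrand into a constant times the density of a normal
  law with mean 2 \<tau> a / (1 + 2 \<tau>) and variance 1 / (1 + 2 \<tau>). Negative \<tau> is
  allowed down to -1/2, so the exponential moments of a square are included.\<close>

lemma nn_integral_stdn_exp_shift:
  assumes \<tau>: "0 < 1 + 2 * \<tau>"
  shows "(\<integral>\<^sup>+x. ennreal (exp (- \<tau> * (x - a)\<^sup>2)) \<partial>stdn)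
     = ennreal (exp (- \<tau> * a\<^sup>2 / (1 + 2 * \<tau>)) / sqrt (1 + 2 * \<tau>))"
proof -
  define D where "D = 1 + 2 * \<tau>"
  have D: "0 < D" using \<tau> by (simp add: D_def)
  define c where "c = exp (- \<tau> * a\<^sup>2 / D) / sqrt D"
  have eq: "std_normal_density x * exp (- \<tau> * (x - a)\<^sup>2) = c * normal_density (2 * \<tau> * a / D) (1 / sqrt D) x" for x
  proof -
    have "- \<tau> * (x - a)\<^sup>2 - x\<^sup>2 / 2 = - \<tau> * a\<^sup>2 / D - (x - 2 * \<tau> * a / D)\<^sup>2 * D / 2"
      using D by (simp add: field_simps power2_eq_square) (simp add: D_def algebra_simps power2_eq_square)
    then have "exp (- x\<^sup>2 / 2) * exp (- \<tau> * (x - a)\<^sup>2) = exp (- \<tau> * a\<^sup>2 / D) * exp (- (x - 2 * \<tau> * a / D)\<^sup>2 * D / 2)"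
      by (simp flip: exp_add)
    moreover have "1 / sqrt D * (1 / sqrt (2 * pi * (1 / sqrt D)\<^sup>2)) = 1 / sqrt (2 * pi)"
      using D by (simp add: power_divide real_sqrt_divide real_sqrt_mult)
    moreover have "2 * (1 / sqrt D)\<^sup>2 = 2 / D" using D by (simp add: power_divide)
    ultimately show ?thesis using D
      by (simp add: normal_density_def c_def mult_ac)
  qed
  have "(\<integral>\<^sup>+x. ennreal (exp (- \<tau> * (x - a)\<^sup>2)) \<partial>stdn)
     = (\<integral>\<^sup>+x. ennreal c * ennreal (normal_density (2 * \<tau> * a / D) (1 / sqrt D) x) \<partial>lborel)"
  proof -
    have "c \<ge> 0" using D by (simp add: c_def)
    then have "ennreal (std_normal_density x) * ennreal (exp (- \<tau> * (x - a)\<^sup>2))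
      = ennreal c * ennreal (normal_density (2 * \<tau> * a / D) (1 / sqrt D) x)" for x
      by (simp only: ennreal_mult'[symmetric] eq normal_density_nonneg)
    then show ?thesis by (subst nn_integral_density) (simp_all add: measurable_ident)
  qed
  also have "\<dots> = ennreal c" using D by (simp add: nn_integral_cmult nn_integral_normal_density)
  finally show ?thesis by (simp add: c_def D_def)
qed

lemma nn_integral_normal_exp_square:
  assumes \<sigma>: "0 < \<sigma>" and \<theta>: "2 * \<theta> * \<sigma>\<^sup>2 < 1"
  shows "(\<integral>\<^sup>+x. ennreal (normal_density 0 \<sigma> x) * ennreal (exp (\<theta> * x\<^sup>2)) \<partial>lborel)
    = ennreal (1 / sqrt (1 - 2 * \<theta> * \<sigma>\<^sup>2))"
proof -
  define D where "D = 1 - 2 * \<theta> * \<sigma>\<^sup>2"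
  have D: "0 < D" using \<theta> by (simp add: D_def)
  have eq: "normal_density 0 \<sigma> x * exp (\<theta> * x\<^sup>2) = (1 / sqrt D) * normal_density 0 (\<sigma> / sqrt D) x" for x
  proof -
    have "\<theta> * x\<^sup>2 - x\<^sup>2 / (2 * \<sigma>\<^sup>2) = - (x\<^sup>2 * D) / (2 * \<sigma>\<^sup>2)"
      using \<sigma> by (simp add: field_simps D_def power2_eq_square)
    then have "exp (- x\<^sup>2 / (2 * \<sigma>\<^sup>2)) * exp (\<theta> * x\<^sup>2) = exp (- (x\<^sup>2 * D) / (2 * \<sigma>\<^sup>2))"
      by (simp flip: exp_add)
    moreover have "1 / sqrt D * (1 / sqrt (2 * pi * (\<sigma> / sqrt D)\<^sup>2)) = 1 / sqrt (2 * pi * \<sigma>\<^sup>2)"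
      using D \<sigma> by (simp add: power_divide real_sqrt_divide real_sqrt_mult)
    ultimately show ?thesis using D \<sigma>
      by (simp add: normal_density_def mult_ac power_divide)
  qed
  have "(\<integral>\<^sup>+x. ennreal (normal_density 0 \<sigma> x) * ennreal (exp (\<theta> * x\<^sup>2)) \<partial>lborel)
     = (\<integral>\<^sup>+x. ennreal (1 / sqrt D) * ennreal (normal_density 0 (\<sigma> / sqrt D) x) \<partial>lborel)"
    using D by (intro nn_integral_cong) (simp add: eq flip: ennreal_mult')
  also have "\<dots> = ennreal (1 / sqrt D)" using D \<sigma> by (simp add: nn_integral_cmult nn_integral_normal_density)
  finally show ?thesis by (simp add: D_def)
qed

lemma nn_integral_stdn_square: "(\<integral>\<^sup>+x. ennreal (x\<^sup>2) \<partial>stdn) = 1"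
proof -
  have "(\<integral>\<^sup>+x. ennreal (x\<^sup>2) \<partial>stdn) = (\<integral>\<^sup>+x. ennreal (std_normal_density x * x\<^sup>2) \<partial>lborel)"
    by (subst nn_integral_density) (auto simp flip: ennreal_mult')
  also have "\<dots> = ennreal (\<integral>x. std_normal_density x * x\<^sup>2 \<partial>lborel)"
    by (intro nn_integral_eq_integral integrable_std_normal_moment) auto
  also have "(\<integral>x. std_normal_density x * x\<^sup>2 \<partial>lborel) = 1"
    using integral_std_normal_moment_even[of 1] by (simp add: fact_numeral)
  finally show ?thesis by simp
qed

section \<open>Exponential moments of a noise vector\<close>

lemma measurable_noise_coord [measurable]: "c < d \<Longrightarrow> (\<lambda>g. g c) \<in> borel_measurable (noise d)"
  by measurable

lemma measurable_noise_dot [measurable]: "(\<lambda>g. dot d v g) \<in> borel_measurable (noise d)"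
  unfolding dot_def by measurable

lemma measurable_noise_norm [measurable]: "(\<lambda>g. dot d g g) \<in> borel_measurable (noise d)"
  unfolding dot_def by measurable

lemma noise_exp_norm:
  assumes "2 * \<theta> < 1"
  shows "(\<integral>\<^sup>+g. ennreal (exp (\<theta> * dot d g g)) \<partial>noise d) = ennreal ((1 / sqrt (1 - 2 * \<theta>)) ^ d)"
proof -
  interpret product_sigma_finite "\<lambda>_::nat. stdn" by (rule product_sigma_finite_stdn)
  have "(\<integral>\<^sup>+g. ennreal (exp (\<theta> * dot d g g)) \<partial>noise d) = (\<integral>\<^sup>+g. (\<Prod>c\<in>{..<d}. ennreal (exp (\<theta> * (g c)\<^sup>2))) \<partial>noise d)"
    by (intro nn_integral_cong) (simp add: dot_def sum_distrib_left exp_sum prod_ennreal power2_eq_square)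
  also have "\<dots> = (\<Prod>c\<in>{..<d}. \<integral>\<^sup>+x. ennreal (exp (\<theta> * x\<^sup>2)) \<partial>stdn)"
    unfolding noise_def by (rule product_nn_integral_prod) auto
  also have "(\<integral>\<^sup>+x. ennreal (exp (\<theta> * x\<^sup>2)) \<partial>stdn) = ennreal (1 / sqrt (1 - 2 * \<theta>))"
    using nn_integral_stdn_exp_shift[of "-\<theta>" 0] assms by simp
  finally show ?thesis using assms by (simp add: ennreal_power)
qed

text \<open>Each coordinate contributes an extra factor exp(-\<tau> x^2 / (1 + 2 \<tau>)) for its
  offset x, which is at most 1. The bound is therefore uniform in the position \<open>a\<close> and
  the target \<open>m\<close>; this is what makes arbitrary means harmless.\<close>

lemma noise_exp_neg_sqdist:
  assumes "0 \<le> \<tau>"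
  shows "(\<integral>\<^sup>+g. ennreal (exp (- \<tau> * sqdist d (\<lambda>c. a c + g c) m)) \<partial>noise d) \<le> ennreal ((1 / sqrt (1 + 2 * \<tau>)) ^ d)"
proof -
  interpret product_sigma_finite "\<lambda>_::nat. stdn" by (rule product_sigma_finite_stdn)
  have "(\<integral>\<^sup>+g. ennreal (exp (- \<tau> * sqdist d (\<lambda>c. a c + g c) m)) \<partial>noise d)
      = (\<integral>\<^sup>+g. (\<Prod>c\<in>{..<d}. ennreal (exp (- \<tau> * (g c - (m c - a c))\<^sup>2))) \<partial>noise d)"
    by (intro nn_integral_cong)
       (simp add: sqdist_def sum_distrib_left exp_sum[symmetric] prod_ennreal sum_negf[symmetric] algebra_simps)
  also have "\<dots> = (\<Prod>c\<in>{..<d}. \<integral>\<^sup>+x. ennreal (exp (- \<tau> * (x - (m c - a c))\<^sup>2)) \<partial>stdn)"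
    unfolding noise_def by (rule product_nn_integral_prod) auto
  also have "\<dots> \<le> (\<Prod>c\<in>{..<d}. ennreal (1 / sqrt (1 + 2 * \<tau>)))"
  proof (rule prod_mono_ennreal)
    fix c
    have "exp (- \<tau> * (m c - a c)\<^sup>2 / (1 + 2 * \<tau>)) \<le> 1" using assms by simp
    then show "(\<integral>\<^sup>+x. ennreal (exp (- \<tau> * (x - (m c - a c))\<^sup>2)) \<partial>stdn) \<le> ennreal (1 / sqrt (1 + 2 * \<tau>))"
      using assms by (subst nn_integral_stdn_exp_shift) (auto intro!: ennreal_leI divide_right_mono)
  qed
  finally show ?thesis using assms by (simp add: ennreal_power)
qed

lemma nn_integral_noise_norm: "(\<integral>\<^sup>+g. ennreal (dot d g g) \<partial>noise d) = ennreal (real d)"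
proof -
  have "(\<integral>\<^sup>+g. ennreal (dot d g g) \<partial>noise d) = (\<integral>\<^sup>+g. (\<Sum>c<d. ennreal ((g c)\<^sup>2)) \<partial>noise d)"
    by (intro nn_integral_cong) (simp add: dot_def power2_eq_square)
  also have "\<dots> = (\<Sum>c<d. \<integral>\<^sup>+g. ennreal ((g c)\<^sup>2) \<partial>noise d)" by (rule nn_integral_sum) auto
  also have "\<dots> = (\<Sum>c<d. 1)"
  proof (intro sum.cong refl)
    fix c assume c: "c \<in> {..<d}"
    have "(\<integral>\<^sup>+g. ennreal ((g c)\<^sup>2) \<partial>noise d) = (\<integral>\<^sup>+x. ennreal (x\<^sup>2) \<partial>distr (noise d) stdn (\<lambda>g. g c))"
      using c by (subst nn_integral_distr) (auto simp: noise_def)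
    also have "distr (noise d) stdn (\<lambda>g. g c) = stdn"
      unfolding noise_def using c by (intro distr_PiM_component prob_space_stdn) auto
    finally show "(\<integral>\<^sup>+g. ennreal ((g c)\<^sup>2) \<partial>noise d) = 1" by (simp add: nn_integral_stdn_square)
  qed
  finally show ?thesis by (simp add: ennreal_of_nat_eq_real_of_nat)
qed

lemma noise_dot_distributed:
  assumes "dot d v v \<noteq> 0"
  shows "distributed (noise d) lborel (dot d v) (normal_density 0 (sqrt (dot d v v)))"
proof -
  interpret prob_space "noise d" by (rule prob_space_noise)
  \<comment> \<open>Coordinates with coefficient 0 are dropped, since a sum of independent normals
    is formed from positive standard deviations.\<close>
  define C where "C = {c. c < d \<and> v c \<noteq> 0}"
  have C: "finite C" "C \<subseteq> {..<d}" by (auto simp: C_def)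
  have ne: "C \<noteq> {}" using assms by (auto simp: C_def dot_eq_0_iff)
  have dC: "dot d v x = (\<Sum>c\<in>C. v c * x c)" for x
    unfolding dot_def by (rule sum.mono_neutral_right) (auto simp: C_def)
  have "indep_vars (\<lambda>_. borel) (\<lambda>c g. g c) {..<d}"
  proof (subst indep_vars_iff_distr_eq_PiM')
    show "{..<d} \<noteq> {}" using ne C by auto
    show "(\<lambda>g. g c) \<in> noise d \<rightarrow>\<^sub>M borel" if "c \<in> {..<d}" for c using that by simp
    have "distr (noise d) (PiM {..<d} (\<lambda>_. borel)) (\<lambda>x. \<lambda>i\<in>{..<d}. x i) = distr (noise d) (noise d) (\<lambda>x. x)"
      by (rule distr_cong) (simp_all add: sets_noise, auto simp: space_PiM noise_def PiE_def extensional_restrict)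
    also have "\<dots> = PiM {..<d} (\<lambda>_. stdn)" by (simp add: noise_def)
    also have "\<dots> = PiM {..<d} (\<lambda>i. distr (noise d) borel (\<lambda>g. g i))"
    proof (rule PiM_cong[OF refl])
      fix c assume c: "c \<in> {..<d}"
      have "distr (noise d) borel (\<lambda>g. g c) = distr (noise d) stdn (\<lambda>g. g c)"
        by (rule distr_cong) auto
      also have "\<dots> = stdn"
        unfolding noise_def using c by (intro distr_PiM_component prob_space_stdn) auto
      finally show "stdn = distr (noise d) borel (\<lambda>g. g c)" ..
    qed
    finally show "distr (noise d) (PiM {..<d} (\<lambda>_. borel)) (\<lambda>x. \<lambda>i\<in>{..<d}. x i)
       = PiM {..<d} (\<lambda>i. distr (noise d) borel (\<lambda>g. g i))" .
  qed
  then have "indep_vars (\<lambda>_. borel) (\<lambda>c g. v c * g c) {..<d}"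
    by (rule indep_vars_compose2[where Y = "\<lambda>c x. v c * x"]) auto
  then have ind: "indep_vars (\<lambda>_. borel) (\<lambda>c g. v c * g c) C" by (rule indep_vars_subset[OF _ C(2)])
  have "distributed (noise d) lborel (\<lambda>g. \<Sum>c\<in>C. v c * g c) (normal_density (\<Sum>c\<in>C. 0) (sqrt (\<Sum>c\<in>C. \<bar>v c\<bar>\<^sup>2)))"
  proof (rule sum_indep_normal[OF C(1) ne ind])
    fix c assume c: "c \<in> C"
    then show "0 < \<bar>v c\<bar>" by (simp add: C_def)
    have "distributed (noise d) lborel (\<lambda>g. g c) (normal_density 0 1)"
      unfolding distributed_def
    proof (intro conjI)
      have "distr (noise d) lborel (\<lambda>g. g c) = distr (noise d) stdn (\<lambda>g. g c)"
        by (rule distr_cong) auto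
      also have "\<dots> = stdn"
        unfolding noise_def using c C by (intro distr_PiM_component prob_space_stdn) auto
      finally show "distr (noise d) lborel (\<lambda>g. g c) = stdn" .
    qed (use c C in auto)
    from normal_density_affine[OF this, of "v c" 0] c
    show "distributed (noise d) lborel (\<lambda>g. v c * g c) (normal_density 0 \<bar>v c\<bar>)" by (simp add: C_def)
  qed
  then show ?thesis by (simp add: dC[abs_def] power2_eq_square)
qed

lemma noise_exp_dot:
  assumes "2 * \<theta> * dot d v v < 1"
  shows "(\<integral>\<^sup>+g. ennreal (exp (\<theta> * (dot d v g)\<^sup>2)) \<partial>noise d) = ennreal (1 / sqrt (1 - 2 * \<theta> * dot d v v))"
proof (cases "dot d v v = 0")
  case True
  then have "dot d v g = 0" for g by (simp add: dot_eq_0_iff) (simp add: dot_def)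
  then show ?thesis using True prob_space.emeasure_space_1[OF prob_space_noise] by simp
next
  case False
  then have pos: "0 < dot d v v" using dot_nonneg[of d v] by linarith
  have "(\<integral>\<^sup>+g. ennreal (exp (\<theta> * (dot d v g)\<^sup>2)) \<partial>noise d)
     = (\<integral>\<^sup>+x. ennreal (normal_density 0 (sqrt (dot d v v)) x) * ennreal (exp (\<theta> * x\<^sup>2)) \<partial>lborel)"
    by (rule distributed_nn_integral[OF noise_dot_distributed[OF False], symmetric]) auto
  also have "\<dots> = ennreal (1 / sqrt (1 - 2 * \<theta> * (sqrt (dot d v v))\<^sup>2))"
    using pos assms by (intro nn_integral_normal_exp_square) auto
  finally show ?thesis using pos by simp
qed

section \<open>The mixture as an image of labels and noise\<close>

lemma distr_PiM_indexed:
  assumes fin: "finite I" and M: "\<And>i. prob_space (M i)" and f [measurable]: "\<And>i. i \<in> I \<Longrightarrow> f i \<in> M i \<rightarrow>\<^sub>M M' i"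
  shows "distr (PiM I M) (PiM I M') (\<lambda>x. \<lambda>i\<in>I. f i (x i)) = PiM I (\<lambda>i. distr (M i) (M' i) (f i))"
proof -
  \<comment> \<open>Product measures ask for a sigma-finite factor at every index, so a point mass
    fills the places outside \<open>I\<close>, where \<open>f\<close> need not be
    measurable.\<close>
  define N where "N = (\<lambda>i. if i \<in> I then distr (M i) (M' i) (f i) else return (count_space UNIV) undefined)"
  have "prob_space (N i)" for i
    using prob_space.prob_space_distr[OF M f] by (cases "i \<in> I") (simp_all add: N_def prob_space_return)
  then interpret product_sigma_finite N by (intro product_sigma_finite.intro prob_space_imp_sigma_finite)
  interpret M: product_sigma_finite M by (intro product_sigma_finite.intro prob_space_imp_sigma_finite M)
  have "distr (PiM I M) (PiM I M') (\<lambda>x. \<lambda>i\<in>I. f i (x i)) = PiM I N"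
  proof (rule PiM_eqI[OF fin])
    show "sets (distr (PiM I M) (PiM I M') (\<lambda>x. \<lambda>i\<in>I. f i (x i))) = sets (PiM I N)"
      by (simp, intro sets_PiM_cong) (auto simp: N_def)
    fix A assume "\<And>i. i \<in> I \<Longrightarrow> A i \<in> sets (N i)"
    then have A: "A i \<in> sets (M' i)" if "i \<in> I" for i using that by (simp add: N_def)
    have "(\<lambda>x. \<lambda>i\<in>I. f i (x i)) -` (PiE I A) \<inter> space (PiM I M) = PiE I (\<lambda>i. f i -` A i \<inter> space (M i))"
      by (auto simp: space_PiM PiE_iff extensional_def)
    then have "emeasure (distr (PiM I M) (PiM I M') (\<lambda>x. \<lambda>i\<in>I. f i (x i))) (PiE I A)
        = emeasure (PiM I M) (PiE I (\<lambda>i. f i -` A i \<inter> space (M i)))"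
      using A fin by (subst emeasure_distr) (auto intro!: sets_PiM_I_finite)
    also have "\<dots> = (\<Prod>i\<in>I. emeasure (M i) (f i -` A i \<inter> space (M i)))"
      using A fin by (intro M.emeasure_PiM) (auto intro!: measurable_sets[OF f])
    also have "\<dots> = (\<Prod>i\<in>I. emeasure (N i) (A i))"
      using A by (intro prod.cong refl) (simp add: N_def emeasure_distr)
    finally show "emeasure (distr (PiM I M) (PiM I M') (\<lambda>x. \<lambda>i\<in>I. f i (x i))) (PiE I A) = (\<Prod>i\<in>I. emeasure (N i) (A i))" .
  qed
  also have "PiM I N = PiM I (\<lambda>i. distr (M i) (M' i) (f i))" by (intro PiM_cong) (auto simp: N_def)
  finally show ?thesis .
qed

text \<open>A data point is encoded by its label and its noise vector, so that the noise stays visible after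
  mixing. Labels outside [k] have probability 0 but do occur in the sample space.\<close>

definition point :: "nat \<Rightarrow> (nat \<Rightarrow> nat \<Rightarrow> real) \<Rightarrow> nat \<times> (nat \<Rightarrow> real) \<Rightarrow> nat \<Rightarrow> real" where
  "point d mu w = (\<lambda>c\<in>{..<d}. mu (fst w) c + snd w c)"

definition site :: "nat \<Rightarrow> nat \<Rightarrow> (nat \<times> (nat \<Rightarrow> real)) measure" where
  "site d k = measure_pmf (pmf_of_set {..<k}) \<Otimes>\<^sub>M noise d"

lemma prob_space_site: "prob_space (site d k)"
  unfolding site_def by (intro prob_space_pair prob_space_measure_pmf prob_space_noise)

abbreviation pts :: "nat \<Rightarrow> (nat \<Rightarrow> real) measure" where
  "pts d \<equiv> PiM {..<d} (\<lambda>_. borel)"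

lemma measurable_noise_shift [measurable]:
  "(\<lambda>g. \<lambda>c\<in>{..<d}. a c + g c) \<in> noise d \<rightarrow>\<^sub>M pts d"
  by measurable

lemma measurable_point [measurable]: "point d mu \<in> site d k \<rightarrow>\<^sub>M pts d"
proof -
  have "(\<lambda>w. \<lambda>c\<in>{..<d}. mu (fst w) c + snd w c) \<in> site d k \<rightarrow>\<^sub>M pts d"
    unfolding site_def
  proof (rule measurable_restrict)
    fix c assume [measurable]: "c \<in> {..<d}"
    have [measurable]: "(\<lambda>t. mu t c) \<in> measure_pmf (pmf_of_set {..<k}) \<rightarrow>\<^sub>M borel" by simp
    show "(\<lambda>w. mu (fst w) c + snd w c) \<in> measure_pmf (pmf_of_set {..<k}) \<Otimes>\<^sub>M noise d \<rightarrow>\<^sub>M borel"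
      by measurable
  qed
  then show ?thesis by (simp add: point_def[abs_def])
qed

lemma gauss_eq_distr: "gauss d a = distr (noise d) (pts d) (\<lambda>g. \<lambda>c\<in>{..<d}. a c + g c)"
proof -
  have "density lborel (\<lambda>x. ennreal (normal_density m 1 x)) = distr stdn borel (\<lambda>x. m + x)" for m
  proof -
    interpret prob_space stdn by (rule prob_space_stdn)
    have "distributed stdn lborel (\<lambda>x. x) (normal_density 0 1)"
      unfolding distributed_def
    proof (intro conjI)
      have "distr stdn lborel (\<lambda>x. x) = distr stdn stdn (\<lambda>x. x)" by (rule distr_cong) auto
      then show "distr stdn lborel (\<lambda>x. x) = density lborel (\<lambda>x. ennreal (normal_density 0 1 x))" by simp
    qed auto
    from normal_density_affine[OF this, of 1 m]
    have "distr stdn lborel (\<lambda>x. m + x) = density lborel (\<lambda>x. ennreal (normal_density m 1 x))"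
      by (simp add: distributed_def)
    moreover have "distr stdn lborel (\<lambda>x. m + x) = distr stdn borel (\<lambda>x. m + x)" by (rule distr_cong) auto
    ultimately show ?thesis by simp
  qed
  then have "gauss d a = PiM {..<d} (\<lambda>c. distr stdn borel (\<lambda>x. a c + x))"
    unfolding gauss_def by (intro PiM_cong refl)
  also have "\<dots> = distr (noise d) (pts d) (\<lambda>g. \<lambda>c\<in>{..<d}. a c + g c)"
    unfolding noise_def by (rule distr_PiM_indexed[symmetric]) (auto intro: prob_space_stdn)
  finally show ?thesis .
qed

text \<open>Fubini over the label: for a fixed label the section of the preimage is the preimage
  under the shift by that mean, whose law is the corresponding Gaussian.\<close>

lemma gmm_eq_distr:
  assumes "0 < k"
  shows "gmm d k mu = distr (site d k) (pts d) (point d mu)"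
proof (rule measure_eqI)
  interpret noise: prob_space "noise d" by (rule prob_space_noise)
  let ?T = "measure_pmf (pmf_of_set {..<k})"
  have K: "(\<lambda>t. gauss d (mu t)) \<in> ?T \<rightarrow>\<^sub>M subprob_algebra (pts d)"
    by (auto simp: space_subprob_algebra gauss_eq_distr intro!: prob_space_imp_subprob_space noise.prob_space_distr)
  then show sets: "sets (gmm d k mu) = sets (distr (site d k) (pts d) (point d mu))"
    by (simp add: gmm_def sets_bind[OF sets_kernel[OF K]])
  fix A assume "A \<in> sets (gmm d k mu)"
  then have A [measurable]: "A \<in> sets (pts d)" using sets by simp
  have "emeasure (distr (site d k) (pts d) (point d mu)) A = emeasure (site d k) (point d mu -` A \<inter> space (site d k))"
    by (intro emeasure_distr) auto
  also have "\<dots> = (\<integral>\<^sup>+t. emeasure (noise d) (Pair t -` (point d mu -` A \<inter> space (site d k))) \<partial>?T)"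
    unfolding site_def by (rule noise.emeasure_pair_measure_alt)
      (rule measurable_sets[OF measurable_point A, unfolded site_def])
  also have "\<dots> = (\<integral>\<^sup>+t. emeasure (gauss d (mu t)) A \<partial>?T)"
  proof (rule nn_integral_cong)
    fix t
    have "Pair t -` (point d mu -` A \<inter> space (site d k)) = (\<lambda>g. \<lambda>c\<in>{..<d}. mu t c + g c) -` A \<inter> space (noise d)"
      by (auto simp: point_def site_def space_pair_measure)
    then show "emeasure (noise d) (Pair t -` (point d mu -` A \<inter> space (site d k))) = emeasure (gauss d (mu t)) A"
      by (simp add: gauss_eq_distr emeasure_distr)
  qed
  also have "\<dots> = emeasure (gmm d k mu) A"
    unfolding gmm_def by (rule emeasure_bind[OF _ K A, symmetric]) simp
  finally show "emeasure (gmm d k mu) A = emeasure (distr (site d k) (pts d) (point d mu)) A" ..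
qed

definition world :: "nat \<Rightarrow> nat \<Rightarrow> nat \<Rightarrow> (nat \<Rightarrow> nat \<times> (nat \<Rightarrow> real)) measure" where
  "world d n k = PiM {..<n} (\<lambda>_. site d k)"

lemma prob_space_world: "prob_space (world d n k)"
  unfolding world_def by (intro prob_space_PiM prob_space_site)

abbreviation data :: "nat \<Rightarrow> nat \<Rightarrow> (nat \<Rightarrow> nat \<Rightarrow> real) measure" where
  "data d n \<equiv> PiM {..<n} (\<lambda>_. pts d)"

definition cloud :: "nat \<Rightarrow> nat \<Rightarrow> (nat \<Rightarrow> nat \<Rightarrow> real) \<Rightarrow> (nat \<Rightarrow> nat \<times> (nat \<Rightarrow> real)) \<Rightarrow> nat \<Rightarrow> nat \<Rightarrow> real" where
  "cloud d n mu \<omega> = (\<lambda>i\<in>{..<n}. point d mu (\<omega> i))"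

lemma measurable_cloud [measurable]: "cloud d n mu \<in> world d n k \<rightarrow>\<^sub>M data d n"
  unfolding cloud_def[abs_def] world_def by measurable

text \<open>Probabilities over the data are computed on \<open>world\<close>, where labels and noise
  are visible, and are carried over to the mixture by this identity.\<close>

lemma gmm_data_eq_distr:
  assumes "0 < k"
  shows "gmm_data d n k mu = distr (world d n k) (data d n) (cloud d n mu)"
  unfolding gmm_data_def world_def gmm_eq_distr[OF assms] cloud_def[abs_def]
  by (rule distr_PiM_indexed[symmetric]) (auto intro: prob_space_site)

subsection \<open>Measurability\<close>

lemma continuous_sdp_objective:
  "continuous_on UNIV (\<lambda>Z :: nat \<Rightarrow> nat \<Rightarrow> real. (1 / (2 * real m)) * (\<Sum>i<m. \<Sum>j<m. sqdist d (Y i) (Y j) * Z j i))"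
proof -
  have "continuous_on UNIV (\<lambda>Z :: nat \<Rightarrow> nat \<Rightarrow> real. Z j i)" for i j
    using continuous_on_product_then_coordinatewise[OF continuous_on_product_then_coordinatewise[OF continuous_on_id[of UNIV]], of j i]
    by simp
  then show ?thesis by (intro continuous_intros)
qed

text \<open>The feasible set is uncountable, so measurability of the infimum is not immediate. The
  space of matrices is separable and the objective is continuous in Z, so a countable dense set of
  feasible points suffices; it does not depend on the data.\<close>

lemma SDP_eq_countable_Inf:
  assumes k: "0 < k" "k \<le> m"
  shows "\<exists>D. countable D \<and> D \<noteq> {} \<and> (\<forall>Z\<in>D. sdp_feasible m k Z) \<and>
    (\<forall>d Y. SDP d Y m k = (INF Z\<in>D. (1 / (2 * real m)) * (\<Sum>i<m. \<Sum>j<m. sqdist d (Y i) (Y j) * Z j i)))"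
proof -
  obtain D where D: "countable D" "D \<subseteq> {Z. sdp_feasible m k Z}" "{Z. sdp_feasible m k Z} \<subseteq> closure D"
    by (rule separable)
  obtain Z0 where "sdp_feasible m k Z0" using exists_sdp_feasible[OF k] by blast
  then have ne: "D \<noteq> {}" using D(3) by auto
  have "SDP d Y m k = (INF Z\<in>D. (1 / (2 * real m)) * (\<Sum>i<m. \<Sum>j<m. sqdist d (Y i) (Y j) * Z j i))" for d Y
  proof (rule antisym)
    let ?f = "\<lambda>Z. (1 / (2 * real m)) * (\<Sum>i<m. \<Sum>j<m. sqdist d (Y i) (Y j) * Z j i)"
    show "SDP d Y m k \<le> (INF Z\<in>D. ?f Z)"
      by (rule cINF_greatest[OF ne]) (use D(2) SDP_le_objective in blast)
    show "(INF Z\<in>D. ?f Z) \<le> SDP d Y m k"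
    proof (rule SDP_geI[OF k])
      fix Z assume "sdp_feasible m k Z"
      then have "Z \<in> closure D" using D(3) by auto
      moreover have "bdd_below (?f ` D)"
        using D(2) sdp_objective_nonneg by (intro bdd_belowI2[of _ 0]) blast
      then have "D \<subseteq> {Z. (INF Z\<in>D. ?f Z) \<le> ?f Z}" by (auto intro: cINF_lower)
      moreover have "closed {Z. (INF Z\<in>D. ?f Z) \<le> ?f Z}"
        by (intro closed_Collect_le continuous_on_const continuous_sdp_objective)
      ultimately show "(INF Z\<in>D. ?f Z) \<le> ?f Z" using closure_minimal by blast
    qed
  qed
  then show ?thesis using D ne by blast
qed

lemma borel_measurable_sqdist:
  assumes "\<And>c. c < d \<Longrightarrow> (\<lambda>\<omega>. x \<omega> c) \<in> borel_measurable M" "\<And>c. c < d \<Longrightarrow> (\<lambda>\<omega>. y \<omega> c) \<in> borel_measurable M"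
  shows "(\<lambda>\<omega>. sqdist d (x \<omega>) (y \<omega>)) \<in> borel_measurable M"
  unfolding sqdist_def using assms by (intro borel_measurable_sum borel_measurable_power borel_measurable_diff) auto

lemma borel_measurable_SDP:
  assumes k: "0 < k" "k \<le> m"
    and Y: "\<And>j c. j < m \<Longrightarrow> c < d \<Longrightarrow> (\<lambda>\<omega>. Y \<omega> j c) \<in> borel_measurable M"
  shows "(\<lambda>\<omega>. SDP d (Y \<omega>) m k) \<in> borel_measurable M"
proof -
  from SDP_eq_countable_Inf[OF k] obtain D where D: "countable D" "D \<noteq> {}" "\<forall>Z\<in>D. sdp_feasible m k Z"
    "\<forall>d Y. SDP d Y m k = (INF Z\<in>D. (1 / (2 * real m)) * (\<Sum>i<m. \<Sum>j<m. sqdist d (Y i) (Y j) * Z j i))"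
    by blast
  show ?thesis
    unfolding D(4)[rule_format]
  proof (rule borel_measurable_cINF[OF D(1)])
    show "(\<lambda>\<omega>. (1 / (2 * real m)) * (\<Sum>i<m. \<Sum>j<m. sqdist d (Y \<omega> i) (Y \<omega> j) * Z j i)) \<in> borel_measurable M" for Z
      using Y by (intro borel_measurable_times borel_measurable_const borel_measurable_sum borel_measurable_sqdist) auto
    show "bdd_below ((\<lambda>Z. (1 / (2 * real m)) * (\<Sum>i<m. \<Sum>j<m. sqdist d (Y \<omega> i) (Y \<omega> j) * Z j i)) ` D)" for \<omega>
      using D(3) sdp_objective_nonneg by (intro bdd_belowI2[of _ 0]) blast
  qed
qed

lemma borel_measurable_kmeans_cost:
  assumes P: "partition_on {..<m} P" and Y: "\<And>j c. j < m \<Longrightarrow> c < d \<Longrightarrow> (\<lambda>\<omega>. Y \<omega> j c) \<in> borel_measurable M"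
  shows "(\<lambda>\<omega>. kmeans_cost d (Y \<omega>) m P) \<in> borel_measurable M"
proof -
  have sub: "j < m" if "S \<in> P" "j \<in> S" for S j using partition_on_lessThanD(4)[OF P that(1)] that(2) by auto
  show ?thesis unfolding kmeans_cost_def
    by (intro borel_measurable_times borel_measurable_const borel_measurable_sum borel_measurable_sqdist)
       (use sub Y in \<open>auto simp: centroid_def intro!: borel_measurable_divide borel_measurable_sum\<close>)
qed

lemma borel_measurable_IP:
  assumes Y: "\<And>j c. j < m \<Longrightarrow> c < d \<Longrightarrow> (\<lambda>\<omega>. Y \<omega> j c) \<in> borel_measurable M"
  shows "(\<lambda>\<omega>. IP d (Y \<omega>) m k) \<in> borel_measurable M"
proof -
  let ?Q = "{P. partition_on {..<m} P \<and> card P = k}"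
  have "?Q \<subseteq> Pow (Pow {..<m})" by (auto simp: partition_on_def)
  then have fin: "finite ?Q" using finite_subset by blast
  have "(\<lambda>\<omega>. Min ((\<lambda>P. kmeans_cost d (Y \<omega>) m P) ` ?Q)) \<in> borel_measurable M"
    using fin Y by (intro borel_measurable_Min borel_measurable_kmeans_cost) auto
  moreover have "{kmeans_cost d (Y \<omega>) m P | P. partition_on {..<m} P \<and> card P = k} = (\<lambda>P. kmeans_cost d (Y \<omega>) m P) ` ?Q" for \<omega>
    by auto
  ultimately show ?thesis unfolding IP_def by simp
qed

section \<open>Measurability of the initialization and of the event\<close>

lemma borel_measurable_edist:
  assumes "\<And>j c. j < n \<Longrightarrow> c < d \<Longrightarrow> (\<lambda>\<omega>. X \<omega> j c) \<in> borel_measurable M" "i < n" "j < n"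
  shows "(\<lambda>\<omega>. edist d (X \<omega> i) (X \<omega> j)) \<in> borel_measurable M"
proof -
  have [measurable]: "(\<lambda>\<omega>. sqdist d (X \<omega> i) (X \<omega> j)) \<in> borel_measurable M"
    using assms by (intro borel_measurable_sqdist) auto
  show ?thesis unfolding edist_def by measurable
qed

lemma borel_measurable_kmpp_b:
  assumes X: "\<And>j c. j < n \<Longrightarrow> c < d \<Longrightarrow> (\<lambda>\<omega>. X \<omega> j c) \<in> borel_measurable M" and idx: "\<And>t. t < k \<Longrightarrow> idx t < n"
  shows "(\<lambda>\<omega>. kmpp_b d n k (X \<omega>) idx) \<in> borel_measurable M"
  unfolding kmpp_b_def
  using idx by (intro borel_measurable_Max borel_measurable_power borel_measurable_Min borel_measurable_edist[where n = n] X) auto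

lemma sets_kmpp_init:
  assumes X: "\<And>j c. j < n \<Longrightarrow> c < d \<Longrightarrow> (\<lambda>\<omega>. X \<omega> j c) \<in> borel_measurable M" and idx: "\<And>t. t < k \<Longrightarrow> idx t < n"
  shows "{\<omega> \<in> space M. kmpp_init d n k (X \<omega>) idx} \<in> sets M"
proof -
  let ?m = "\<lambda>t i \<omega>. Min ((\<lambda>j. edist d (X \<omega> i) (X \<omega> (idx j))) ` {..<t})"
  have m: "?m t i \<in> borel_measurable M" if "t < k" "i < n" for t i
    using idx that by (intro borel_measurable_Min borel_measurable_edist[where n = n] X) auto
  have "kmpp_init d n k (X \<omega>) idx \<longleftrightarrow> idx 0 = 0 \<and> (\<forall>t\<in>{0<..<k}. \<forall>i\<in>{..<n}. ?m t i \<omega> \<le> ?m t (idx t) \<omega>)" for \<omega>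
    unfolding kmpp_init_def using idx by (simp add: Ball_def)
  moreover have "{\<omega> \<in> space M. idx 0 = 0 \<and> (\<forall>t\<in>{0<..<k}. \<forall>i\<in>{..<n}. ?m t i \<omega> \<le> ?m t (idx t) \<omega>)} \<in> sets M"
  proof (intro sets.sets_Collect_conj sets.sets_Collect_finite_All borel_measurable_le)
    fix t i assume "t \<in> {0<..<k}" "i \<in> {..<n}"
    then show "?m t i \<in> borel_measurable M" "?m t (idx t) \<in> borel_measurable M" using idx by (auto intro!: m)
  qed simp_all
  ultimately show ?thesis by (simp only:)
qed

lemma kmpp_init_restrict:
  assumes "0 < k"
  shows "kmpp_init d n k X idx = kmpp_init d n k X (restrict idx {..<k})"
proof -
  define m where "m h t i = Min ((\<lambda>j. edist d (X i) (X (h j))) ` {..<t})" for h :: "nat \<Rightarrow> nat" and t i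
  define h where "h = restrict idx {..<k}"
  have h: "h t = idx t" if "t < k" for t using that by (simp add: h_def)
  have m: "m idx t i = m h t i" if "t < k" for t i
    unfolding m_def using h that by (intro arg_cong[where f = Min] image_cong) auto
  have "(idx t < n \<and> (\<forall>i<n. m idx t i \<le> m idx t (idx t))) = (h t < n \<and> (\<forall>i<n. m h t i \<le> m h t (h t)))"
    if "t < k" for t using that by (simp add: h m)
  then show ?thesis unfolding kmpp_init_def m_def[symmetric] h_def[symmetric] using assms h by auto
qed

text \<open>Turns a quantifier over all index functions, an uncountable intersection of events, into
  a finite one.\<close>

lemma all_kmpp_init_iff:
  assumes "0 < k" "0 < n" "\<And>idx. Q (restrict idx {..<k}) = Q idx"
  shows "(\<forall>idx. kmpp_init d n k X idx \<longrightarrow> Q idx) \<longleftrightarrow> (\<forall>idx\<in>{..<k} \<rightarrow>\<^sub>E {..<n}. kmpp_init d n k X idx \<longrightarrow> Q idx)"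
proof (intro iffI allI impI)
  fix idx assume H: "\<forall>idx\<in>{..<k} \<rightarrow>\<^sub>E {..<n}. kmpp_init d n k X idx \<longrightarrow> Q idx" and i: "kmpp_init d n k X idx"
  have "restrict idx {..<k} \<in> {..<k} \<rightarrow>\<^sub>E {..<n}" using kmpp_init_less[OF i assms(2)] by auto
  then have "Q (restrict idx {..<k})" using H i kmpp_init_restrict[OF assms(1)] by blast
  then show "Q idx" using assms(3) by simp
qed blast

lemma sets_B_H_event:
  fixes d l :: nat
  assumes k: "0 < k" "k \<le> s" "k \<le> n"
  defines "M \<equiv> data d n \<Otimes>\<^sub>M measure_pmf (sampler n s l)"
  shows "{p \<in> space M. \<forall>idx. kmpp_init d n k (fst p) idx \<longrightarrow>
       B_H d n k s l \<epsilon> (fst p) idx (snd p) \<ge> q * IP d (fst p) n k} \<in> sets M"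
proof -
  have X: "(\<lambda>p. fst p i c) \<in> borel_measurable M" if "i < n" "c < d" for i c
  proof (rule measurable_compose[where g = "\<lambda>x. x c" and N = "pts d"])
    show "(\<lambda>p. fst p i) \<in> M \<rightarrow>\<^sub>M pts d"
      unfolding M_def
      by (rule measurable_compose[OF measurable_fst, where N = "data d n"])
         (use that measurable_component_singleton[of i "{..<n}" "\<lambda>_. pts d"] in simp)
    show "(\<lambda>x. x c) \<in> pts d \<rightarrow>\<^sub>M borel"
      using that measurable_component_singleton[of c "{..<d}" "\<lambda>_. borel"] by simp
  qed
  \<comment> \<open>A sampled index may be \<ge> n on a null set of the sample space. There every
    data tuple has the value \<open>undefined\<close>, which is constant and so still
    measurable.\<close>
  have out: "(\<lambda>p. fst p i c) \<in> borel_measurable M" if "\<not> i < n" for i c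
  proof -
    have "fst p i c = undefined c" if "p \<in> space M" for p
      using that \<open>\<not> i < n\<close> by (auto simp: M_def space_pair_measure space_PiM PiE_def extensional_def)
    then show ?thesis by (subst measurable_cong[where g = "\<lambda>_. undefined c"]) auto
  qed
  have Y: "(\<lambda>p. fst p (snd p i j) c) \<in> borel_measurable M" if "c < d" for i j c
  proof (rule measurable_compose_countable[where f = "\<lambda>a p. fst p a c" and g = "\<lambda>p. snd p i j"])
    show "(\<lambda>p. fst p a c) \<in> borel_measurable M" for a using X out that by blast
    show "(\<lambda>p. snd p i j) \<in> M \<rightarrow>\<^sub>M count_space UNIV"
      unfolding M_def by (rule measurable_compose[OF measurable_snd]) simp
  qed
  have bh: "B_H d n k s l \<epsilon> X (restrict idx {..<k}) \<sigma> = B_H d n k s l \<epsilon> X idx \<sigma>" for X idx \<sigma>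
    unfolding B_H_def using kmpp_b_restrict by metis
  have B: "(\<lambda>p. B_H d n k s l \<epsilon> (fst p) idx (snd p)) \<in> borel_measurable M" if "idx \<in> {..<k} \<rightarrow>\<^sub>E {..<n}" for idx
  proof -
    have [measurable]: "(\<lambda>p. SDP d (\<lambda>j. fst p (snd p i j)) s k) \<in> borel_measurable M" for i
      using k Y by (intro borel_measurable_SDP) auto
    have [measurable]: "(\<lambda>p. kmpp_b d n k (fst p) idx) \<in> borel_measurable M"
      using that X by (intro borel_measurable_kmpp_b) auto
    show ?thesis unfolding B_H_def by measurable
  qed
  have "{p \<in> space M. \<forall>idx\<in>{..<k} \<rightarrow>\<^sub>E {..<n}. kmpp_init d n k (fst p) idx \<longrightarrow>
       q * IP d (fst p) n k \<le> B_H d n k s l \<epsilon> (fst p) idx (snd p)} \<in> sets M"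
    by (intro sets.sets_Collect_finite_All sets.sets_Collect_imp sets_kmpp_init borel_measurable_le
        borel_measurable_times borel_measurable_const borel_measurable_IP B finite_PiE)
       (use X in \<open>auto simp: PiE_iff\<close>)
  then show ?thesis using k by (subst all_kmpp_init_iff) (auto simp: bh)
qed

subsection \<open>Tail bounds for the noise\<close>

lemma measurable_snd_site [measurable]: "snd \<in> site d k \<rightarrow>\<^sub>M noise d"
  unfolding site_def by measurable

lemma nn_integral_site_snd:
  assumes [measurable]: "F \<in> borel_measurable (noise d)"
  shows "(\<integral>\<^sup>+w. F (snd w) \<partial>site d k) = (\<integral>\<^sup>+g. F g \<partial>noise d)"
proof -
  interpret noise: prob_space "noise d" by (rule prob_space_noise)
  have "(\<integral>\<^sup>+w. F (snd w) \<partial>site d k) = (\<integral>\<^sup>+t. \<integral>\<^sup>+g. F g \<partial>noise d \<partial>measure_pmf (pmf_of_set {..<k}))"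
    unfolding site_def by (subst noise.nn_integral_fst[symmetric]) auto
  then show ?thesis by (simp add: measure_pmf.emeasure_space_1)
qed

lemma product_sigma_finite_site: "product_sigma_finite (\<lambda>_::nat. site d k)"
  by (intro product_sigma_finite.intro prob_space_imp_sigma_finite prob_space_site)

lemma measurable_world_snd [measurable]: "i < n \<Longrightarrow> (\<lambda>\<omega>. snd (\<omega> i)) \<in> world d n k \<rightarrow>\<^sub>M noise d"
  unfolding world_def by measurable

lemma nn_integral_world_prod:
  assumes [measurable]: "\<And>i. i < n \<Longrightarrow> F i \<in> borel_measurable (noise d)"
  shows "(\<integral>\<^sup>+\<omega>. (\<Prod>i<n. F i (snd (\<omega> i))) \<partial>world d n k) = (\<Prod>i<n. \<integral>\<^sup>+g. F i g \<partial>noise d)"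
proof -
  interpret product_sigma_finite "\<lambda>_::nat. site d k" by (rule product_sigma_finite_site)
  have "(\<integral>\<^sup>+\<omega>. (\<Prod>i<n. F i (snd (\<omega> i))) \<partial>world d n k) = (\<Prod>i<n. \<integral>\<^sup>+w. F i (snd w) \<partial>site d k)"
    unfolding world_def by (rule product_nn_integral_prod) auto
  also have "\<dots> = (\<Prod>i<n. \<integral>\<^sup>+g. F i g \<partial>noise d)" by (intro prod.cong refl nn_integral_site_snd) auto
  finally show ?thesis .
qed

lemma nn_integral_world_component:
  assumes "i < n" and [measurable]: "F \<in> borel_measurable (noise d)"
  shows "(\<integral>\<^sup>+\<omega>. F (snd (\<omega> i)) \<partial>world d n k) = (\<integral>\<^sup>+g. F g \<partial>noise d)"
proof -
  have "(\<integral>\<^sup>+\<omega>. F (snd (\<omega> i)) \<partial>world d n k) = (\<integral>\<^sup>+w. F (snd w) \<partial>distr (world d n k) (site d k) (\<lambda>\<omega>. \<omega> i))"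
    using assms(1) by (subst nn_integral_distr) (auto simp: world_def)
  also have "distr (world d n k) (site d k) (\<lambda>\<omega>. \<omega> i) = site d k"
    unfolding world_def using assms(1) by (intro distr_PiM_component prob_space_site) auto
  finally show ?thesis by (simp add: nn_integral_site_snd)
qed

section \<open>Chernoff bounds for sums over the data\<close>

lemma (in prob_space) Chernoff_bound:
  assumes [measurable]: "Z \<in> borel_measurable M" and B: "(\<integral>\<^sup>+\<omega>. ennreal (exp (Z \<omega>)) \<partial>M) \<le> ennreal B" and "0 \<le> B"
  shows "prob {\<omega>\<in>space M. a \<le> Z \<omega>} \<le> B * exp (- a)"
proof -
  have "emeasure M {\<omega>\<in>space M. 1 \<le> ennreal (exp (- a)) * ennreal (exp (Z \<omega>))}
     \<le> ennreal (exp (- a)) * (\<integral>\<^sup>+\<omega>. ennreal (exp (Z \<omega>)) * indicator (space M) \<omega> \<partial>M)"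
    by (rule nn_integral_Markov_inequality) auto
  also have "(\<integral>\<^sup>+\<omega>. ennreal (exp (Z \<omega>)) * indicator (space M) \<omega> \<partial>M) = (\<integral>\<^sup>+\<omega>. ennreal (exp (Z \<omega>)) \<partial>M)"
    by (intro nn_integral_cong) auto
  also have "{\<omega>\<in>space M. 1 \<le> ennreal (exp (- a)) * ennreal (exp (Z \<omega>))} = {\<omega>\<in>space M. a \<le> Z \<omega>}"
    by (auto simp: ennreal_mult'[symmetric] exp_add[symmetric] ennreal_1[symmetric] simp del: ennreal_1)
  also have "ennreal (exp (- a)) * (\<integral>\<^sup>+\<omega>. ennreal (exp (Z \<omega>)) \<partial>M) \<le> ennreal (exp (- a)) * ennreal B"
    using B by (rule mult_left_mono) simp
  finally show ?thesis using assms(3)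
    by (simp add: emeasure_eq_measure ennreal_mult'[symmetric] mult.commute)
qed

lemma world_sum_tail:
  assumes [measurable]: "Z \<in> borel_measurable (noise d)" and "(\<integral>\<^sup>+g. ennreal (exp (Z g)) \<partial>noise d) \<le> ennreal (exp b)"
  shows "measure (world d n k) {\<omega>\<in>space (world d n k). a \<le> (\<Sum>i<n. Z (snd (\<omega> i)))} \<le> exp (real n * b - a)"
proof -
  interpret prob_space "world d n k" by (rule prob_space_world)
  have "(\<integral>\<^sup>+\<omega>. ennreal (exp (\<Sum>i<n. Z (snd (\<omega> i)))) \<partial>world d n k) = (\<integral>\<^sup>+\<omega>. (\<Prod>i<n. ennreal (exp (Z (snd (\<omega> i))))) \<partial>world d n k)"
    by (simp add: exp_sum prod_ennreal)
  also have "\<dots> = (\<Prod>i<n. \<integral>\<^sup>+g. ennreal (exp (Z g)) \<partial>noise d)"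
    by (rule nn_integral_world_prod) auto
  also have "\<dots> \<le> (\<Prod>i<n. ennreal (exp b))" using assms(2) by (intro prod_mono_ennreal)
  also have "\<dots> = ennreal (exp (real n * b))" by (simp add: ennreal_power exp_of_nat_mult)
  finally have "prob {\<omega>\<in>space (world d n k). a \<le> (\<Sum>i<n. Z (snd (\<omega> i)))} \<le> exp (real n * b) * exp (- a)"
    by (intro Chernoff_bound) auto
  then show ?thesis by (simp add: exp_diff exp_minus field_simps)
qed

lemma inverse_sqrt_le_exp:
  fixes x :: real
  assumes "0 \<le> x" "x \<le> 1/2"
  shows "1 / sqrt (1 - x) \<le> exp (x / 2 + x\<^sup>2)"
proof -
  have "- x - 2 * x\<^sup>2 \<le> ln (1 - x)" using ln_one_minus_pos_lower_bound[OF assms] .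
  then have "exp (- x - 2 * x\<^sup>2) \<le> 1 - x" using assms by (simp add: ln_ge_iff[symmetric])
  then have "sqrt (exp (- x - 2 * x\<^sup>2)) \<le> sqrt (1 - x)" by simp
  moreover have "sqrt (exp (- x - 2 * x\<^sup>2)) = exp (- (x / 2 + x\<^sup>2))"
  proof (rule real_sqrt_unique)
    show "(exp (- (x / 2 + x\<^sup>2)))\<^sup>2 = exp (- x - 2 * x\<^sup>2)"
      by (simp add: exp_double[symmetric] algebra_simps)
  qed simp
  ultimately have "1 / sqrt (1 - x) \<le> 1 / exp (- (x / 2 + x\<^sup>2))"
    using assms by (intro divide_left_mono mult_pos_pos) auto
  then show ?thesis by (simp add: exp_minus field_simps)
qed

lemma inverse_sqrt_le_exp_neg:
  fixes x :: real
  assumes "0 \<le> x" "x \<le> 1"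
  shows "1 / sqrt (1 + x) \<le> exp (- x / 2 + x\<^sup>2 / 2)"
proof -
  have "x - x\<^sup>2 \<le> ln (1 + x)" using ln_one_plus_pos_lower_bound[OF assms] .
  then have "exp (x - x\<^sup>2) \<le> 1 + x" using assms by (simp add: ln_ge_iff[symmetric])
  then have "sqrt (exp (x - x\<^sup>2)) \<le> sqrt (1 + x)" by simp
  moreover have "sqrt (exp (x - x\<^sup>2)) = exp (- (- x / 2 + x\<^sup>2 / 2))"
  proof (rule real_sqrt_unique)
    show "(exp (- (- x / 2 + x\<^sup>2 / 2)))\<^sup>2 = exp (x - x\<^sup>2)"
      by (simp add: exp_double[symmetric] algebra_simps)
  qed simp
  ultimately have "1 / sqrt (1 + x) \<le> 1 / exp (- (- x / 2 + x\<^sup>2 / 2))"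
    using assms by (intro divide_left_mono) auto
  then show ?thesis by (simp add: exp_minus field_simps)
qed

lemma noise_exp_norm_le:
  assumes "0 \<le> \<theta>" "\<theta> \<le> 1/4"
  shows "(\<integral>\<^sup>+g. ennreal (exp (\<theta> * dot d g g)) \<partial>noise d) \<le> ennreal (exp (real d * (\<theta> + 4 * \<theta>\<^sup>2)))"
proof -
  have "1 / sqrt (1 - 2 * \<theta>) \<le> exp (2 * \<theta> / 2 + (2 * \<theta>)\<^sup>2)" using assms by (intro inverse_sqrt_le_exp) auto
  then have "(1 / sqrt (1 - 2 * \<theta>)) ^ d \<le> exp (2 * \<theta> / 2 + (2 * \<theta>)\<^sup>2) ^ d" using assms by (intro power_mono) auto
  also have "\<dots> = exp (real d * (\<theta> + 4 * \<theta>\<^sup>2))" by (simp add: exp_of_nat_mult[symmetric] power_mult_distrib)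
  finally show ?thesis using assms by (subst noise_exp_norm) (auto intro!: ennreal_leI)
qed

lemma noise_exp_neg_norm_le:
  assumes "0 \<le> \<theta>" "\<theta> \<le> 1/2"
  shows "(\<integral>\<^sup>+g. ennreal (exp (- \<theta> * dot d g g)) \<partial>noise d) \<le> ennreal (exp (real d * (- \<theta> + 2 * \<theta>\<^sup>2)))"
proof -
  have "1 / sqrt (1 + 2 * \<theta>) \<le> exp (- (2 * \<theta>) / 2 + (2 * \<theta>)\<^sup>2 / 2)" using assms by (intro inverse_sqrt_le_exp_neg) auto
  then have "(1 / sqrt (1 + 2 * \<theta>)) ^ d \<le> exp (- (2 * \<theta>) / 2 + (2 * \<theta>)\<^sup>2 / 2) ^ d" using assms by (intro power_mono) auto
  also have "\<dots> = exp (real d * (- \<theta> + 2 * \<theta>\<^sup>2))" by (simp add: exp_of_nat_mult[symmetric] power_mult_distrib)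
  finally show ?thesis using assms noise_exp_norm[of "- \<theta>" d] by (auto intro!: ennreal_leI)
qed

lemma world_norm_sum_upper:
  assumes "0 < d"
  shows "measure (world d n k) {\<omega>\<in>space (world d n k). real n * (real d + 1) \<le> (\<Sum>i<n. dot d (snd (\<omega> i)) (snd (\<omega> i)))}
    \<le> exp (- real n / (16 * real d))"
proof -
  \<comment> \<open>The minimiser of the exponent 4 d \<theta>^2 - \<theta> per point, with value
    -1/(16 d).\<close>
  define \<theta> where "\<theta> = 1 / (8 * real d)"
  have \<theta>: "0 < \<theta>" "\<theta> \<le> 1/4" using assms by (auto simp: \<theta>_def field_simps)
  have "measure (world d n k) {\<omega>\<in>space (world d n k). \<theta> * (real n * (real d + 1)) \<le> (\<Sum>i<n. \<theta> * dot d (snd (\<omega> i)) (snd (\<omega> i)))}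
      \<le> exp (real n * (real d * (\<theta> + 4 * \<theta>\<^sup>2)) - \<theta> * (real n * (real d + 1)))"
    by (rule world_sum_tail) (use \<theta> in \<open>auto intro!: noise_exp_norm_le\<close>)
  moreover have "\<theta> * x \<le> (\<Sum>i<n. \<theta> * y i) \<longleftrightarrow> x \<le> (\<Sum>i<n. y i)" for x and y :: "nat \<Rightarrow> real"
    using \<theta> by (simp add: sum_distrib_left[symmetric])
  moreover have "real n * (real d * (\<theta> + 4 * \<theta>\<^sup>2)) - \<theta> * (real n * (real d + 1)) = - real n / (16 * real d)"
    using assms by (simp add: \<theta>_def field_simps power2_eq_square)
  ultimately show ?thesis by simp
qed

lemma world_norm_sum_lower:
  assumes "0 < d"
  shows "measure (world d n k) {\<omega>\<in>space (world d n k). (\<Sum>i<n. dot d (snd (\<omega> i)) (snd (\<omega> i))) \<le> real n * (real d - 1)}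
    \<le> exp (- real n / (16 * real d))"
proof -
  \<comment> \<open>The minimiser of 2 d \<theta>^2 - \<theta>. Its value -1/(8 d) is weakened to
    match the upper tail.\<close>
  define \<theta> where "\<theta> = 1 / (4 * real d)"
  have \<theta>: "0 < \<theta>" "\<theta> \<le> 1/2" using assms by (auto simp: \<theta>_def field_simps)
  have "measure (world d n k) {\<omega>\<in>space (world d n k). - \<theta> * (real n * (real d - 1)) \<le> (\<Sum>i<n. - \<theta> * dot d (snd (\<omega> i)) (snd (\<omega> i)))}
      \<le> exp (real n * (real d * (- \<theta> + 2 * \<theta>\<^sup>2)) - - \<theta> * (real n * (real d - 1)))"
  proof (rule world_sum_tail)
    show "(\<integral>\<^sup>+g. ennreal (exp (- \<theta> * dot d g g)) \<partial>noise d) \<le> ennreal (exp (real d * (- \<theta> + 2 * \<theta>\<^sup>2)))"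
      using \<theta> by (intro noise_exp_neg_norm_le) auto
  qed simp
  moreover have "- \<theta> * x \<le> (\<Sum>i<n. - \<theta> * y i) \<longleftrightarrow> (\<Sum>i<n. y i) \<le> x" for x and y :: "nat \<Rightarrow> real"
    using \<theta> by (simp add: sum_distrib_left[symmetric] sum_negf)
  moreover have "real n * (real d * (- \<theta> + 2 * \<theta>\<^sup>2)) - - \<theta> * (real n * (real d - 1)) \<le> - real n / (16 * real d)"
    using assms by (simp add: \<theta>_def field_simps power2_eq_square)
  ultimately show ?thesis by (simp only:) (meson exp_le_cancel_iff order_trans)
qed

lemma world_dot_sum_upper:
  assumes "dot d u u = 1"
  shows "measure (world d n k) {\<omega>\<in>space (world d n k). real n * (5/4) \<le> (\<Sum>i<n. (dot d u (snd (\<omega> i)))\<^sup>2)}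
    \<le> exp (- real n / 256)"
proof -
  \<comment> \<open>Chernoff parameter 1/32: the moment costs 1/32 + 1/256 = 9/256 per point and the
    threshold gains (1/32)(5/4) = 10/256.\<close>
  have "1 / sqrt (1 - 1/16) \<le> exp ((1/16) / 2 + (1/16)\<^sup>2 :: real)" by (intro inverse_sqrt_le_exp) auto
  then have "(\<integral>\<^sup>+g. ennreal (exp (1/32 * (dot d u g)\<^sup>2)) \<partial>noise d) \<le> ennreal (exp (9/256))"
    using noise_exp_dot[of "1/32" d u] assms by (auto intro!: ennreal_leI simp: power2_eq_square)
  then have "measure (world d n k) {\<omega>\<in>space (world d n k). 1/32 * (real n * (5/4)) \<le> (\<Sum>i<n. 1/32 * (dot d u (snd (\<omega> i)))\<^sup>2)}
      \<le> exp (real n * (9/256) - 1/32 * (real n * (5/4)))"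
    by (intro world_sum_tail) auto
  then show ?thesis by (simp add: sum_divide_distrib[symmetric] field_simps)
qed

text \<open>At parameter 1/3 the moment is 3^(d/2) \<le> exp(2d/3), which the 2 d in the threshold
  cancels, and 6 ln n leaves n^(-2) per point. The union over n points gives 1/n.\<close>

lemma world_norm_max:
  assumes "0 < n"
  shows "measure (world d n k) {\<omega>\<in>space (world d n k). \<exists>i<n. 2 * real d + 6 * ln (real n) \<le> dot d (snd (\<omega> i)) (snd (\<omega> i))}
    \<le> 1 / real n"
proof -
  interpret prob_space "world d n k" by (rule prob_space_world)
  let ?A = "\<lambda>i. {\<omega>\<in>space (world d n k). 1/3 * (2 * real d + 6 * ln (real n)) \<le> 1/3 * dot d (snd (\<omega> i)) (snd (\<omega> i))}"
  have sq: "1 / sqrt (1/3) \<le> exp (2/3 :: real)"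
  proof -
    have "3 \<le> 1 + 4/3 + (4/3)\<^sup>2 / (2::real)" by (simp add: power2_eq_square)
    also have "\<dots> \<le> exp (4/3)" by (rule exp_lower_Taylor_quadratic) simp
    finally have "sqrt 3 \<le> sqrt (exp (4/3 :: real))" by simp
    also have "\<dots> = exp (2/3)" by (rule real_sqrt_unique) (simp_all add: exp_double[symmetric])
    finally show ?thesis by (simp add: real_sqrt_divide)
  qed
  have "prob (?A i) \<le> 1 / (real n)\<^sup>2" if i: "i < n" for i
  proof -
    have "(\<integral>\<^sup>+\<omega>. ennreal (exp (1/3 * dot d (snd (\<omega> i)) (snd (\<omega> i)))) \<partial>world d n k) = (\<integral>\<^sup>+g. ennreal (exp (1/3 * dot d g g)) \<partial>noise d)"
      using i by (intro nn_integral_world_component[where F = "\<lambda>g. ennreal (exp (1/3 * dot d g g))"]) auto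
    also have "\<dots> = ennreal ((1 / sqrt (1 - 2 * (1/3))) ^ d)" by (rule noise_exp_norm) simp
    also have "\<dots> \<le> ennreal (exp (2/3) ^ d)" using sq by (intro ennreal_leI power_mono) auto
    finally have "prob (?A i) \<le> exp (2/3) ^ d * exp (- (1/3 * (2 * real d + 6 * ln (real n))))"
      using i by (intro Chernoff_bound) auto
    also have "\<dots> = exp (- 2 * ln (real n))" by (simp add: exp_of_nat_mult[symmetric] exp_add[symmetric] field_simps)
    also have "\<dots> = 1 / (real n)\<^sup>2" using assms by (simp add: exp_minus exp_double field_simps)
    finally show ?thesis .
  qed
  then have "(\<Sum>i<n. prob (?A i)) \<le> (\<Sum>i<n. 1 / (real n)\<^sup>2)" by (intro sum_mono) auto
  also have "\<dots> = 1 / real n" using assms by (simp add: power2_eq_square)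
  finally have "(\<Sum>i<n. prob (?A i)) \<le> 1 / real n" .
  moreover have "prob (\<Union>i\<in>{..<n}. ?A i) \<le> (\<Sum>i<n. prob (?A i))" by (intro finite_measure_subadditive_finite) auto
  moreover have "(\<Union>i\<in>{..<n}. ?A i) = {\<omega>\<in>space (world d n k). \<exists>i<n. 2 * real d + 6 * ln (real n) \<le> dot d (snd (\<omega> i)) (snd (\<omega> i))}"
    by auto
  ultimately show ?thesis by simp
qed

subsection \<open>Lower tail of the k-means optimum\<close>

text \<open>Agrees with \<open>cloud\<close> on its range but does not mention n, so an induction
  over the number of points can keep it fixed.\<close>

definition pos :: "(nat \<Rightarrow> nat \<Rightarrow> real) \<Rightarrow> (nat \<Rightarrow> nat \<times> (nat \<Rightarrow> real)) \<Rightarrow> nat \<Rightarrow> nat \<Rightarrow> real" where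
  "pos mu \<omega> i c = mu (fst (\<omega> i)) c + snd (\<omega> i) c"

lemma cloud_pos: "i < n \<Longrightarrow> c < d \<Longrightarrow> cloud d n mu \<omega> i c = pos mu \<omega> i c"
  by (simp add: cloud_def point_def pos_def)

definition fiber :: "(nat \<Rightarrow> nat) \<Rightarrow> nat \<Rightarrow> nat \<Rightarrow> nat set" where
  "fiber a n t = {j. j < n \<and> a j = t}"

lemma finite_fiber [simp]: "finite (fiber a n t)"
  by (simp add: fiber_def)

lemma fiber_Suc: "fiber a (Suc n) t = (if a n = t then insert n (fiber a n t) else fiber a n t)"
  by (auto simp: fiber_def less_Suc_eq)

lemma not_in_fiber [simp]: "n \<notin> fiber a n t"
  by (simp add: fiber_def)

section \<open>Laplace transform of the cost of a fixed assignment\<close>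

definition inertia :: "nat \<Rightarrow> (nat \<Rightarrow> nat \<Rightarrow> real) \<Rightarrow> nat set \<Rightarrow> real" where
  "inertia d X S = (\<Sum>j\<in>S. sqdist d (X j) (centroid X S))"

definition assignment_cost :: "nat \<Rightarrow> nat \<Rightarrow> (nat \<Rightarrow> nat) \<Rightarrow> (nat \<Rightarrow> nat \<Rightarrow> real) \<Rightarrow> nat \<Rightarrow> real" where
  "assignment_cost d k a X n = (\<Sum>t<k. inertia d X (fiber a n t))"

text \<open>The distance is to the old centroid, which does not involve the new point; this is what
  allows conditioning on the past. For empty \<open>S\<close> the weight is 0: the first point of a
  class is free.\<close>

lemma inertia_insert:
  assumes "finite S" "x \<notin> S"
  shows "inertia d X (insert x S)
     = inertia d X S + real (card S) / (real (card S) + 1) * sqdist d (X x) (centroid X S)"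
proof (cases "S = {}")
  case True
  then show ?thesis by (simp add: inertia_def centroid_def sqdist_def)
next
  case False
  define q where "q = real (card S)"
  have q: "0 < q" using assms False by (simp add: q_def card_gt_0_iff)
  have 1: "(\<Sum>j\<in>insert x S. (X j c - centroid X (insert x S) c)\<^sup>2)
     = (\<Sum>j\<in>S. (X j c - centroid X S c)\<^sup>2) + q / (q + 1) * (X x c - centroid X S c)\<^sup>2" for c
  proof -
    define m where "m = centroid X S c"
    have sumS: "(\<Sum>j\<in>S. X j c) = q * m" using q by (simp add: m_def centroid_def q_def)
    have m': "centroid X (insert x S) c = (q * m + X x c) / (q + 1)"
      using assms sumS by (simp add: centroid_def q_def add.commute)
    have "(\<Sum>j\<in>insert x S. (X j c - m)\<^sup>2) = (\<Sum>j\<in>insert x S. (X j c - centroid X (insert x S) c)\<^sup>2)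
       + (q + 1) * (centroid X (insert x S) c - m)\<^sup>2"
      using sum_sq_about[of "insert x S" "\<lambda>j. X j c" m] assms by (simp add: centroid_def q_def add.commute)
    moreover have "(\<Sum>j\<in>insert x S. (X j c - m)\<^sup>2) = (X x c - m)\<^sup>2 + (\<Sum>j\<in>S. (X j c - m)\<^sup>2)" using assms by simp
    moreover have "(q + 1) * (centroid X (insert x S) c - m)\<^sup>2 = (X x c - m)\<^sup>2 / (q + 1)"
    proof -
      have "centroid X (insert x S) c - m = (X x c - m) / (q + 1)" unfolding m' using q by (simp add: field_simps)
      then show ?thesis using q by (simp add: power2_eq_square)
    qed
    moreover have "(X x c - m)\<^sup>2 - (X x c - m)\<^sup>2 / (q + 1) = q / (q + 1) * (X x c - m)\<^sup>2"
      using q by (simp add: field_simps)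
    ultimately show ?thesis unfolding m_def[symmetric] by linarith
  qed
  show ?thesis
    unfolding inertia_def sum_sqdist_swap 1 sum.distrib
    by (simp add: sqdist_def sum_distrib_left q_def)
qed

lemma assignment_cost_Suc:
  assumes "a n < k"
  shows "assignment_cost d k a X (Suc n) = assignment_cost d k a X n
     + real (card (fiber a n (a n))) / (real (card (fiber a n (a n))) + 1) * sqdist d (X n) (centroid X (fiber a n (a n)))"
proof -
  let ?e = "real (card (fiber a n (a n))) / (real (card (fiber a n (a n))) + 1) * sqdist d (X n) (centroid X (fiber a n (a n)))"
  have "assignment_cost d k a X (Suc n) = (\<Sum>t<k. inertia d X (fiber a n t) + (if t = a n then ?e else 0))"
    unfolding assignment_cost_def
    by (intro sum.cong refl) (auto simp: fiber_Suc inertia_insert)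
  then show ?thesis using assms by (simp add: sum.distrib assignment_cost_def)
qed

lemma assignment_cost_le:
  assumes "\<forall>j<n. a j < k"
  shows "assignment_cost d k a X n \<le> (\<Sum>j<n. sqdist d (X j) (c (a j)))"
proof -
  have "assignment_cost d k a X n \<le> (\<Sum>t<k. \<Sum>j\<in>fiber a n t. sqdist d (X j) (c t))"
    unfolding assignment_cost_def inertia_def by (intro sum_mono sqdist_centroid_le) simp
  also have "\<dots> = (\<Sum>t<k. \<Sum>j\<in>{j\<in>{..<n}. a j = t}. sqdist d (X j) (c (a j)))"
    by (intro sum.cong) (auto simp: fiber_def)
  also have "\<dots> = (\<Sum>j<n. sqdist d (X j) (c (a j)))"
    using assms by (intro sum.group) auto
  finally show ?thesis .
qed

lemma assignment_cost_cong:
  assumes "\<And>j c. j < n \<Longrightarrow> c < d \<Longrightarrow> X j c = X' j c"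
  shows "assignment_cost d k a X n = assignment_cost d k a X' n"
proof -
  have "centroid X (fiber a n t) c = centroid X' (fiber a n t) c" if "c < d" for t c
    unfolding centroid_def using assms that by (intro arg_cong2[where f = "(/)"] sum.cong refl) (auto simp: fiber_def)
  then show ?thesis unfolding assignment_cost_def inertia_def sqdist_def
    using assms by (intro sum.cong refl) (auto simp: fiber_def)
qed

lemma site_exp_neg_sqdist:
  assumes "0 \<le> \<tau>"
  shows "(\<integral>\<^sup>+w. ennreal (exp (- \<tau> * sqdist d (\<lambda>c. mu (fst w) c + snd w c) m)) \<partial>site d k) \<le> ennreal ((1 / sqrt (1 + 2 * \<tau>)) ^ d)"
proof -
  interpret noise: prob_space "noise d" by (rule prob_space_noise)
  let ?T = "measure_pmf (pmf_of_set {..<k})"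
  have [measurable]: "(\<lambda>w. sqdist d (\<lambda>c. mu (fst w) c + snd w c) m) \<in> borel_measurable (?T \<Otimes>\<^sub>M noise d)"
  proof (rule borel_measurable_sqdist)
    fix c assume c: "c < d"
    have [measurable]: "(\<lambda>t. mu t c) \<in> ?T \<rightarrow>\<^sub>M borel" by simp
    show "(\<lambda>w. mu (fst w) c + snd w c) \<in> borel_measurable (?T \<Otimes>\<^sub>M noise d)" using c by measurable
  qed simp
  have "(\<integral>\<^sup>+w. ennreal (exp (- \<tau> * sqdist d (\<lambda>c. mu (fst w) c + snd w c) m)) \<partial>site d k)
     = (\<integral>\<^sup>+t. \<integral>\<^sup>+g. ennreal (exp (- \<tau> * sqdist d (\<lambda>c. mu t c + g c) m)) \<partial>noise d \<partial>?T)"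
    unfolding site_def by (subst noise.nn_integral_fst[symmetric]) auto
  also have "\<dots> \<le> (\<integral>\<^sup>+t. ennreal ((1 / sqrt (1 + 2 * \<tau>)) ^ d) \<partial>?T)"
    by (intro nn_integral_mono noise_exp_neg_sqdist assms)
  also have "\<dots> = ennreal ((1 / sqrt (1 + 2 * \<tau>)) ^ d)" by (simp add: measure_pmf.emeasure_space_1)
  finally show ?thesis .
qed

lemma measurable_pos: "i < n \<Longrightarrow> c < d \<Longrightarrow> (\<lambda>\<omega>. pos mu \<omega> i c) \<in> borel_measurable (world d n k)"
proof -
  assume i: "i < n" and c: "c < d"
  have "(\<lambda>\<omega>. cloud d n mu \<omega> i c) \<in> borel_measurable (world d n k)"
  proof (rule measurable_compose[OF measurable_cloud])
    have "(\<lambda>X. X i) \<in> data d n \<rightarrow>\<^sub>M pts d" using i measurable_component_singleton[of i "{..<n}" "\<lambda>_. pts d"] by simp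
    then show "(\<lambda>X. X i c) \<in> data d n \<rightarrow>\<^sub>M borel"
      using c measurable_component_singleton[of c "{..<d}" "\<lambda>_. borel"] measurable_compose by fastforce
  qed
  then show ?thesis using i c by (simp add: cloud_pos)
qed

lemma measurable_assignment_cost:
  assumes "n \<le> N"
  shows "(\<lambda>\<omega>. assignment_cost d k a (pos mu \<omega>) n) \<in> borel_measurable (world d N k')"
  unfolding assignment_cost_def inertia_def centroid_def
  using assms measurable_pos[of _ N]
  by (intro borel_measurable_sum borel_measurable_sqdist borel_measurable_divide borel_measurable_const) (auto simp: fiber_def)

text \<open>The last point is integrated out first. Given the others, it adds q/(q+1) times a
  squared distance to a fixed centroid, so its Laplace transform has a bound independent of that
  centroid. The weight is close to 1 only after r predecessors in the class; earlier points are
  estimated by the factor 1.\<close>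

lemma nn_integral_assignment_cost:
  assumes a: "\<forall>j<n. a j < k" and \<tau>: "0 \<le> \<tau>" and r: "0 < r"
  defines "b \<equiv> 1 / sqrt (1 + 2 * (\<tau> * (real r / (real r + 1))))"
  shows "(\<integral>\<^sup>+\<omega>. ennreal (exp (- \<tau> * assignment_cost d k a (pos mu \<omega>) n)) \<partial>world d n k')
     \<le> ennreal ((b ^ d) ^ card {i. i < n \<and> r \<le> card (fiber a i (a i))})"
  using a
proof (induction n)
  case 0
  interpret prob_space "world d 0 k'" by (rule prob_space_world)
  show ?case by (simp add: assignment_cost_def fiber_def inertia_def emeasure_space_1)
next
  case (Suc n)
  interpret product_sigma_finite "\<lambda>_::nat. site d k'" by (rule product_sigma_finite_site)
  let ?q = "card (fiber a n (a n))"
  \<comment> \<open>The weight q/(q+1) is lowered to r/(r+1) or to 0, so the factor of each point is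
    either \<open>b ^ d\<close> or 1.\<close>
  let ?p = "\<tau> * (if r \<le> ?q then real r / (real r + 1) else 0)"
  let ?m = "\<lambda>\<omega>. centroid (pos mu \<omega>) (fiber a n (a n))"
  let ?C = "\<lambda>\<omega>. assignment_cost d k a (pos mu \<omega>) n"
  have b: "0 \<le> b" by (simp add: b_def \<tau>)
  have step: "(\<integral>\<^sup>+y. ennreal (exp (- \<tau> * assignment_cost d k a (pos mu (x(n := y))) (Suc n))) \<partial>site d k')
      \<le> ennreal (exp (- \<tau> * ?C x)) * ennreal (if r \<le> ?q then b ^ d else 1)" for x
  proof -
    have same: "pos mu (x(n := y)) j c = pos mu x j c" if "j < n" for j c y using that by (simp add: pos_def)
    have cm: "centroid (pos mu (x(n := y))) (fiber a n (a n)) = ?m x" for y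
      unfolding centroid_def using same by (intro ext arg_cong2[where f = "(/)"] sum.cong refl) (auto simp: fiber_def)
    have pn: "pos mu (x(n := y)) n = (\<lambda>c. mu (fst y) c + snd y c)" for y by (auto simp: pos_def)
    have pt: "exp (- \<tau> * assignment_cost d k a (pos mu (x(n := y))) (Suc n))
       \<le> exp (- \<tau> * ?C x) * exp (- ?p * sqdist d (\<lambda>c. mu (fst y) c + snd y c) (?m x))" for y
    proof -
      have "assignment_cost d k a (pos mu (x(n := y))) n = ?C x"
        by (rule assignment_cost_cong) (simp add: same)
      then have eq: "assignment_cost d k a (pos mu (x(n := y))) (Suc n) = ?C x
         + real ?q / (real ?q + 1) * sqdist d (\<lambda>c. mu (fst y) c + snd y c) (?m x)"
        using Suc.prems by (simp only: assignment_cost_Suc cm pn lessI)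
      have "(if r \<le> ?q then real r / (real r + 1) else 0) \<le> real ?q / (real ?q + 1)"
      proof (cases "r \<le> ?q")
        case True
        have "real r * (real ?q + 1) \<le> real ?q * (real r + 1)" using True by (simp add: algebra_simps)
        then have "real r / (real r + 1) \<le> real ?q / (real ?q + 1)"
          by (subst frac_le_eq) (auto simp: divide_le_0_iff mult_pos_pos)
        then show ?thesis using True by simp
      qed simp
      then have "?p * sqdist d (\<lambda>c. mu (fst y) c + snd y c) (?m x)
         \<le> \<tau> * (real ?q / (real ?q + 1)) * sqdist d (\<lambda>c. mu (fst y) c + snd y c) (?m x)"
        using \<tau> by (intro mult_right_mono mult_left_mono sqdist_nonneg)
      then show ?thesis unfolding eq exp_add[symmetric] by (simp only: exp_le_cancel_iff) (simp add: algebra_simps)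
    qed
    have "(\<integral>\<^sup>+y. ennreal (exp (- \<tau> * assignment_cost d k a (pos mu (x(n := y))) (Suc n))) \<partial>site d k')
       \<le> (\<integral>\<^sup>+y. ennreal (exp (- \<tau> * ?C x)) * ennreal (exp (- ?p * sqdist d (\<lambda>c. mu (fst y) c + snd y c) (?m x))) \<partial>site d k')"
      using pt by (intro nn_integral_mono) (simp add: ennreal_mult'[symmetric] ennreal_leI del: mult_minus_left)
    also have "\<dots> = ennreal (exp (- \<tau> * ?C x)) * (\<integral>\<^sup>+y. ennreal (exp (- ?p * sqdist d (\<lambda>c. mu (fst y) c + snd y c) (?m x))) \<partial>site d k')"
    proof (rule nn_integral_cmult)
      let ?T = "measure_pmf (pmf_of_set {..<k'})"
      have [measurable]: "(\<lambda>w. sqdist d (\<lambda>c. mu (fst w) c + snd w c) (?m x)) \<in> borel_measurable (?T \<Otimes>\<^sub>M noise d)"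
      proof (rule borel_measurable_sqdist)
        fix c assume c: "c < d"
        have [measurable]: "(\<lambda>t. mu t c) \<in> ?T \<rightarrow>\<^sub>M borel" by simp
        show "(\<lambda>w. mu (fst w) c + snd w c) \<in> borel_measurable (?T \<Otimes>\<^sub>M noise d)" using c by measurable
      qed simp
      show "(\<lambda>y. ennreal (exp (- ?p * sqdist d (\<lambda>c. mu (fst y) c + snd y c) (?m x)))) \<in> borel_measurable (site d k')"
        unfolding site_def by measurable
    qed
    also have "\<dots> \<le> ennreal (exp (- \<tau> * ?C x)) * ennreal ((1 / sqrt (1 + 2 * ?p)) ^ d)"
      using \<tau> by (intro mult_left_mono site_exp_neg_sqdist) auto
    also have "(1 / sqrt (1 + 2 * ?p)) ^ d = (if r \<le> ?q then b ^ d else 1)" by (simp add: b_def)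
    finally show ?thesis .
  qed
  have "(\<integral>\<^sup>+\<omega>. ennreal (exp (- \<tau> * assignment_cost d k a (pos mu \<omega>) (Suc n))) \<partial>world d (Suc n) k')
     = (\<integral>\<^sup>+x. \<integral>\<^sup>+y. ennreal (exp (- \<tau> * assignment_cost d k a (pos mu (x(n := y))) (Suc n))) \<partial>site d k' \<partial>world d n k')"
    unfolding world_def lessThan_Suc
    by (rule product_nn_integral_insert)
       (use measurable_assignment_cost[of "Suc n" "Suc n" d k a mu k'] in \<open>simp_all add: world_def lessThan_Suc[symmetric]\<close>)
  also have "\<dots> \<le> (\<integral>\<^sup>+\<omega>. ennreal (exp (- \<tau> * ?C \<omega>)) * ennreal (if r \<le> ?q then b ^ d else 1) \<partial>world d n k')"
    by (intro nn_integral_mono step)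
  also have "\<dots> = (\<integral>\<^sup>+\<omega>. ennreal (exp (- \<tau> * ?C \<omega>)) \<partial>world d n k') * ennreal (if r \<le> ?q then b ^ d else 1)"
    using measurable_assignment_cost[of n n d k a mu k'] by (intro nn_integral_multc) simp
  also have "\<dots> \<le> ennreal ((b ^ d) ^ card {i. i < n \<and> r \<le> card (fiber a i (a i))}) * ennreal (if r \<le> ?q then b ^ d else 1)"
    using Suc by (intro mult_right_mono) auto
  also have "\<dots> = ennreal ((b ^ d) ^ card {i. i < Suc n \<and> r \<le> card (fiber a i (a i))})"
  proof -
    have "{i. i < Suc n \<and> r \<le> card (fiber a i (a i))}
       = (if r \<le> ?q then insert n {i. i < n \<and> r \<le> card (fiber a i (a i))} else {i. i < n \<and> r \<le> card (fiber a i (a i))})"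
      by (auto simp: less_Suc_eq)
    then show ?thesis using b by (simp add: ennreal_mult'[symmetric] mult.commute)
  qed
  finally show ?case .
qed

text \<open>A point is determined by its class and its number of predecessors there, so each class
  has at most r points with fewer than r predecessors.\<close>

lemma card_small_rank_le:
  assumes "\<forall>j<n. a j < k"
  shows "card {i. i < n \<and> card (fiber a i (a i)) < r} \<le> r * k"
proof -
  have "card {i. i < n \<and> card (fiber a i (a i)) < r} \<le> card ({..<k} \<times> {..<r})"
  proof (rule card_inj_on_le[where f = "\<lambda>i. (a i, card (fiber a i (a i)))"])
    show "inj_on (\<lambda>i. (a i, card (fiber a i (a i)))) {i. i < n \<and> card (fiber a i (a i)) < r}"
    proof (rule linorder_inj_onI')
      fix i j :: nat assume "i < j"
      show "(a i, card (fiber a i (a i))) \<noteq> (a j, card (fiber a j (a j)))"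
      proof
        assume eq: "(a i, card (fiber a i (a i))) = (a j, card (fiber a j (a j)))"
        then have "fiber a i (a i) \<subset> fiber a j (a j)" using \<open>i < j\<close> by (auto simp: fiber_def)
        then have "card (fiber a i (a i)) < card (fiber a j (a j))" by (intro psubset_card_mono) auto
        then show False using eq by simp
      qed
    qed
  qed (use assms in auto)
  then show ?thesis by (simp add: mult.commute)
qed

lemma measurable_cloud_coord: "i < n \<Longrightarrow> c < d \<Longrightarrow> (\<lambda>\<omega>. cloud d n mu \<omega> i c) \<in> borel_measurable (world d n k)"
  using measurable_pos[of i n c d mu k] by (simp add: cloud_pos)

lemma world_IP_lower_tail:
  assumes k: "0 < k" "k \<le> n" and \<tau>: "0 < \<tau>" and r: "0 < r" "r * k \<le> n"
  defines "b \<equiv> 1 / sqrt (1 + 2 * (\<tau> * (real r / (real r + 1))))"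
  shows "measure (world d n k) {\<omega>\<in>space (world d n k). IP d (cloud d n mu \<omega>) n k \<le> \<theta>}
    \<le> real k ^ n * (exp (\<tau> * (real n * \<theta>)) * (b ^ d) ^ (n - r * k))"
proof -
  interpret prob_space "world d n k" by (rule prob_space_world)
  let ?F = "{..<n} \<rightarrow>\<^sub>E {..<k}"
  let ?A = "\<lambda>a. {\<omega>\<in>space (world d n k). - \<tau> * (real n * \<theta>) \<le> - \<tau> * assignment_cost d k a (pos mu \<omega>) n}"
  have "1 \<le> sqrt (1 + 2 * (\<tau> * (real r / (real r + 1))))" using \<tau> by simp
  then have b: "0 \<le> b" "b \<le> 1" unfolding b_def by (auto simp: divide_le_eq_1)
  have meas: "(\<lambda>\<omega>. assignment_cost d k a (pos mu \<omega>) n) \<in> borel_measurable (world d n k)" for a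
    by (rule measurable_assignment_cost) simp
  have A: "prob (?A a) \<le> exp (\<tau> * (real n * \<theta>)) * (b ^ d) ^ (n - r * k)" if a: "a \<in> ?F" for a
  proof -
    have ak: "\<forall>j<n. a j < k" using a by auto
    have "card {..<n} = card ({i. i < n \<and> r \<le> card (fiber a i (a i))} \<union> {i. i < n \<and> card (fiber a i (a i)) < r})"
      by (rule arg_cong[where f = card]) auto
    also have "\<dots> = card {i. i < n \<and> r \<le> card (fiber a i (a i))} + card {i. i < n \<and> card (fiber a i (a i)) < r}"
      by (rule card_Un_disjoint) auto
    finally have "n - r * k \<le> card {i. i < n \<and> r \<le> card (fiber a i (a i))}"
      using card_small_rank_le[OF ak, of r] by simp
    then have "(b ^ d) ^ card {i. i < n \<and> r \<le> card (fiber a i (a i))} \<le> (b ^ d) ^ (n - r * k)"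
      using b by (intro power_decreasing) (auto intro: power_le_one)
    then have "(\<integral>\<^sup>+\<omega>. ennreal (exp (- \<tau> * assignment_cost d k a (pos mu \<omega>) n)) \<partial>world d n k) \<le> ennreal ((b ^ d) ^ (n - r * k))"
      using nn_integral_assignment_cost[OF ak, where d = d and mu = mu and k' = k and \<tau> = \<tau> and r = r] \<tau> r unfolding b_def
      by (meson ennreal_leI less_imp_le order_trans)
    then have "prob (?A a) \<le> (b ^ d) ^ (n - r * k) * exp (- (- \<tau> * (real n * \<theta>)))"
      using b meas by (intro Chernoff_bound) auto
    then show ?thesis by (simp add: mult.commute)
  qed
  have sub: "{\<omega>\<in>space (world d n k). IP d (cloud d n mu \<omega>) n k \<le> \<theta>} \<subseteq> (\<Union>a\<in>?F. ?A a)"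
  proof
    fix \<omega> assume \<omega>: "\<omega> \<in> {\<omega>\<in>space (world d n k). IP d (cloud d n mu \<omega>) n k \<le> \<theta>}"
    obtain a c where a: "\<forall>j<n. a j < k"
      and IP: "IP d (cloud d n mu \<omega>) n k = (1 / real n) * (\<Sum>j<n. sqdist d (cloud d n mu \<omega> j) (c (a j)))"
      using IP_attained_assignment[OF k, of d "cloud d n mu \<omega>"] by blast
    define a' where "a' = restrict a {..<n}"
    have a': "\<forall>j<n. a' j < k" "a' \<in> ?F" using a by (auto simp: a'_def)
    have n: "0 < real n" using k by simp
    have "assignment_cost d k a' (pos mu \<omega>) n = assignment_cost d k a' (cloud d n mu \<omega>) n"
      by (rule assignment_cost_cong) (simp add: cloud_pos)
    also have "\<dots> \<le> (\<Sum>j<n. sqdist d (cloud d n mu \<omega> j) (c (a' j)))" by (rule assignment_cost_le[OF a'(1)])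
    also have "\<dots> = real n * IP d (cloud d n mu \<omega>) n k" using n by (simp add: IP a'_def)
    also have "\<dots> \<le> real n * \<theta>" using \<omega> n by simp
    finally have "assignment_cost d k a' (pos mu \<omega>) n \<le> real n * \<theta>" .
    then have "\<omega> \<in> ?A a'" using \<omega> \<tau> by simp
    then show "\<omega> \<in> (\<Union>a\<in>?F. ?A a)" using a'(2) by blast
  qed
  have Am: "?A a \<in> events" for a
    by (intro borel_measurable_le borel_measurable_times borel_measurable_const meas)
  have fin: "finite ?F" by (intro finite_PiE) auto
  have "prob {\<omega>\<in>space (world d n k). IP d (cloud d n mu \<omega>) n k \<le> \<theta>} \<le> prob (\<Union>a\<in>?F. ?A a)"
    by (rule finite_measure_mono[OF sub sets.finite_UN[OF fin Am]])
  also have "\<dots> \<le> (\<Sum>a\<in>?F. prob (?A a))" 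
    by (rule finite_measure_subadditive_finite[OF fin]) (use Am in blast)
  also have "\<dots> \<le> (\<Sum>a\<in>?F. exp (\<tau> * (real n * \<theta>)) * (b ^ d) ^ (n - r * k))" by (intro sum_mono A)
  also have "\<dots> = real k ^ n * (exp (\<tau> * (real n * \<theta>)) * (b ^ d) ^ (n - r * k))"
    by (simp add: card_PiE)
  finally show ?thesis .
qed

section \<open>Numerical estimates for the exponent\<close>

lemma ln2_lower: "6929/10000 \<le> ln (2::real)"
  using ln_approx_bounds[of 2 3] by (simp add: eval_nat_numeral power_divide)

text \<open>The tangent of ln at 2, with ln 2 \<le> 25/36 and 25/36 - 1 = -11/36.\<close>

lemma ln_nat_le: "2 \<le> k \<Longrightarrow> ln (real k) \<le> real k / 2 - 11/36"
proof -
  assume k: "2 \<le> k"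
  have "ln (real k) = ln 2 + ln (real k / 2)" using k by (simp add: ln_div)
  also have "ln (real k / 2) \<le> real k / 2 - 1" using k by (intro ln_le_minus_one) simp
  finally show ?thesis using ln2_le_25_over_36 by simp
qed

text \<open>Above the threshold \<theta> the negative right-hand side of the claim is below -1/2 and
  absorbs the correction term. The exponent per point consists of ln k for the union over k^n
  assignments, \<tau> \<theta> from Chernoff, and half the logarithm per dimension for 99 percent of
  the points, with r = 32. When d is near 6 k the threshold is of order k, which forces a moderate
  \<tau> = 1/2. For d \<le> 3 k it is below 1/2, so \<tau> = 2 is affordable, and ln k, now large
  against d, calls for it.\<close>

lemma IP_threshold_exponent:
  assumes k: "2 \<le> k" "k \<le> d" "d \<le> 6 * k + 1"
  defines "\<theta> \<equiv> (real d + 1) / (2 * (6 * real k + 2 - real d))"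
  shows "\<exists>\<tau>>0. ln (real k) + \<tau> * \<theta> - (99/200) * real d * ln (1 + 2 * (\<tau> * (real 32 / (real 32 + 1)))) \<le> - (1/10)"
proof -
  have L1: "677/1000 \<le> ln (1 + 2 * (1/2 * (real 32 / (real 32 + 1))))"
  proof -
    have "ln (66/65 :: real) \<le> 66/65 - 1" by (rule ln_le_minus_one) simp
    moreover have "ln (65/33 :: real) = ln 2 - ln (66/65)" 
      using ln_div[of 2 "66/65"] by simp
    ultimately have "677/1000 \<le> ln (65/33 :: real)" using ln2_lower by simp
    then show ?thesis by simp
  qed
  have L2: "1565/1000 \<le> ln (1 + 2 * (2 * (real 32 / (real 32 + 1))))"
  proof -
    have "ln (132/161 :: real) \<le> 132/161 - 1" by (rule ln_le_minus_one) simp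
    moreover have "ln (161/33 :: real) = 2 * ln 2 - ln (132/161)"
    proof -
      have "2 * ln 2 = ln (4::real)" using ln_realpow[of 2 2] by simp
      then show ?thesis using ln_div[of 4 "132/161"] by simp
    qed
    ultimately have "1565/1000 \<le> ln (161/33 :: real)" using ln2_lower by simp
    then show ?thesis by simp
  qed
  have lk: "ln (real k) \<le> real k / 2 - 11/36" using k by (intro ln_nat_le)
  have dk: "2 \<le> real k" "real k \<le> real d" using k by auto
  consider "d = 6 * k + 1" | "3 * k + 1 \<le> d" "d \<le> 6 * k" | "d \<le> 3 * k" using k by linarith
  then show ?thesis
  proof cases
    case 1
    have d: "real d = 6 * real k + 1" using 1 by simp
    define P where "P = (99/200) * real d * ln (1 + 2 * (1/2 * (real 32 / (real 32 + 1))))"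
    have "(99/200) * real d * (677/1000) \<le> P"
      unfolding P_def by (rule mult_left_mono[OF L1]) simp
    moreover have "1/2 * \<theta> = (6 * real k + 2) / 4" unfolding \<theta>_def d by simp
    ultimately have "ln (real k) + 1/2 * \<theta> - P \<le> - (1/10)" using lk dk d by (simp add: field_simps)
    then show ?thesis unfolding P_def by (intro exI[of _ "1/2"] conjI) simp_all
  next
    case 2
    have d: "3 * real k + 1 \<le> real d" "real d \<le> 6 * real k" using 2 by linarith+
    define P where "P = (99/200) * real d * ln (1 + 2 * (1/2 * (real 32 / (real 32 + 1))))"
    have "(99/200) * real d * (677/1000) \<le> P"
      unfolding P_def by (rule mult_left_mono[OF L1]) simp
    moreover have "\<theta> \<le> (real d + 1) / 4"
      unfolding \<theta>_def using d dk by (intro divide_left_mono) auto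
    ultimately have "ln (real k) + 1/2 * \<theta> - P \<le> - (1/10)" using lk dk d by (simp add: field_simps)
    then show ?thesis unfolding P_def by (intro exI[of _ "1/2"] conjI) simp_all
  next
    case 3
    have d: "real d \<le> 3 * real k" using 3 by linarith
    define P where "P = (99/200) * real d * ln (1 + 2 * (2 * (real 32 / (real 32 + 1))))"
    have "(99/200) * real d * (1565/1000) \<le> P"
      unfolding P_def by (rule mult_left_mono[OF L2]) simp
    moreover have "2 * \<theta> \<le> 3/4 + (real d - 2) / 16"
    proof -
      have "2 * (x / (2 * y)) = x / y" for x y :: real by simp
      then have "2 * \<theta> = (real d + 1) / (6 * real k + 2 - real d)" unfolding \<theta>_def .
      also have "\<dots> \<le> (real d + 1) / (real d + 2)" using d dk by (intro divide_left_mono mult_pos_pos) auto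
      \<comment> \<open>The tangent of the concave function (d + 1) / (d + 2) at d = 2.\<close>
      also have "\<dots> \<le> 3/4 + (real d - 2) / 16"
      proof -
        have "0 \<le> (real d - 2)\<^sup>2" by simp
        then show ?thesis using dk by (simp add: field_simps power2_eq_square)
      qed
      finally show ?thesis .
    qed
    ultimately have "ln (real k) + 2 * \<theta> - P \<le> - (1/10)" using lk dk d by (simp add: field_simps)
    then show ?thesis unfolding P_def by (intro exI[of _ 2] conjI) simp_all
  qed
qed

lemma world_IP_small:
  assumes k: "2 \<le> k" "k \<le> d" "d \<le> 6 * k + 1" and n: "3200 * d \<le> n"
  shows "measure (world d n k) {\<omega>\<in>space (world d n k).
      IP d (cloud d n mu \<omega>) n k \<le> (real d + 1) / (2 * (6 * real k + 2 - real d))} \<le> exp (- real n / 10)"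
proof -
  define \<theta> where "\<theta> = (real d + 1) / (2 * (6 * real k + 2 - real d))"
  obtain \<tau> where \<tau>: "0 < \<tau>"
    and ex: "ln (real k) + \<tau> * \<theta> - (99/200) * real d * ln (1 + 2 * (\<tau> * (real 32 / (real 32 + 1)))) \<le> - (1/10)"
    using IP_threshold_exponent[OF k] unfolding \<theta>_def by blast
  define D where "D = 1 + 2 * (\<tau> * (real 32 / (real 32 + 1)))"
  have D: "1 < D" using \<tau> by (simp add: D_def)
  have nk: "k \<le> n" "32 * k \<le> n" using k n by auto
  have "measure (world d n k) {\<omega>\<in>space (world d n k). IP d (cloud d n mu \<omega>) n k \<le> \<theta>}
    \<le> real k ^ n * (exp (\<tau> * (real n * \<theta>)) * ((1 / sqrt D) ^ d) ^ (n - 32 * k))"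
    unfolding D_def using k \<tau> nk by (intro world_IP_lower_tail) auto
  also have "((1 / sqrt D) ^ d) ^ (n - 32 * k) = exp (- (real (d * (n - 32 * k)) * (ln D / 2)))"
  proof -
    have "1 / sqrt D = exp (- (ln D / 2))" using D by (simp add: exp_minus ln_sqrt[symmetric] inverse_eq_divide)
    then show ?thesis by (simp add: power_mult[symmetric] exp_of_nat_mult[symmetric])
  qed
  also have "real k ^ n = exp (real n * ln (real k))" using k by (simp add: exp_of_nat_mult)
  also have "exp (real n * ln (real k)) * (exp (\<tau> * (real n * \<theta>)) * exp (- (real (d * (n - 32 * k)) * (ln D / 2))))
      = exp (real n * (ln (real k) + \<tau> * \<theta>) - real (d * (n - 32 * k)) * (ln D / 2))"
    by (simp add: exp_add[symmetric] algebra_simps)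
  also have "\<dots> \<le> exp (- real n / 10)"
  proof -
    have lD: "0 \<le> ln D / 2" using D by simp
    \<comment> \<open>Here n \<ge> 3200 d enters: at most one percent of the points have fewer than
      32 predecessors in their class.\<close>
    have "100 * (32 * k) \<le> n" using k n by linarith
    then have "(99/100) * real n \<le> real (n - 32 * k)" using nk by (simp add: of_nat_diff)
    then have "real d * ((99/100) * real n) \<le> real d * real (n - 32 * k)" by (rule mult_left_mono) simp
    then have "real d * ((99/100) * real n) \<le> real (d * (n - 32 * k))" by simp
    then have "real d * ((99/100) * real n) * (ln D / 2) \<le> real (d * (n - 32 * k)) * (ln D / 2)"
      using lD by (rule mult_right_mono)
    moreover have "real n * (ln (real k) + \<tau> * \<theta> - (99/200) * real d * ln D) \<le> real n * (- (1/10))"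
      using ex unfolding D_def by (intro mult_left_mono) auto
    ultimately show ?thesis by (simp add: algebra_simps)
  qed
  finally show ?thesis unfolding \<theta>_def .
qed

section \<open>From conditional to joint probability\<close>

lemma AE_site_label: "0 < k \<Longrightarrow> AE w in site d k. fst w < k"
proof -
  assume k: "0 < k"
  interpret noise: prob_space "noise d" by (rule prob_space_noise)
  interpret pair_sigma_finite "measure_pmf (pmf_of_set {..<k})" "noise d"
    by (intro pair_sigma_finite.intro prob_space_imp_sigma_finite prob_space_measure_pmf prob_space_noise)
  have "AE t in measure_pmf (pmf_of_set {..<k}). AE g in noise d. t < k"
    using k by (intro AE_pmfI) (auto simp: lessThan_empty_iff)
  moreover have "{w \<in> space (measure_pmf (pmf_of_set {..<k}) \<Otimes>\<^sub>M noise d). fst w < k}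
      \<in> sets (measure_pmf (pmf_of_set {..<k}) \<Otimes>\<^sub>M noise d)"
  proof -
    have [measurable]: "Measurable.pred (measure_pmf (pmf_of_set {..<k})) (\<lambda>t. t < k)" by simp
    show ?thesis by measurable
  qed
  ultimately have "AE w in measure_pmf (pmf_of_set {..<k}) \<Otimes>\<^sub>M noise d. fst w < k"
    by (intro AE_pair_measure) auto
  then show ?thesis unfolding site_def .
qed

lemma AE_world_label: "0 < k \<Longrightarrow> AE \<omega> in world d n k. \<forall>i<n. fst (\<omega> i) < k"
proof -
  assume k: "0 < k"
  have "AE \<omega> in world d n k. \<forall>i\<in>{..<n}. fst (\<omega> i) < k"
    unfolding world_def
    by (intro eventually_ball_finite ballI AE_PiM_component prob_space_site AE_site_label k) auto
  then show ?thesis by (rule eventually_mono) simp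
qed

text \<open>Fubini, with the outer integral moved to \<open>world\<close>: it suffices that for good
  data the procedure alone succeeds with probability 1 - \<epsilon>. Labels below k hold almost
  everywhere and may therefore be assumed for good data.\<close>

lemma joint_prob_ge:
  fixes \<epsilon> q q' :: real and mu :: "nat \<Rightarrow> nat \<Rightarrow> real"
  assumes k: "0 < k" "k \<le> s" "k \<le> n" and \<epsilon>: "0 \<le> \<epsilon>" "\<epsilon> \<le> 1"
    and G: "G \<in> sets (world d n k)" "1 - q \<le> measure (world d n k) G"
    and E: "\<And>\<omega>. \<omega> \<in> G \<Longrightarrow> \<forall>i<n. fst (\<omega> i) < k \<Longrightarrow>
       1 - \<epsilon> \<le> measure_pmf.prob (sampler n s l) {\<sigma>. \<forall>idx. kmpp_init d n k (cloud d n mu \<omega>) idx \<longrightarrow>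
            q' * IP d (cloud d n mu \<omega>) n k \<le> B_H d n k s l \<epsilon>' (cloud d n mu \<omega>) idx \<sigma>}"
  shows "1 - q - \<epsilon> \<le> measure (gmm_data d n k mu \<Otimes>\<^sub>M measure_pmf (sampler n s l))
               {p \<in> space (gmm_data d n k mu \<Otimes>\<^sub>M measure_pmf (sampler n s l)).
                  \<forall>idx. kmpp_init d n k (fst p) idx \<longrightarrow>
                    B_H d n k s l \<epsilon>' (fst p) idx (snd p) \<ge> q' * IP d (fst p) n k}"
proof -
  let ?S = "measure_pmf (sampler n s l)" and ?D = "gmm_data d n k mu"
  let ?P = "\<lambda>X \<sigma>. \<forall>idx. kmpp_init d n k X idx \<longrightarrow> q' * IP d X n k \<le> B_H d n k s l \<epsilon>' X idx \<sigma>"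
  let ?E = "{p \<in> space (?D \<Otimes>\<^sub>M ?S). ?P (fst p) (snd p)}"
  interpret W: prob_space "world d n k" by (rule prob_space_world)
  interpret D: prob_space ?D
    unfolding gmm_data_eq_distr[OF k(1)] by (rule W.prob_space_distr) simp
  interpret DS: pair_prob_space ?D ?S ..
  have setsD: "sets ?D = sets (data d n)" by (simp add: gmm_data_eq_distr[OF k(1)])
  have sets: "sets (?D \<Otimes>\<^sub>M ?S) = sets (data d n \<Otimes>\<^sub>M ?S)" by (intro sets_pair_measure_cong setsD refl)
  have Em: "?E \<in> sets (?D \<Otimes>\<^sub>M ?S)"
    unfolding sets sets_eq_imp_space_eq[OF sets] by (rule sets_B_H_event[OF k])
  have "ennreal (1 - q - \<epsilon>) \<le> ennreal ((1 - \<epsilon>) * W.prob G)"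
  proof (rule ennreal_leI)
    have "\<epsilon> * W.prob G \<le> \<epsilon> * 1" using \<epsilon> by (intro mult_left_mono) auto
    then show "1 - q - \<epsilon> \<le> (1 - \<epsilon>) * W.prob G" using G(2) by (simp add: left_diff_distrib)
  qed
  also have "\<dots> = (\<integral>\<^sup>+\<omega>. ennreal (1 - \<epsilon>) * indicator G \<omega> \<partial>world d n k)"
    using \<epsilon> G(1) by (subst nn_integral_cmult_indicator) (simp_all add: W.emeasure_eq_measure ennreal_mult')
  also have "\<dots> \<le> (\<integral>\<^sup>+\<omega>. emeasure ?S (Pair (cloud d n mu \<omega>) -` ?E) \<partial>world d n k)"
  proof (rule nn_integral_mono_AE)
    show "AE \<omega> in world d n k. ennreal (1 - \<epsilon>) * indicator G \<omega> \<le> emeasure ?S (Pair (cloud d n mu \<omega>) -` ?E)"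
      using AE_world_label[OF k(1), where d = d and n = n] AE_space
    proof eventually_elim
      case (elim \<omega>)
      show ?case
      proof (cases "\<omega> \<in> G")
        case True
        have "cloud d n mu \<omega> \<in> space ?D"
          using elim measurable_space[OF measurable_cloud] by (simp add: gmm_data_eq_distr[OF k(1)])
        then have "Pair (cloud d n mu \<omega>) -` ?E = {\<sigma>. ?P (cloud d n mu \<omega>) \<sigma>}"
          by (simp add: space_pair_measure vimage_def)
        then show ?thesis using E[OF True] elim True by (simp add: measure_pmf.emeasure_eq_measure ennreal_leI)
      qed simp
    qed
  qed
  also have "\<dots> = (\<integral>\<^sup>+X. emeasure ?S (Pair X -` ?E) \<partial>?D)"
  proof -
    define h where "h = (\<lambda>X. emeasure ?S (Pair X -` ?E))"
    have "h \<in> borel_measurable ?D"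
      unfolding h_def by (rule sigma_finite_measure.measurable_emeasure_Pair[OF prob_space_imp_sigma_finite[OF prob_space_measure_pmf] Em])
    then have "h \<in> borel_measurable (data d n)" by (subst measurable_cong_sets[OF setsD[symmetric] refl])
    then have "(\<integral>\<^sup>+\<omega>. h (cloud d n mu \<omega>) \<partial>world d n k) = (\<integral>\<^sup>+X. h X \<partial>?D)"
      by (subst gmm_data_eq_distr[OF k(1)]) (simp add: nn_integral_distr[OF measurable_cloud])
    then show ?thesis unfolding h_def .
  qed
  also have "\<dots> = emeasure (?D \<Otimes>\<^sub>M ?S) ?E" 
    by (rule sigma_finite_measure.emeasure_pair_measure_alt[OF prob_space_imp_sigma_finite[OF prob_space_measure_pmf] Em, symmetric])
  finally have "ennreal (1 - q - \<epsilon>) \<le> ennreal (measure (?D \<Otimes>\<^sub>M ?S) ?E)"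
    by (simp add: DS.emeasure_eq_measure)
  then show ?thesis by (simp add: ennreal_le_iff)
qed

text \<open>The constant 128 enters through 2 * 128 = 16^2. With Q = d + 3 ln n the bound is used
  twice: for B = b \<le> 8 Q it gives 1/2, for the range B = R = 2 Q of the sampled relaxations it
  gives 1/8.\<close>

lemma deviation_le:
  assumes \<epsilon>: "0 < \<epsilon>" "\<epsilon> < 1" and Q: "0 < Q" and l: "real l \<ge> 128 * Q\<^sup>2 * ln (1 / \<epsilon>)" and B: "0 \<le> B"
  shows "sqrt (B\<^sup>2 / (2 * real l) * ln (1 / \<epsilon>)) \<le> B / (16 * Q)"
proof (rule real_le_lsqrt[OF divide_nonneg_nonneg])
  have ln: "0 < ln (1 / \<epsilon>)" using \<epsilon> by simp
  then have pos: "0 < 128 * Q\<^sup>2 * ln (1 / \<epsilon>)" using Q by simp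
  have "B\<^sup>2 / (2 * real l) * ln (1 / \<epsilon>) = B\<^sup>2 * ln (1 / \<epsilon>) / 2 / real l" by simp
  also have "\<dots> \<le> B\<^sup>2 * ln (1 / \<epsilon>) / 2 / (128 * Q\<^sup>2 * ln (1 / \<epsilon>))"
  proof (rule divide_left_mono[OF l _ mult_pos_pos[OF _ pos]])
    show "0 < real l" using l pos by linarith
  qed (use ln in simp)
  also have "\<dots> = (B / (16 * Q))\<^sup>2" using ln Q by (simp add: field_simps power2_eq_square)
  finally show "B\<^sup>2 / (2 * real l) * ln (1 / \<epsilon>) \<le> (B / (16 * Q))\<^sup>2" .
qed (use B Q in auto)

lemma cloud_sqdist:
  assumes "i < n"
  shows "sqdist d (cloud d n mu \<omega> i) (mu (fst (\<omega> i))) = dot d (snd (\<omega> i)) (snd (\<omega> i))"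
  using assms by (simp add: sqdist_def dot_def cloud_pos pos_def power2_eq_square)

lemma kmpp_b_deviation:
  assumes k: "0 < k" "k \<le> n" and T: "\<forall>i<n. fst (\<omega> i) < k"
    and norm: "\<forall>i<n. dot d (snd (\<omega> i)) (snd (\<omega> i)) < 2 * real d + 6 * ln (real n)" and d: "0 < d"
    and \<epsilon>: "0 < \<epsilon>" "\<epsilon> < 1" and l: "real l \<ge> 128 * (real d + 3 * ln (real n))\<^sup>2 * ln (1 / \<epsilon>)"
    and init: "kmpp_init d n k (cloud d n mu \<omega>) idx"
  shows "sqrt ((kmpp_b d n k (cloud d n mu \<omega>) idx)\<^sup>2 / (2 * real l) * ln (1 / \<epsilon>)) \<le> 1/2"
proof -
  let ?b = "kmpp_b d n k (cloud d n mu \<omega>) idx" and ?Q = "real d + 3 * ln (real n)"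
  have n: "0 < n" using k by simp
  have Q: "0 < ?Q" using d n by (intro add_pos_nonneg) auto
  have "?b \<le> 4 * (2 * real d + 6 * ln (real n))"
    using kmpp_b_le[OF init k(1) n T, of mu "2 * real d + 6 * ln (real n)"] norm cloud_sqdist[of _ n d mu \<omega>]
    by (simp add: less_imp_le)
  then have b8: "?b \<le> 8 * ?Q" by simp
  have "sqrt (?b\<^sup>2 / (2 * real l) * ln (1 / \<epsilon>)) \<le> ?b / (16 * ?Q)"
    by (rule deviation_le[OF \<epsilon> Q l kmpp_b_nonneg[OF k(1) n]])
  also have "\<dots> \<le> 8 * ?Q / (16 * ?Q)" using b8 Q by (intro divide_right_mono) auto
  also have "\<dots> = 1/2" using Q by simp
  finally show ?thesis .
qed

subsection \<open>Low dimension, and McDiarmid's inequality\<close>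

lemma (in prob_space) prob_diff_ge: "A \<in> events \<Longrightarrow> prob A \<le> q \<Longrightarrow> 1 - q \<le> prob (space M - A)"
  by (subst prob_compl) auto

lemma sets_norm_max: "{\<omega>\<in>space (world d n k). \<exists>i<n. R \<le> dot d (snd (\<omega> i)) (snd (\<omega> i))} \<in> sets (world d n k)"
proof -
  have "{\<omega>\<in>space (world d n k). \<exists>i<n. R \<le> dot d (snd (\<omega> i)) (snd (\<omega> i))}
     = (\<Union>i\<in>{..<n}. {\<omega>\<in>space (world d n k). R \<le> dot d (snd (\<omega> i)) (snd (\<omega> i))})" by auto
  also have "\<dots> \<in> sets (world d n k)"
  proof (rule sets.finite_UN)
    fix i assume "i \<in> {..<n}"
    then have [measurable]: "(\<lambda>\<omega>. snd (\<omega> i)) \<in> world d n k \<rightarrow>\<^sub>M noise d" by simp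
    show "{\<omega>\<in>space (world d n k). R \<le> dot d (snd (\<omega> i)) (snd (\<omega> i))} \<in> sets (world d n k)" by measurable
  qed simp
  finally show ?thesis .
qed

text \<open>Of the relaxation only nonnegativity enters, so \<open>B_H\<close> \<ge> -1/2 for every
  outcome of the sampling. With -c the factor of \<open>IP\<close>, the event \<open>IP\<close> >
  1/(2c) brings the right-hand side to at most -1/2.\<close>

theorem B_H_lower_bound_low_dim:
  assumes k: "2 \<le> k" "k \<le> d" "d \<le> 6 * k + 1" and s: "d \<le> s" "s \<le> n" and n: "3200 * d \<le> n"
    and \<epsilon>: "0 < \<epsilon>" "\<epsilon> < 1" and l: "real l \<ge> 128 * (real d + 3 * ln (real n))\<^sup>2 * ln (1 / \<epsilon>)"
  shows "1 - (1 / real n + exp (- real n / 10)) - \<epsilon> \<le> measure (gmm_data d n k mu \<Otimes>\<^sub>M measure_pmf (sampler n s l))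
               {p \<in> space (gmm_data d n k mu \<Otimes>\<^sub>M measure_pmf (sampler n s l)).
                  \<forall>idx. kmpp_init d n k (fst p) idx \<longrightarrow>
                    B_H d n k s l \<epsilon> (fst p) idx (snd p)
                      \<ge> (real d - 6 * real k - 2) / (real d + 1) * IP d (fst p) n k}"
proof -
  interpret W: prob_space "world d n k" by (rule prob_space_world)
  define c where "c = (6 * real k + 2 - real d) / (real d + 1)"
  have "real d \<le> 6 * real k + 1" using k by linarith
  then have c: "0 < c" "(real d - 6 * real k - 2) / (real d + 1) = - c"
    unfolding c_def by (simp_all add: minus_divide_left)
  have th: "(real d + 1) / (2 * (6 * real k + 2 - real d)) = 1 / (2 * c)" unfolding c_def by simp
  let ?A = "{\<omega>\<in>space (world d n k). \<exists>i<n. 2 * real d + 6 * ln (real n) \<le> dot d (snd (\<omega> i)) (snd (\<omega> i))}"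
  let ?B = "{\<omega>\<in>space (world d n k). IP d (cloud d n mu \<omega>) n k \<le> 1 / (2 * c)}"
  have kn: "0 < k" "k \<le> s" "k \<le> n" "0 < n" "0 < d" using k s by auto
  have A: "?A \<in> W.events" by (rule sets_norm_max)
  have "(\<lambda>\<omega>. IP d (cloud d n mu \<omega>) n k) \<in> borel_measurable (world d n k)"
    by (rule borel_measurable_IP) (rule measurable_cloud_coord)
  then have B: "?B \<in> W.events" by (intro borel_measurable_le borel_measurable_const)
  have "W.prob (?A \<union> ?B) \<le> W.prob ?A + W.prob ?B" using A B by (rule measure_Un_le)
  also have "\<dots> \<le> 1 / real n + exp (- real n / 10)"
    using world_norm_max[OF kn(4), of d k] world_IP_small[OF k n, of mu] unfolding th by (intro add_mono)
  finally have G: "1 - (1 / real n + exp (- real n / 10)) \<le> W.prob (space (world d n k) - (?A \<union> ?B))"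
    using A B by (intro W.prob_diff_ge) auto
  show ?thesis
    unfolding c(2)
  proof (rule joint_prob_ge[OF kn(1-3) _ _ _ G])
    fix \<omega> assume \<omega>: "\<omega> \<in> space (world d n k) - (?A \<union> ?B)" and T: "\<forall>i<n. fst (\<omega> i) < k"
    let ?X = "cloud d n mu \<omega>"
    have norm: "\<forall>i<n. dot d (snd (\<omega> i)) (snd (\<omega> i)) < 2 * real d + 6 * ln (real n)" using \<omega> by (auto simp: not_le)
    have "1 / (2 * c) < IP d ?X n k" using \<omega> by auto
    then have IP: "1/2 \<le> c * IP d ?X n k" using c(1) by (simp add: field_simps)
    have "- c * IP d ?X n k \<le> B_H d n k s l \<epsilon> ?X idx \<sigma>" if "kmpp_init d n k ?X idx" for idx \<sigma>
    proof -
      have "0 \<le> (1 / real l) * (\<Sum>i<l. SDP d (\<lambda>j. ?X (\<sigma> i j)) s k)"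
        using kn by (intro mult_nonneg_nonneg sum_nonneg SDP_nonneg) auto
      then show ?thesis
        unfolding B_H_def using kmpp_b_deviation[OF kn(1,3) T norm kn(5) \<epsilon> l that] IP by linarith
    qed
    then have "{\<sigma>. \<forall>idx. kmpp_init d n k ?X idx \<longrightarrow> - c * IP d ?X n k \<le> B_H d n k s l \<epsilon> ?X idx \<sigma>} = UNIV" by auto
    then show "1 - \<epsilon> \<le> measure_pmf.prob (sampler n s l)
        {\<sigma>. \<forall>idx. kmpp_init d n k ?X idx \<longrightarrow> - c * IP d ?X n k \<le> B_H d n k s l \<epsilon> ?X idx \<sigma>}"
      using \<epsilon> by simp
  qed (use \<epsilon> A B in auto)
qed

section \<open>McDiarmid's inequality by integrating out coordinates\<close>

text \<open>One coordinate is changed at a time. The resulting global bound makes a function with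
  bounded differences integrable, as Fubini requires.\<close>

lemma bounded_diff_total:
  assumes bd: "\<And>x i y. x \<in> space (PiM {..<n} (\<lambda>_. N)) \<Longrightarrow> i < n \<Longrightarrow> y \<in> space N \<Longrightarrow> \<bar>f x - f (x(i := y))\<bar> \<le> (c::real)"
    and x: "x \<in> space (PiM {..<n} (\<lambda>_. N))" and z: "z \<in> space (PiM {..<n} (\<lambda>_. N))"
  shows "\<bar>f x - f z\<bar> \<le> real n * c"
proof -
  define h where "h j = (\<lambda>i. if i < j then z i else x i)" for j
  have "j \<le> n \<Longrightarrow> h j \<in> space (PiM {..<n} (\<lambda>_. N)) \<and> \<bar>f x - f (h j)\<bar> \<le> real j * c" for j
  proof (induction j)
    case 0
    then show ?case using x by (simp add: h_def)
  next
    case (Suc j)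
    have upd: "h (Suc j) = (h j)(j := z j)" by (rule ext) (simp add: h_def less_Suc_eq)
    have zj: "z j \<in> space N" using z Suc.prems PiE_mem[of z "{..<n}" "\<lambda>_. space N" j] by (simp add: space_PiM)
    have hj: "h j \<in> space (PiM {..<n} (\<lambda>_. N))" "\<bar>f x - f (h j)\<bar> \<le> real j * c"
      using Suc.IH Suc.prems by simp_all
    have "h (Suc j) \<in> space (PiM {..<n} (\<lambda>_. N))" unfolding upd using hj zj Suc.prems by (auto simp: space_PiM PiE_iff extensional_def)
    moreover have "\<bar>f (h j) - f (h (Suc j))\<bar> \<le> c" unfolding upd using bd[OF hj(1) _ zj] Suc.prems by simp
    ultimately show ?case using hj by (simp add: algebra_simps)
  qed
  from this[of n] have "\<bar>f x - f (h n)\<bar> \<le> real n * c" by simp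
  moreover have "h n = z"
    using x z by (intro ext) (auto simp: h_def space_PiM PiE_iff extensional_def)
  ultimately show ?thesis by simp
qed

text \<open>Integrating out the last coordinate leaves a function \<open>F\<close> whose differences
  are again at most c. For fixed other coordinates f lies within c of its value at a reference
  point, an interval of length 2c, and Hoeffding's lemma gives \<gamma>^2 (2c)^2 / 8 = \<gamma>^2
  c^2 / 2.\<close>

lemma McDiarmid_mgf:
  fixes f :: "(nat \<Rightarrow> 'a) \<Rightarrow> real"
  assumes N: "prob_space N" and \<gamma>: "0 < \<gamma>" and c: "0 \<le> c"
    and f: "f \<in> borel_measurable (PiM {..<n} (\<lambda>_. N))"
    and bd: "\<And>x i y. x \<in> space (PiM {..<n} (\<lambda>_. N)) \<Longrightarrow> i < n \<Longrightarrow> y \<in> space N \<Longrightarrow> \<bar>f x - f (x(i := y))\<bar> \<le> c"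
  shows "(\<integral>\<^sup>+x. ennreal (exp (\<gamma> * (f x - (\<integral>x. f x \<partial>PiM {..<n} (\<lambda>_. N))))) \<partial>PiM {..<n} (\<lambda>_. N))
     \<le> ennreal (exp (real n * (\<gamma>\<^sup>2 * c\<^sup>2 / 2)))"
  using f bd
proof (induction n arbitrary: f)
  case 0
  interpret prob_space "PiM {} (\<lambda>_::nat. N)" by (intro prob_space_PiM N)
  let ?P = "PiM {} (\<lambda>_::nat. N)"
  have z: "f x = f (\<lambda>_. undefined)" if "x \<in> space ?P" for x
    using that by (simp add: space_PiM)
  have "(\<integral>x. f x \<partial>?P) = (\<integral>x. f (\<lambda>_. undefined) \<partial>?P)" by (rule Bochner_Integration.integral_cong[OF refl z])
  then have E: "(\<integral>x. f x \<partial>?P) = f (\<lambda>_. undefined)" by (simp add: prob_space)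
  have "(\<integral>\<^sup>+x. ennreal (exp (\<gamma> * (f x - (\<integral>x. f x \<partial>?P)))) \<partial>?P) = (\<integral>\<^sup>+x. 1 \<partial>?P)"
    unfolding E by (intro nn_integral_cong) (simp only: z, simp)
  also have "\<dots> = 1" by (simp add: emeasure_space_1)
  finally show ?case by simp
next
  case (Suc n)
  interpret N: prob_space N by (rule N)
  interpret product_sigma_finite "\<lambda>_::nat. N" by (intro product_sigma_finite.intro prob_space_imp_sigma_finite N)
  let ?P = "PiM {..<n} (\<lambda>_. N)" and ?Q = "PiM {..<Suc n} (\<lambda>_. N)"
  interpret P: prob_space ?P by (intro prob_space_PiM N)
  interpret Q: prob_space ?Q by (intro prob_space_PiM N)
  have ins: "insert n {..<n} = {..<Suc n}" by auto
  define F where "F x = (\<integral>y. f (x(n := y)) \<partial>N)" for x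
  obtain y0 where y0: "y0 \<in> space N" using N.not_empty by blast
  have upd: "x(n := y) \<in> space ?Q" if "x \<in> space ?P" "y \<in> space N" for x y
    using that by (auto simp: space_PiM PiE_iff extensional_def)
  have fm [measurable]: "(\<lambda>(x, y). f (x(n := y))) \<in> borel_measurable (?P \<Otimes>\<^sub>M N)"
  proof -
    have "(\<lambda>(x, y). x(n := y)) \<in> ?P \<Otimes>\<^sub>M N \<rightarrow>\<^sub>M PiM (insert n {..<n}) (\<lambda>_. N)" by (rule measurable_add_dim)
    then have "(\<lambda>p. f ((\<lambda>(x, y). x(n := y)) p)) \<in> borel_measurable (?P \<Otimes>\<^sub>M N)"
      unfolding ins by (rule measurable_compose[OF _ Suc.prems(1)])
    then show ?thesis by (simp add: case_prod_unfold)
  qed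
  have Fm [measurable]: "F \<in> borel_measurable ?P"
    unfolding F_def using N.borel_measurable_lebesgue_integral[OF fm] by simp
  have bdy: "\<bar>f (x(n := y)) - f (x(n := y'))\<bar> \<le> c" if "x \<in> space ?P" "y \<in> space N" "y' \<in> space N" for x y y'
    using Suc.prems(2)[OF upd[OF that(1,2)] _ that(3), of n] by (simp only: fun_upd_upd lessI simp_thms)
  have int: "interval_bounded_random_variable N (\<lambda>y. f (x(n := y))) (f (x(n := y0)) - c) (f (x(n := y0)) + c)"
    if x: "x \<in> space ?P" for x
  proof unfold_locales
    show "(\<lambda>y. f (x(n := y))) \<in> borel_measurable N"
      using measurable_Pair2[OF fm x] by simp
    show "AE y in N. f (x(n := y)) \<in> {f (x(n := y0)) - c..f (x(n := y0)) + c}"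
    proof (rule AE_I2)
      fix y assume "y \<in> space N"
      from bdy[OF x this y0] show "f (x(n := y)) \<in> {f (x(n := y0)) - c..f (x(n := y0)) + c}"
        by (simp add: abs_le_iff)
    qed
  qed
  have integ: "integrable N (\<lambda>y. f (x(n := y)))" if "x \<in> space ?P" for x
    using interval_bounded_random_variable.integrable[OF int[OF that]] .
  have step: "(\<integral>\<^sup>+y. ennreal (exp (\<gamma> * (f (x(n := y)) - F x))) \<partial>N) \<le> ennreal (exp (\<gamma>\<^sup>2 * c\<^sup>2 / 2))" if x: "x \<in> space ?P" for x
  proof -
    interpret I: interval_bounded_random_variable N "\<lambda>y. f (x(n := y))" "f (x(n := y0)) - c" "f (x(n := y0)) + c"
      by (rule int[OF x])
    have "\<gamma>\<^sup>2 * (f (x(n := y0)) + c - (f (x(n := y0)) - c))\<^sup>2 / 8 = \<gamma>\<^sup>2 * c\<^sup>2 / 2"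
      by (simp add: power2_eq_square)
    then show ?thesis using I.Hoeffdings_lemma_nn_integral[OF \<gamma>] unfolding F_def by simp
  qed
  have Fbd: "\<bar>F x - F (x(i := y))\<bar> \<le> c" if x: "x \<in> space ?P" and i: "i < n" and y: "y \<in> space N" for x i y
  proof -
    have x': "x(i := y) \<in> space ?P" using x i y by (auto simp: space_PiM PiE_iff extensional_def)
    have "F x - F (x(i := y)) = (\<integral>z. f (x(n := z)) - f ((x(i := y))(n := z)) \<partial>N)"
      unfolding F_def by (rule Bochner_Integration.integral_diff[symmetric]) (intro integ x x')+
    also have "\<bar>\<dots>\<bar> \<le> (\<integral>z. \<bar>f (x(n := z)) - f ((x(i := y))(n := z))\<bar> \<partial>N)" by (rule integral_abs_bound)
    also have "\<dots> \<le> (\<integral>z. c \<partial>N)"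
    proof (rule integral_mono)
      show "integrable N (\<lambda>z. \<bar>f (x(n := z)) - f ((x(i := y))(n := z))\<bar>)" using integ[OF x] integ[OF x'] by auto
      fix z assume z: "z \<in> space N"
      have eq: "(x(i := y))(n := z) = (x(n := z))(i := y)" using i by (auto simp: fun_upd_twist)
      have "i < Suc n" using i by simp
      from Suc.prems(2)[OF upd[OF x z] this y] show "\<bar>f (x(n := z)) - f ((x(i := y))(n := z))\<bar> \<le> c"
        unfolding eq .
    qed simp
    also have "\<dots> = c" by (simp add: N.prob_space)
    finally show ?thesis .
  qed
  have EF: "(\<integral>x. F x \<partial>?P) = (\<integral>x. f x \<partial>?Q)"
  proof -
    obtain x0 where x0: "x0 \<in> space ?Q" using Q.not_empty by blast
    have "integrable ?Q f"
    proof (rule Q.integrable_const_bound[where B = "\<bar>f x0\<bar> + real (Suc n) * c"])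
      show "AE x in ?Q. norm (f x) \<le> \<bar>f x0\<bar> + real (Suc n) * c"
      proof (rule AE_I2)
        fix x assume x: "x \<in> space ?Q"
        have "\<bar>f x - f x0\<bar> \<le> real (Suc n) * c" by (rule bounded_diff_total[OF Suc.prems(2) x x0])
        then show "norm (f x) \<le> \<bar>f x0\<bar> + real (Suc n) * c" by simp
      qed
    qed (rule Suc.prems(1))
    then show ?thesis
      using product_integral_insert[of "{..<n}" n f] unfolding ins F_def by simp
  qed
  have "(\<integral>\<^sup>+x. ennreal (exp (\<gamma> * (f x - (\<integral>x. f x \<partial>?Q)))) \<partial>?Q)
     = (\<integral>\<^sup>+x. \<integral>\<^sup>+y. ennreal (exp (\<gamma> * (f (x(n := y)) - (\<integral>x. f x \<partial>?Q)))) \<partial>N \<partial>?P)"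
    unfolding ins[symmetric] by (rule product_nn_integral_insert) (use Suc.prems(1) in \<open>simp_all add: ins\<close>)
  also have "\<dots> \<le> (\<integral>\<^sup>+x. ennreal (exp (\<gamma> * (F x - (\<integral>x. F x \<partial>?P)))) * ennreal (exp (\<gamma>\<^sup>2 * c\<^sup>2 / 2)) \<partial>?P)"
  proof (rule nn_integral_mono)
    fix x assume x: "x \<in> space ?P"
    have [measurable]: "(\<lambda>y. f (x(n := y))) \<in> borel_measurable N" using integ[OF x] by auto
    have "(\<integral>\<^sup>+y. ennreal (exp (\<gamma> * (f (x(n := y)) - (\<integral>x. f x \<partial>?Q)))) \<partial>N)
       = (\<integral>\<^sup>+y. ennreal (exp (\<gamma> * (F x - (\<integral>x. F x \<partial>?P)))) * ennreal (exp (\<gamma> * (f (x(n := y)) - F x))) \<partial>N)"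
      unfolding EF by (intro nn_integral_cong) (simp add: ennreal_mult'[symmetric] exp_add[symmetric] algebra_simps)
    also have "\<dots> = ennreal (exp (\<gamma> * (F x - (\<integral>x. F x \<partial>?P)))) * (\<integral>\<^sup>+y. ennreal (exp (\<gamma> * (f (x(n := y)) - F x))) \<partial>N)"
      by (rule nn_integral_cmult) measurable
    also have "\<dots> \<le> ennreal (exp (\<gamma> * (F x - (\<integral>x. F x \<partial>?P)))) * ennreal (exp (\<gamma>\<^sup>2 * c\<^sup>2 / 2))"
      by (intro mult_left_mono step[OF x]) simp
    finally show "(\<integral>\<^sup>+y. ennreal (exp (\<gamma> * (f (x(n := y)) - (\<integral>x. f x \<partial>?Q)))) \<partial>N)
      \<le> ennreal (exp (\<gamma> * (F x - (\<integral>x. F x \<partial>?P)))) * ennreal (exp (\<gamma>\<^sup>2 * c\<^sup>2 / 2))" .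
  qed
  also have "\<dots> = (\<integral>\<^sup>+x. ennreal (exp (\<gamma> * (F x - (\<integral>x. F x \<partial>?P)))) \<partial>?P) * ennreal (exp (\<gamma>\<^sup>2 * c\<^sup>2 / 2))"
    by (rule nn_integral_multc) measurable
  also have "\<dots> \<le> ennreal (exp (real n * (\<gamma>\<^sup>2 * c\<^sup>2 / 2))) * ennreal (exp (\<gamma>\<^sup>2 * c\<^sup>2 / 2))"
    using Suc.IH[OF Fm Fbd] by (intro mult_right_mono) auto
  also have "\<dots> = ennreal (exp (real (Suc n) * (\<gamma>\<^sup>2 * c\<^sup>2 / 2)))"
    by (simp add: ennreal_mult'[symmetric] exp_add[symmetric] algebra_simps)
  finally show ?case .
qed

lemma McDiarmid:
  fixes f :: "(nat \<Rightarrow> 'a) \<Rightarrow> real"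
  assumes N: "prob_space N" and n: "0 < n" and t: "0 < t" and c: "0 < c"
    and f: "f \<in> borel_measurable (PiM {..<n} (\<lambda>_. N))"
    and bd: "\<And>x i y. x \<in> space (PiM {..<n} (\<lambda>_. N)) \<Longrightarrow> i < n \<Longrightarrow> y \<in> space N \<Longrightarrow> \<bar>f x - f (x(i := y))\<bar> \<le> c"
  shows "measure (PiM {..<n} (\<lambda>_. N)) {x \<in> space (PiM {..<n} (\<lambda>_. N)). (\<integral>x. f x \<partial>PiM {..<n} (\<lambda>_. N)) + t \<le> f x}
     \<le> exp (- t\<^sup>2 / (2 * real n * c\<^sup>2))"
proof -
  let ?P = "PiM {..<n} (\<lambda>_. N)"
  interpret prob_space ?P by (intro prob_space_PiM N)
  \<comment> \<open>The minimiser of n \<gamma>^2 c^2 / 2 - \<gamma> t.\<close>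
  define \<gamma> where "\<gamma> = t / (real n * c\<^sup>2)"
  have \<gamma>: "0 < \<gamma>" using n t c by (simp add: \<gamma>_def)
  note f [measurable]
  have "prob {x \<in> space ?P. \<gamma> * t \<le> \<gamma> * (f x - (\<integral>x. f x \<partial>?P))} \<le> exp (real n * (\<gamma>\<^sup>2 * c\<^sup>2 / 2)) * exp (- (\<gamma> * t))"
    using McDiarmid_mgf[OF N \<gamma> less_imp_le[OF c] f bd] by (intro Chernoff_bound) auto
  also have "{x \<in> space ?P. \<gamma> * t \<le> \<gamma> * (f x - (\<integral>x. f x \<partial>?P))} = {x \<in> space ?P. (\<integral>x. f x \<partial>?P) + t \<le> f x}"
    using \<gamma> by (auto simp: mult_le_cancel_left_pos)
  also have "exp (real n * (\<gamma>\<^sup>2 * c\<^sup>2 / 2)) * exp (- (\<gamma> * t)) = exp (- t\<^sup>2 / (2 * real n * c\<^sup>2))"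
    unfolding exp_add[symmetric] using n c by (simp add: \<gamma>_def field_simps power2_eq_square)
  finally show ?thesis .
qed

subsection \<open>Rounding to a grid\<close>

definition weighted_form :: "nat \<Rightarrow> nat \<Rightarrow> (nat \<Rightarrow> real) \<Rightarrow> (nat \<Rightarrow> nat \<Rightarrow> real) \<Rightarrow> (nat \<Rightarrow> real) \<Rightarrow> real" where
  "weighted_form d n w g v = (\<Sum>i<n. w i * (dot d v (g i))\<^sup>2)"

text \<open>With t the relative position of x between its two grid neighbours, the weights 1 - t and
  t cancel the linear term. The mean of the form is then A t (1 - t) h^2 \<ge> - L h^2 / 4, because
  t (1 - t) \<le> 1/4, and one neighbour reaches the mean.\<close>

lemma round_coordinate:
  fixes A B L h x :: real
  assumes h: "0 < h" and L: "0 \<le> L" and A: "- L \<le> A"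
  shows "\<exists>z::int. \<bar>h * of_int z - x\<bar> \<le> h \<and> - (L * h\<^sup>2 / 4) \<le> A * (h * of_int z - x)\<^sup>2 + B * (h * of_int z - x)"
proof -
  define z0 where "z0 = \<lfloor>x / h\<rfloor>"
  define t where "t = x / h - of_int z0"
  have t: "0 \<le> t" "t < 1" unfolding t_def z0_def by linarith+
  define q where "q y = A * y\<^sup>2 + B * y" for y
  have lo: "h * of_int z0 - x = - (t * h)" using h by (simp add: t_def field_simps)
  have hi: "h * of_int (z0 + 1) - x = (1 - t) * h" using h by (simp add: t_def field_simps)
  have "(1 - t) * q (- (t * h)) + t * q ((1 - t) * h) = A * (t * (1 - t)) * h\<^sup>2"
    unfolding q_def by (simp add: power2_eq_square algebra_simps)
  moreover have "- (L * h\<^sup>2 / 4) \<le> A * (t * (1 - t)) * h\<^sup>2"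
  proof -
    have "0 \<le> (t - 1/2)\<^sup>2" by simp
    then have tt: "0 \<le> t * (1 - t)" "t * (1 - t) \<le> 1/4" using t by (simp_all add: power2_eq_square algebra_simps mult_left_le)
    have "- (L / 4) \<le> - L * (t * (1 - t))" using mult_left_mono[OF tt(2) L] by simp
    also have "\<dots> \<le> A * (t * (1 - t))" using A tt(1) by (intro mult_right_mono)
    finally have "- (L / 4) * h\<^sup>2 \<le> A * (t * (1 - t)) * h\<^sup>2" by (rule mult_right_mono) simp
    then show ?thesis by simp
  qed
  ultimately have avg: "- (L * h\<^sup>2 / 4) \<le> (1 - t) * q (- (t * h)) + t * q ((1 - t) * h)" by simp
  have "- (L * h\<^sup>2 / 4) \<le> q (- (t * h)) \<or> - (L * h\<^sup>2 / 4) \<le> q ((1 - t) * h)"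
  proof (rule ccontr)
    assume "\<not> ?thesis"
    then have lt: "q (- (t * h)) < - (L * h\<^sup>2 / 4)" "q ((1 - t) * h) < - (L * h\<^sup>2 / 4)" by auto
    define M where "M = - (L * h\<^sup>2 / 4)"
    have "(1 - t) * q (- (t * h)) < (1 - t) * M" using lt t by (intro mult_strict_left_mono) (auto simp: M_def)
    moreover have "t * q ((1 - t) * h) \<le> t * M" using lt t by (intro mult_left_mono) (auto simp: M_def)
    moreover have "(1 - t) * M + t * M = M" by (simp add: algebra_simps)
    ultimately show False using avg unfolding M_def[symmetric] by linarith
  qed
  then show ?thesis
  proof
    assume "- (L * h\<^sup>2 / 4) \<le> q (- (t * h))"
    moreover have "t * h \<le> 1 * h" "0 \<le> t * h" using t h by (intro mult_right_mono mult_nonneg_nonneg; simp)+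
    then have "\<bar>- (t * h)\<bar> \<le> h" by simp
    ultimately show ?thesis unfolding q_def lo[symmetric] by blast
  next
    assume "- (L * h\<^sup>2 / 4) \<le> q ((1 - t) * h)"
    moreover have "(1 - t) * h \<le> 1 * h" "0 \<le> (1 - t) * h" using t h by (intro mult_right_mono mult_nonneg_nonneg; simp)+
    then have "\<bar>(1 - t) * h\<bar> \<le> h" by simp
    ultimately show ?thesis unfolding q_def hi[symmetric] by blast
  qed
qed

text \<open>Derandomised rounding to a grid: moving one coordinate to one of its two grid neighbours
  with the mean-preserving weights changes the quadratic form by a variance term on average.\<close>

lemma round_to_grid:
  fixes u :: "nat \<Rightarrow> real" and h L :: real and d :: nat and g :: "nat \<Rightarrow> nat \<Rightarrow> real"
  assumes h: "0 < h" and L: "0 \<le> L" and w: "\<forall>i<n. 0 \<le> w i"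
  defines "F \<equiv> (\<lambda>v. weighted_form d n w g v - L * dot d v v)"
  shows "\<exists>z :: nat \<Rightarrow> int. (\<forall>c<d. \<bar>h * of_int (z c) - u c\<bar> \<le> h) \<and>
     F u - real d * (L * h\<^sup>2 / 4) \<le> F (\<lambda>c. h * of_int (z c))"
proof -
  have step: "p \<le> d \<Longrightarrow> \<exists>v z. (\<forall>c<p. v c = h * of_int (z c) \<and> \<bar>v c - u c\<bar> \<le> h) \<and> (\<forall>c. p \<le> c \<longrightarrow> v c = u c) \<and>
     F u - real p * (L * h\<^sup>2 / 4) \<le> F v" for p
  proof (induction p)
    case 0
    then show ?case by (intro exI[of _ u]) simp
  next
    case (Suc p)
    have "p \<le> d" using Suc.prems by simp
    from Suc.IH[OF this] obtain v :: "nat \<Rightarrow> real" and z :: "nat \<Rightarrow> int"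
      where v: "\<forall>c<p. v c = h * of_int (z c) \<and> \<bar>v c - u c\<bar> \<le> h" "\<forall>c. p \<le> c \<longrightarrow> v c = u c"
      and F: "F u - real p * (L * h\<^sup>2 / 4) \<le> F v" by blast
    have p: "p < d" using Suc.prems by simp
    \<comment> \<open>Moving coordinate p by e changes \<open>F\<close> by A e^2 + B e. The weighted
      form has nonnegative curvature, so only the penalty can make \<open>A\<close> negative, and by
      no more than L.\<close>
    define A where "A = (\<Sum>i<n. w i * (g i p)\<^sup>2) - L"
    define B where "B = (\<Sum>i<n. w i * (2 * dot d v (g i) * g i p)) - L * (2 * v p)"
    have "0 \<le> (\<Sum>i<n. w i * (g i p)\<^sup>2)" using w by (intro sum_nonneg mult_nonneg_nonneg) auto
    then have "- L \<le> A" unfolding A_def by simp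
    from round_coordinate[OF h L this, of "v p" B] obtain y :: int
      where y: "\<bar>h * of_int y - v p\<bar> \<le> h"
        "- (L * h\<^sup>2 / 4) \<le> A * (h * of_int y - v p)\<^sup>2 + B * (h * of_int y - v p)" by blast
    define e where "e = h * of_int y - v p"
    define v' where "v' = (\<lambda>c. if c = p then h * of_int y else v c)"
    define z' where "z' = (\<lambda>c. if c = p then y else z c)"
    have dv: "dot d v' x = dot d v x + e * x p" for x
    proof -
      have "dot d v' x = (\<Sum>c<d. v c * x c + (if c = p then e * x p else 0))"
        unfolding dot_def by (intro sum.cong refl) (auto simp: v'_def e_def algebra_simps)
      then show ?thesis using p by (simp add: sum.distrib dot_def)
    qed
    have dvv: "dot d v' v' = dot d v v + 2 * e * v p + e\<^sup>2"
    proof -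
      have "v' p = v p + e" by (simp add: v'_def e_def)
      then have "dot d v' v' = dot d v v' + e * (v p + e)" using dv[of v'] by simp
      also have "dot d v v' = dot d v v + e * v p" using dv[of v] by (simp only: dot_commute[of d v v'])
      finally show ?thesis by (simp add: power2_eq_square algebra_simps)
    qed
    have wf: "weighted_form d n w g v' = weighted_form d n w g v
        + e * (\<Sum>i<n. w i * (2 * dot d v (g i) * g i p)) + e\<^sup>2 * (\<Sum>i<n. w i * (g i p)\<^sup>2)"
      unfolding weighted_form_def dv sum_distrib_left sum.distrib[symmetric]
      by (intro sum.cong refl) (simp add: power2_eq_square algebra_simps)
    have "F v' = F v + (A * e\<^sup>2 + B * e)"
      unfolding F_def wf dvv A_def B_def by (simp add: algebra_simps)
    then have "F u - real (Suc p) * (L * h\<^sup>2 / 4) \<le> F v'"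
    proof -
      have "real (Suc p) * (L * h\<^sup>2 / 4) = real p * (L * h\<^sup>2 / 4) + L * h\<^sup>2 / 4" by (simp add: algebra_simps)
      with \<open>F v' = F v + (A * e\<^sup>2 + B * e)\<close> F y(2)[folded e_def] show ?thesis by linarith
    qed
    moreover have "\<forall>c<Suc p. v' c = h * of_int (z' c) \<and> \<bar>v' c - u c\<bar> \<le> h"
      using v y(1) by (auto simp: v'_def z'_def less_Suc_eq)
    moreover have "\<forall>c. Suc p \<le> c \<longrightarrow> v' c = u c" using v(2) by (simp add: v'_def)
    ultimately show ?case by blast
  qed
  from step[OF order_refl] obtain v z where v: "\<forall>c<d. v c = h * of_int (z c) \<and> \<bar>v c - u c\<bar> \<le> h"
    and F: "F u - real d * (L * h\<^sup>2 / 4) \<le> F v" by blast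
  have "dot d v x = dot d (\<lambda>c. h * of_int (z c)) x" "dot d v v = dot d (\<lambda>c. h * of_int (z c)) (\<lambda>c. h * of_int (z c))" for x
    using v by (intro dot_cong; simp)+
  then have "F v = F (\<lambda>c. h * of_int (z c))" unfolding F_def weighted_form_def by (simp only:)
  moreover have "\<forall>c<d. \<bar>h * of_int (z c) - u c\<bar> \<le> h" using v by metis
  ultimately show ?thesis using F by (intro exI[of _ z] conjI) simp_all
qed

section \<open>A finite grid and the penalised maximum over it\<close>

definition grid_point :: "nat \<Rightarrow> (nat \<Rightarrow> int) \<Rightarrow> nat \<Rightarrow> real" where
  "grid_point d z = (\<lambda>c. (1 / (2 * sqrt (real d))) * of_int (z c))"

text \<open>A rounded unit vector u + a has |a|^2 \<le> d h^2 = 1/4, and |u + a|^2 \<le> (3/2) |u|^2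
  + 3 |a|^2 gives 9/4. The norm bound already forces coordinates at most 3 sqrt d in absolute value;
  the box makes the set visibly finite.\<close>

definition grid :: "nat \<Rightarrow> (nat \<Rightarrow> int) set" where
  "grid d = {z \<in> {..<d} \<rightarrow>\<^sub>E {- int (3 * d)..int (3 * d)}. dot d (grid_point d z) (grid_point d z) \<le> 9/4}"

lemma finite_grid: "finite (grid d)"
  unfolding grid_def by (rule finite_subset[of _ "{..<d} \<rightarrow>\<^sub>E {- int (3 * d)..int (3 * d)}"]) (auto intro!: finite_PiE)

lemma zero_in_grid: "(\<lambda>c\<in>{..<d}. 0) \<in> grid d"
  by (auto simp: grid_def grid_point_def dot_def)

lemma dot_grid_point: "0 < d \<Longrightarrow> dot d (grid_point d z) (grid_point d z) = (\<Sum>c<d. (real_of_int (z c))\<^sup>2) / (4 * real d)"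
  by (simp add: dot_def grid_point_def power2_eq_square sum_divide_distrib)

text \<open>The constant 17/16 is 1 + d h^2 / 4 for the mesh h = 1 / (2 sqrt d): the mean squared norm of a
  randomly rounded unit vector is at most that.\<close>

definition form_bound :: "nat \<Rightarrow> nat \<Rightarrow> real \<Rightarrow> (nat \<Rightarrow> real) \<Rightarrow> (nat \<Rightarrow> nat \<Rightarrow> real) \<Rightarrow> real" where
  "form_bound d n L w g = Max ((\<lambda>z. weighted_form d n w g (grid_point d z)
      - L * dot d (grid_point d z) (grid_point d z)) ` grid d) + L * (17/16)"

lemma form_bound_nonneg:
  assumes "0 \<le> L" shows "0 \<le> form_bound d n L w g"
proof -
  have "dot d (grid_point d (\<lambda>c\<in>{..<d}. 0)) x = 0" for x by (simp add: dot_def grid_point_def)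
  then have "0 \<in> (\<lambda>z. weighted_form d n w g (grid_point d z) - L * dot d (grid_point d z) (grid_point d z)) ` grid d"
    using zero_in_grid[of d] by (intro image_eqI[of _ _ "\<lambda>c\<in>{..<d}. 0"]) (simp_all add: weighted_form_def)
  then have "0 \<le> Max ((\<lambda>z. weighted_form d n w g (grid_point d z) - L * dot d (grid_point d z) (grid_point d z)) ` grid d)"
    by (intro Max_ge finite_imageI finite_grid)
  then show ?thesis using assms by (simp add: form_bound_def)
qed

text \<open>Rounding loses L/16 of the penalised form, and a unit vector has penalty L, so adding
  back 17/16 of L suffices. The penalty inside the maximum is what later makes the sum of
  exponential moments over the grid small.\<close>

lemma weighted_form_unit_le:
  assumes d: "0 < d" and L: "0 \<le> L" and w: "\<forall>i<n. 0 \<le> w i" and u: "dot d u u = 1"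
  shows "weighted_form d n w g u \<le> form_bound d n L w g"
proof -
  define h where "h = 1 / (2 * sqrt (real d))"
  have h: "0 < h" "h\<^sup>2 = 1 / (4 * real d)" using d by (simp_all add: h_def power2_eq_square)
  from round_to_grid[OF h(1) L w, where d = d and g = g and u = u]
  obtain z0 where z0: "\<forall>c<d. \<bar>h * of_int (z0 c) - u c\<bar> \<le> h"
    and F0: "weighted_form d n w g u - L * dot d u u - real d * (L * h\<^sup>2 / 4)
      \<le> weighted_form d n w g (\<lambda>c. h * of_int (z0 c)) - L * dot d (\<lambda>c. h * of_int (z0 c)) (\<lambda>c. h * of_int (z0 c))" by blast
  define z where "z = restrict z0 {..<d}"
  have zz: "grid_point d z c = h * of_int (z0 c)" if "c < d" for c using that by (simp add: z_def grid_point_def h_def)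
  have dz: "dot d (grid_point d z) x = dot d (\<lambda>c. h * of_int (z0 c)) x" for x
    by (rule dot_cong) (simp_all add: zz)
  have dzz: "dot d (grid_point d z) (grid_point d z) = dot d (\<lambda>c. h * of_int (z0 c)) (\<lambda>c. h * of_int (z0 c))"
    by (rule dot_cong) (simp_all add: zz)
  have F: "weighted_form d n w g u - L * (17/16) \<le> weighted_form d n w g (grid_point d z) - L * dot d (grid_point d z) (grid_point d z)"
    using F0 d unfolding dzz h(2) u by (simp add: weighted_form_def dz field_simps)
  have norm: "dot d (grid_point d z) (grid_point d z) \<le> 9/4"
  proof -
    have "dot d (grid_point d z) (grid_point d z) \<le> (\<Sum>c<d. 3/2 * (u c)\<^sup>2 + 3 * h\<^sup>2)"
      unfolding dzz unfolding dot_def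
    proof (rule sum_mono)
      fix c assume "c \<in> {..<d}"
      define a where "a = h * of_int (z0 c) - u c"
      have "\<bar>a\<bar> \<le> h" using z0 \<open>c \<in> {..<d}\<close> by (simp add: a_def)
      then have "a\<^sup>2 \<le> h\<^sup>2" using h(1) by (simp add: abs_le_square_iff[symmetric])
      moreover have "(u c + a)\<^sup>2 \<le> 3/2 * (u c)\<^sup>2 + 3 * a\<^sup>2"
      proof -
        have "0 \<le> (u c - 2 * a)\<^sup>2 / 2" by simp
        then show ?thesis by (simp add: power2_eq_square algebra_simps)
      qed
      moreover have "h * of_int (z0 c) = u c + a" by (simp add: a_def)
      ultimately show "h * of_int (z0 c) * (h * of_int (z0 c)) \<le> 3/2 * (u c)\<^sup>2 + 3 * h\<^sup>2"
        by (simp only: power2_eq_square[symmetric])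
    qed
    also have "\<dots> = 3/2 * dot d u u + 3 * (real d * h\<^sup>2)"
      unfolding sum.distrib sum_distrib_left[symmetric] by (simp add: dot_def power2_eq_square)
    also have "\<dots> = 9/4" unfolding u h(2) using d by simp
    finally show ?thesis .
  qed
  have "z \<in> grid d"
  proof -
    have "\<bar>z0 c\<bar> \<le> int (3 * d)" if c: "c < d" for c
    proof -
      have "(\<Sum>c<d. (real_of_int (z c))\<^sup>2) \<le> 9 * real d" using norm d by (simp add: dot_grid_point divide_le_eq)
      moreover have "(real_of_int (z c))\<^sup>2 \<le> (\<Sum>c<d. (real_of_int (z c))\<^sup>2)" using c by (intro member_le_sum) auto
      moreover have "9 * real d \<le> (3 * real d)\<^sup>2" using d by (simp add: power2_eq_square)
      ultimately have "(real_of_int (z c))\<^sup>2 \<le> (3 * real d)\<^sup>2" by linarith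
      then have "(real_of_int (z0 c))\<^sup>2 \<le> (3 * real d)\<^sup>2" using c by (simp add: z_def)
      then have "\<bar>real_of_int (z0 c)\<bar> \<le> \<bar>3 * real d\<bar>" by (simp only: abs_le_square_iff)
      then have "\<bar>real_of_int (z0 c)\<bar> \<le> 3 * real d" by simp
      then show ?thesis by linarith
    qed
    then show ?thesis using norm by (auto simp: grid_def z_def abs_le_iff minus_le_iff)
  qed
  then have "weighted_form d n w g (grid_point d z) - L * dot d (grid_point d z) (grid_point d z)
     \<le> Max ((\<lambda>z. weighted_form d n w g (grid_point d z) - L * dot d (grid_point d z) (grid_point d z)) ` grid d)"
    by (intro Max_ge finite_imageI finite_grid imageI)
  then show ?thesis using F by (simp add: form_bound_def)
qed

lemma weighted_form_le:
  assumes d: "0 < d" and L: "0 \<le> L" and w: "\<forall>i<n. 0 \<le> w i"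
  shows "weighted_form d n w g v \<le> form_bound d n L w g * dot d v v"
proof (cases "dot d v v = 0")
  case True
  then have "dot d v x = 0" for x by (simp add: dot_eq_0_iff) (simp add: dot_def)
  then show ?thesis using True by (simp add: weighted_form_def)
next
  case False
  then have pos: "0 < dot d v v" using dot_nonneg[of d v] by linarith
  define a where "a = 1 / sqrt (dot d v v)"
  have a2: "a\<^sup>2 = 1 / dot d v v" using pos by (simp add: a_def power_divide)
  have "dot d (\<lambda>c. a * v c) (\<lambda>c. a * v c) = a\<^sup>2 * dot d v v" by (simp add: dot_scale_left dot_scale_right power2_eq_square)
  then have u: "dot d (\<lambda>c. a * v c) (\<lambda>c. a * v c) = 1" using a2 pos by simp
  have "weighted_form d n w g (\<lambda>c. a * v c) = a\<^sup>2 * weighted_form d n w g v"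
    unfolding weighted_form_def sum_distrib_left by (intro sum.cong refl) (simp add: dot_scale_left power_mult_distrib)
  then have "weighted_form d n w g v / dot d v v \<le> form_bound d n L w g"
    using weighted_form_unit_le[OF d L w u, of g] a2 by simp
  then show ?thesis using pos by (simp add: field_simps)
qed

section \<open>Exponential moments over the grid\<close>

text \<open>The sum over all integers is about sqrt(4 pi), roughly 3.54. The term 2 (1/2)^L makes
  the bound inductive: from 3 on, exp(-L^2/4) \<le> (1/2)^L covers the two new terms, and the first
  two steps are computed.\<close>

lemma exp_neg_square_sum: "(\<Sum>z\<in>{- int L..int L}. exp (- (real_of_int z)\<^sup>2 / 4)) \<le> 4 - 2 * (1/2) ^ L"
proof (induction L)
  case 0
  then show ?case by simp
next
  case (Suc L)
  have "{- int (Suc L)..int (Suc L)} = insert (int (Suc L)) (insert (- int (Suc L)) {- int L..int L})" by auto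
  then have "(\<Sum>z\<in>{- int (Suc L)..int (Suc L)}. exp (- (real_of_int z)\<^sup>2 / 4))
     = 2 * exp (- (real (Suc L))\<^sup>2 / 4) + (\<Sum>z\<in>{- int L..int L}. exp (- (real_of_int z)\<^sup>2 / 4))"
    using power2_minus[of "1 + real L"] by simp
  also have "\<dots> \<le> 4 - 2 * (1/2) ^ Suc L"
  proof -
    have inv: "exp (- x) \<le> 1 / (1 + x + x\<^sup>2 / 2)" if "0 \<le> x" for x :: real
    proof -
      have "0 < 1 + x + x\<^sup>2 / 2" using that by (simp add: add_pos_nonneg)
      then show ?thesis using exp_lower_Taylor_quadratic[OF that] by (simp add: exp_minus inverse_eq_divide divide_left_mono)
    qed
    consider "L = 0" | "L = 1" | "2 \<le> L" by linarith
    then show ?thesis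
    proof cases
      case 1
      have "exp (- (1/4)) \<le> 1 / (1 + 1/4 + (1/4)\<^sup>2 / 2 :: real)" by (rule inv) simp
      then show ?thesis using 1 by (simp add: power2_eq_square)
    next
      case 2
      have e1: "exp (- (1/4)) \<le> 1 / (1 + 1/4 + (1/4)\<^sup>2 / 2 :: real)" by (rule inv) simp
      have e2: "exp (- 1) \<le> 1 / (1 + 1 + 1\<^sup>2 / 2 :: real)" by (rule inv) simp
      have "{- 1..1::int} = {-1, 0, 1}" by auto
      then show ?thesis using 2 e1 e2 by (simp add: power2_eq_square)
    next
      case 3
      have "exp (- (3/4)) \<le> 1 / (1 + 3/4 + (3/4)\<^sup>2 / 2 :: real)" by (rule inv) simp
      then have half: "exp (- (3/4)) \<le> (1/2 :: real)" by (simp add: power2_eq_square)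
      have "3 * real (Suc L) \<le> (real (Suc L))\<^sup>2"
        unfolding power2_eq_square using 3 by (intro mult_right_mono) auto
      then have "exp (- (real (Suc L))\<^sup>2 / 4) \<le> exp (real (Suc L) * - (3/4))" by simp
      also have "\<dots> = exp (- (3/4)) ^ Suc L" by (rule exp_of_nat_mult)
      also have "\<dots> \<le> (1/2) ^ Suc L" by (intro power_mono half) simp
      finally show ?thesis using Suc by simp
    qed
  qed
  finally show ?case .
qed

text \<open>With mesh 1 / (2 sqrt d) the exponent is a sum of z^2 / 4 over the coordinates, so over
  the full box the sum factors into d one-dimensional ones.\<close>

lemma grid_gauss_sum:
  assumes d: "0 < d"
  shows "(\<Sum>z\<in>grid d. exp (- real d * dot d (grid_point d z) (grid_point d z))) \<le> 4 ^ d"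
proof -
  let ?Z = "{- int (3 * d)..int (3 * d)}"
  have "(\<Sum>z\<in>grid d. exp (- real d * dot d (grid_point d z) (grid_point d z)))
     \<le> (\<Sum>z\<in>{..<d} \<rightarrow>\<^sub>E ?Z. exp (- real d * dot d (grid_point d z) (grid_point d z)))"
    by (intro sum_mono2 finite_PiE) (auto simp: grid_def)
  also have "\<dots> = (\<Sum>z\<in>{..<d} \<rightarrow>\<^sub>E ?Z. \<Prod>c<d. exp (- (real_of_int (z c))\<^sup>2 / 4))"
  proof (intro sum.cong refl)
    fix z :: "nat \<Rightarrow> int"
    have "- real d * dot d (grid_point d z) (grid_point d z) = (\<Sum>c<d. - (real_of_int (z c))\<^sup>2 / 4)"
      using d unfolding dot_grid_point[OF d] by (simp add: sum_negf sum_divide_distrib[symmetric])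
    then show "exp (- real d * dot d (grid_point d z) (grid_point d z)) = (\<Prod>c<d. exp (- (real_of_int (z c))\<^sup>2 / 4))"
      by (simp only: exp_sum finite_lessThan)
  qed
  also have "\<dots> = (\<Prod>c<d. \<Sum>z\<in>?Z. exp (- (real_of_int z)\<^sup>2 / 4))"
    by (rule prod_sum_PiE[symmetric]) auto
  also have "\<dots> \<le> (\<Prod>c<d. 4)"
  proof (rule prod_mono)
    fix c
    have "(\<Sum>z\<in>?Z. exp (- (real_of_int z)\<^sup>2 / 4)) \<le> 4 - 2 * (1/2) ^ (3 * d)" by (rule exp_neg_square_sum)
    also have "\<dots> \<le> 4" by simp
    finally show "0 \<le> (\<Sum>z\<in>?Z. exp (- (real_of_int z)\<^sup>2 / 4)) \<and> (\<Sum>z\<in>?Z. exp (- (real_of_int z)\<^sup>2 / 4)) \<le> 4"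
      by (simp add: sum_nonneg)
  qed
  finally show ?thesis by simp
qed

text \<open>By convexity exp(-2x) lies below its chord on [0, 3/4], and exp(-3/2) \<le> 1/4 places
  that chord below 1 - x.\<close>

lemma inverse_sqrt_le_exp':
  fixes x :: real
  assumes "0 \<le> x" "x \<le> 3/4"
  shows "1 / sqrt (1 - x) \<le> exp x"
proof -
  have e: "exp (- (3/2)) \<le> (1/4 :: real)"
  proof -
    have "1 + 3/4 + (3/4)\<^sup>2 / 2 \<le> exp (3/4 :: real)" by (rule exp_lower_Taylor_quadratic) simp
    then have "2 \<le> exp (3/4 :: real)" by (simp add: power2_eq_square)
    then have "2 * 2 \<le> exp (3/4 :: real) * exp (3/4)" by (intro mult_mono) auto
    also have "\<dots> = exp (3/2)" by (simp add: exp_add[symmetric])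
    finally have "1 / exp (3/2 :: real) \<le> 1 / 4" by (intro divide_left_mono) auto
    then show ?thesis by (simp add: exp_minus inverse_eq_divide)
  qed
  define t where "t = 4 * x / 3"
  have t: "0 \<le> t" "t \<le> 1" using assms by (simp_all add: t_def)
  have "exp (1 * ((1 - t) *\<^sub>R 0 + t *\<^sub>R - (3/2))) \<le> (1 - t) * exp (1 * 0) + t * exp (1 * - (3/2))"
    by (rule convex_onD[OF convex_on_exp]) (use t in auto)
  then have "exp (- (2 * x)) \<le> 1 - t + t * exp (- (3/2))" by (simp add: t_def)
  also have "\<dots> \<le> 1 - t + t * (1/4)" using e t by (intro add_left_mono mult_left_mono) auto
  finally have "exp (- (2 * x)) \<le> 1 - x" by (simp add: t_def)
  then have "sqrt (exp (- (2 * x))) \<le> sqrt (1 - x)" by simp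
  moreover have "sqrt (exp (- (2 * x))) = exp (- x)"
    by (rule real_sqrt_unique) (simp_all add: exp_double[symmetric])
  ultimately have "1 / sqrt (1 - x) \<le> 1 / exp (- x)" using assms by (intro divide_left_mono mult_pos_pos) auto
  then show ?thesis by (simp add: exp_minus inverse_eq_divide)
qed

text \<open>Jensen's bound of a mean by the logarithm of the moment generating function, obtained
  from the tangent 1 + y \<le> exp y at y = \<theta> Z - a, so without prior integrability. The
  condition a \<ge> 1 keeps the constant term (a - 1) / \<theta> nonnegative, as extended
  nonnegative reals require.\<close>

lemma (in prob_space) nn_integral_le_log_mgf:
  assumes [measurable]: "Z \<in> borel_measurable M" and "0 < \<theta>" "1 \<le> a"
    and mgf: "(\<integral>\<^sup>+\<omega>. ennreal (exp (\<theta> * Z \<omega>)) \<partial>M) \<le> ennreal (exp a)"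
  shows "(\<integral>\<^sup>+\<omega>. ennreal (Z \<omega>) \<partial>M) \<le> ennreal (a / \<theta>)"
proof -
  have pt: "ennreal (Z \<omega>) \<le> ennreal ((a - 1) / \<theta>) + ennreal (exp (- a) / \<theta>) * ennreal (exp (\<theta> * Z \<omega>))" for \<omega>
  proof -
    have "1 + (\<theta> * Z \<omega> - a) \<le> exp (\<theta> * Z \<omega> - a)" by (rule exp_ge_add_one_self)
    then have "\<theta> * Z \<omega> \<le> (a - 1) + exp (\<theta> * Z \<omega> - a)" by linarith
    then have "\<theta> * Z \<omega> \<le> (a - 1) + exp (- a) * exp (\<theta> * Z \<omega>)" by (simp add: exp_add[symmetric])
    then have "Z \<omega> \<le> ((a - 1) + exp (- a) * exp (\<theta> * Z \<omega>)) / \<theta>" using assms(2) by (simp only: pos_le_divide_eq mult.commute)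
    then have "Z \<omega> \<le> (a - 1) / \<theta> + exp (- a) / \<theta> * exp (\<theta> * Z \<omega>)" by (simp add: add_divide_distrib)
    then have "ennreal (Z \<omega>) \<le> ennreal ((a - 1) / \<theta> + exp (- a) / \<theta> * exp (\<theta> * Z \<omega>))" by (rule ennreal_leI)
    also have "\<dots> = ennreal ((a - 1) / \<theta>) + ennreal (exp (- a) / \<theta> * exp (\<theta> * Z \<omega>))"
      using assms by (intro ennreal_plus) auto
    also have "ennreal (exp (- a) / \<theta> * exp (\<theta> * Z \<omega>)) = ennreal (exp (- a) / \<theta>) * ennreal (exp (\<theta> * Z \<omega>))"
      using assms by (intro ennreal_mult) auto
    finally show ?thesis .
  qed
  have "(\<integral>\<^sup>+\<omega>. ennreal (Z \<omega>) \<partial>M) \<le> (\<integral>\<^sup>+\<omega>. ennreal ((a - 1) / \<theta>) + ennreal (exp (- a) / \<theta>) * ennreal (exp (\<theta> * Z \<omega>)) \<partial>M)"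
    by (intro nn_integral_mono pt)
  also have "\<dots> = ennreal ((a - 1) / \<theta>) + ennreal (exp (- a) / \<theta>) * (\<integral>\<^sup>+\<omega>. ennreal (exp (\<theta> * Z \<omega>)) \<partial>M)"
    by (simp add: nn_integral_add nn_integral_cmult emeasure_space_1)
  also have "\<dots> \<le> ennreal ((a - 1) / \<theta>) + ennreal (exp (- a) / \<theta>) * ennreal (exp a)"
    by (intro add_left_mono mult_left_mono mgf) simp
  also have "\<dots> = ennreal (a / \<theta>)"
  proof -
    have "(a - 1) / \<theta> + exp (- a) / \<theta> * exp a = a / \<theta>"
      using assms by (simp add: exp_minus field_simps)
    moreover have "0 \<le> (a - 1) / \<theta>" "0 \<le> exp (- a) / \<theta>" using assms by auto
    ultimately show ?thesis by (simp only: ennreal_mult'[symmetric] ennreal_plus[symmetric] mult_nonneg_nonneg exp_ge_zero)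
  qed
  finally show ?thesis .
qed

lemma nn_integral_exp_weighted_form:
  assumes w: "\<forall>i<n. 0 \<le> w i \<and> 2 * \<theta> * w i * dot d v v \<le> 3/4" and \<theta>: "0 \<le> \<theta>"
  shows "(\<integral>\<^sup>+\<omega>. ennreal (exp (\<theta> * weighted_form d n w (\<lambda>i. snd (\<omega> i)) v)) \<partial>world d n k)
     \<le> ennreal (exp (2 * \<theta> * dot d v v * (\<Sum>i<n. w i)))"
proof -
  have "(\<integral>\<^sup>+\<omega>. ennreal (exp (\<theta> * weighted_form d n w (\<lambda>i. snd (\<omega> i)) v)) \<partial>world d n k)
     = (\<integral>\<^sup>+\<omega>. (\<Prod>i<n. ennreal (exp (\<theta> * w i * (dot d v (snd (\<omega> i)))\<^sup>2))) \<partial>world d n k)"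
    by (intro nn_integral_cong) (simp add: weighted_form_def sum_distrib_left exp_sum prod_ennreal mult.assoc)
  also have "\<dots> = (\<Prod>i<n. \<integral>\<^sup>+g. ennreal (exp (\<theta> * w i * (dot d v g)\<^sup>2)) \<partial>noise d)"
    by (rule nn_integral_world_prod[where F = "\<lambda>i g. ennreal (exp (\<theta> * w i * (dot d v g)\<^sup>2))"]) simp
  also have "\<dots> \<le> (\<Prod>i<n. ennreal (exp (2 * \<theta> * w i * dot d v v)))"
  proof (rule prod_mono_ennreal)
    fix i assume "i \<in> {..<n}"
    then have wi: "0 \<le> w i" "2 * \<theta> * w i * dot d v v \<le> 3/4" using w by auto
    have "(\<integral>\<^sup>+g. ennreal (exp (\<theta> * w i * (dot d v g)\<^sup>2)) \<partial>noise d) = ennreal (1 / sqrt (1 - 2 * (\<theta> * w i) * dot d v v))"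
      using wi by (intro noise_exp_dot) (simp add: mult.assoc)
    also have "\<dots> \<le> ennreal (exp (2 * (\<theta> * w i) * dot d v v))"
      using wi \<theta> by (intro ennreal_leI inverse_sqrt_le_exp') (auto simp: mult.assoc dot_nonneg)
    finally show "(\<integral>\<^sup>+g. ennreal (exp (\<theta> * w i * (dot d v g)\<^sup>2)) \<partial>noise d) \<le> ennreal (exp (2 * \<theta> * w i * dot d v v))"
      by (simp add: mult.assoc)
  qed
  also have "\<dots> = ennreal (exp (2 * \<theta> * dot d v v * (\<Sum>i<n. w i)))"
    by (simp add: prod_ennreal exp_sum[symmetric]) (simp add: sum_distrib_left sum_distrib_right mult_ac)
  finally show ?thesis .
qed

lemma measurable_weighted_form:
  "(\<lambda>\<omega>. weighted_form d n w (\<lambda>i. snd (\<omega> i)) v) \<in> borel_measurable (world d n k)"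
  unfolding weighted_form_def
proof (rule borel_measurable_sum)
  fix i assume "i \<in> {..<n}"
  then have [measurable]: "(\<lambda>\<omega>. snd (\<omega> i)) \<in> world d n k \<rightarrow>\<^sub>M noise d" by simp
  show "(\<lambda>\<omega>. w i * (dot d v (snd (\<omega> i)))\<^sup>2) \<in> borel_measurable (world d n k)" by measurable
qed

lemma measurable_form_bound:
  "(\<lambda>\<omega>. form_bound d n L w (\<lambda>i. snd (\<omega> i))) \<in> borel_measurable (world d n k)"
  unfolding form_bound_def
  by (intro borel_measurable_add borel_measurable_const borel_measurable_Max finite_grid
      borel_measurable_diff measurable_weighted_form)

text \<open>The exponential of the maximum is at most the sum over the grid. \<theta> is the largest
  parameter with 2 \<theta> r (9/4) \<le> 3/4, the range of the moment estimate. L solves 2 \<theta>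
  s - \<theta> L = -d, which leaves exp(-d |v|^2) for each grid point v.\<close>

lemma nn_integral_exp_form_bound:
  fixes s r :: nat
  assumes d: "0 < d" and r: "0 < r" and w: "\<forall>i<n. 0 \<le> w i \<and> w i \<le> real r" and sw: "(\<Sum>i<n. w i) \<le> real s"
  defines "L \<equiv> 2 * real s + 6 * real r * real d" and "\<theta> \<equiv> 1 / (6 * real r)"
  shows "(\<integral>\<^sup>+\<omega>. ennreal (exp (\<theta> * form_bound d n L w (\<lambda>i. snd (\<omega> i)))) \<partial>world d n k)
    \<le> ennreal (exp (\<theta> * (L * (17/16))) * 4 ^ d)"
proof -
  have \<theta>: "0 < \<theta>" using r by (simp add: \<theta>_def)
  define T where "T z \<omega> = exp (\<theta> * (L * (17/16))) * exp (- \<theta> * L * dot d (grid_point d z) (grid_point d z))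
      * exp (\<theta> * weighted_form d n w (\<lambda>i. snd (\<omega> i)) (grid_point d z))" for z and \<omega> :: "nat \<Rightarrow> nat \<times> (nat \<Rightarrow> real)"
  have pt: "exp (\<theta> * form_bound d n L w (\<lambda>i. snd (\<omega> i))) \<le> (\<Sum>z\<in>grid d. T z \<omega>)" for \<omega>
  proof -
    let ?f = "\<lambda>z. weighted_form d n w (\<lambda>i. snd (\<omega> i)) (grid_point d z) - L * dot d (grid_point d z) (grid_point d z)"
    have "Max (?f ` grid d) \<in> ?f ` grid d" using finite_grid zero_in_grid by (intro Max_in) auto
    then obtain z where z: "z \<in> grid d" "Max (?f ` grid d) = ?f z" by auto
    have "exp (\<theta> * form_bound d n L w (\<lambda>i. snd (\<omega> i))) = T z \<omega>"
      unfolding form_bound_def z(2) T_def exp_add[symmetric] by (simp add: algebra_simps)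
    also have "\<dots> \<le> (\<Sum>z\<in>grid d. T z \<omega>)" using z(1) finite_grid by (intro member_le_sum) (auto simp: T_def)
    finally show ?thesis .
  qed
  have each: "(\<integral>\<^sup>+\<omega>. ennreal (T z \<omega>) \<partial>world d n k)
     \<le> ennreal (exp (\<theta> * (L * (17/16))) * exp (- real d * dot d (grid_point d z) (grid_point d z)))" if z: "z \<in> grid d" for z
  proof -
    let ?v = "grid_point d z"
    have v: "dot d ?v ?v \<le> 9/4" "0 \<le> dot d ?v ?v" using z by (auto simp: grid_def dot_nonneg)
    have "(\<integral>\<^sup>+\<omega>. ennreal (T z \<omega>) \<partial>world d n k)
      = ennreal (exp (\<theta> * (L * (17/16))) * exp (- \<theta> * L * dot d ?v ?v)) * (\<integral>\<^sup>+\<omega>. ennreal (exp (\<theta> * weighted_form d n w (\<lambda>i. snd (\<omega> i)) ?v)) \<partial>world d n k)"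
      unfolding T_def using measurable_weighted_form[of d n w ?v k]
      by (subst nn_integral_cmult[symmetric]) (simp_all add: ennreal_mult')
    also have "\<dots> \<le> ennreal (exp (\<theta> * (L * (17/16))) * exp (- \<theta> * L * dot d ?v ?v)) * ennreal (exp (2 * \<theta> * dot d ?v ?v * (\<Sum>i<n. w i)))"
    proof (intro mult_left_mono nn_integral_exp_weighted_form allI impI conjI)
      fix i assume "i < n"
      then have wi: "0 \<le> w i" "w i \<le> real r" using w by auto
      then show "0 \<le> w i" by simp
      have "2 * \<theta> * w i * dot d ?v ?v \<le> 2 * \<theta> * real r * (9/4)"
        using wi v \<theta> by (intro mult_mono) auto
      then show "2 * \<theta> * w i * dot d ?v ?v \<le> 3/4" using r by (simp add: \<theta>_def)
    qed (use \<theta> in auto)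
    also have "\<dots> \<le> ennreal (exp (\<theta> * (L * (17/16))) * exp (- real d * dot d ?v ?v))"
    proof -
      have "2 * \<theta> * dot d ?v ?v * (\<Sum>i<n. w i) \<le> 2 * \<theta> * dot d ?v ?v * real s"
        using sw v \<theta> by (intro mult_left_mono) auto
      moreover have "- \<theta> * L * dot d ?v ?v + 2 * \<theta> * dot d ?v ?v * real s = - real d * dot d ?v ?v"
        using r by (simp add: \<theta>_def L_def field_simps)
      ultimately have "- \<theta> * L * dot d ?v ?v + 2 * \<theta> * dot d ?v ?v * (\<Sum>i<n. w i) \<le> - real d * dot d ?v ?v" by linarith
      then have "exp (\<theta> * (L * (17/16))) * exp (- \<theta> * L * dot d ?v ?v) * exp (2 * \<theta> * dot d ?v ?v * (\<Sum>i<n. w i))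
         \<le> exp (\<theta> * (L * (17/16))) * exp (- real d * dot d ?v ?v)"
        unfolding mult.assoc[of "exp (\<theta> * (L * (17/16)))"] exp_add[symmetric, of "- \<theta> * L * dot d ?v ?v"]
        by (intro mult_left_mono) auto
      then show ?thesis by (simp add: ennreal_mult'[symmetric] ennreal_leI del: mult_minus_left)
    qed
    finally show ?thesis .
  qed
  have "(\<integral>\<^sup>+\<omega>. ennreal (exp (\<theta> * form_bound d n L w (\<lambda>i. snd (\<omega> i)))) \<partial>world d n k)
     \<le> (\<integral>\<^sup>+\<omega>. (\<Sum>z\<in>grid d. ennreal (T z \<omega>)) \<partial>world d n k)"
    using pt by (intro nn_integral_mono) (simp add: T_def ennreal_leI)
  also have "\<dots> = (\<Sum>z\<in>grid d. \<integral>\<^sup>+\<omega>. ennreal (T z \<omega>) \<partial>world d n k)"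
    unfolding T_def using measurable_weighted_form[of d n w _ k] by (intro nn_integral_sum) simp
  also have "\<dots> \<le> (\<Sum>z\<in>grid d. ennreal (exp (\<theta> * (L * (17/16))) * exp (- real d * dot d (grid_point d z) (grid_point d z))))"
    by (intro sum_mono each)
  also have "\<dots> = ennreal (exp (\<theta> * (L * (17/16))) * (\<Sum>z\<in>grid d. exp (- real d * dot d (grid_point d z) (grid_point d z))))"
    by (simp add: sum_distrib_left)
  also have "\<dots> \<le> ennreal (exp (\<theta> * (L * (17/16))) * 4 ^ d)"
    by (intro ennreal_leI mult_left_mono grid_gauss_sum[OF d]) simp
  finally show ?thesis .
qed

lemma nn_integral_form_bound:
  fixes s r :: nat
  assumes d: "0 < d" and r: "0 < r" and w: "\<forall>i<n. 0 \<le> w i \<and> w i \<le> real r" and sw: "(\<Sum>i<n. w i) \<le> real s"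
  shows "(\<integral>\<^sup>+\<omega>. ennreal (form_bound d n (2 * real s + 6 * real r * real d) w (\<lambda>i. snd (\<omega> i))) \<partial>world d n k)
    \<le> ennreal (17/8 * real s + 6 * real r * real d * (17/16 + 25/18))"
proof -
  interpret prob_space "world d n k" by (rule prob_space_world)
  define L where "L = 2 * real s + 6 * real r * real d"
  define \<theta> where "\<theta> = 1 / (6 * real r)"
  define a where "a = \<theta> * (L * (17/16)) + real d * (25/18)"
  have \<theta>: "0 < \<theta>" using r by (simp add: \<theta>_def)
  have "ln (4::real) = 2 * ln 2" using ln_realpow[of 2 2] by simp
  then have "ln (4::real) \<le> 25/18" using ln2_le_25_over_36 by simp
  then have "exp (ln (4::real)) \<le> exp (25/18)" by (simp only: exp_le_cancel_iff)
  then have "(4::real) \<le> exp (25/18)" by simp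
  then have "(4::real) ^ d \<le> exp (25/18) ^ d" by (intro power_mono) auto
  also have "\<dots> = exp (real d * (25/18))" by (rule exp_of_nat_mult[symmetric])
  finally have "exp (\<theta> * (L * (17/16))) * 4 ^ d \<le> exp a"
    unfolding a_def exp_add by (intro mult_left_mono) auto
  then have mgf: "(\<integral>\<^sup>+\<omega>. ennreal (exp (\<theta> * form_bound d n L w (\<lambda>i. snd (\<omega> i)))) \<partial>world d n k) \<le> ennreal (exp a)"
    using nn_integral_exp_form_bound[OF d r w sw, of k] unfolding L_def \<theta>_def by (meson ennreal_leI order_trans)
  have "0 \<le> \<theta> * (L * (17/16))" using \<theta> by (intro mult_nonneg_nonneg) (auto simp: L_def)
  moreover have "1 \<le> real d" using d by simp
  ultimately have a1: "1 \<le> a" unfolding a_def by linarith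
  \<comment> \<open>17/16 of L = 2 s + 6 r d, plus d / \<theta> = 6 r d times 25/18, the bound for
    ln 4.\<close>
  have "a / \<theta> = 17/8 * real s + 6 * real r * real d * (17/16 + 25/18)"
    using r by (simp add: a_def \<theta>_def L_def field_simps)
  then show ?thesis
    using nn_integral_le_log_mgf[OF measurable_form_bound \<theta> a1 mgf] by (simp add: L_def)
qed

subsection \<open>Multiplicities of the sample\<close>

definition mult_of :: "nat \<Rightarrow> (nat \<Rightarrow> nat) \<Rightarrow> nat \<Rightarrow> nat" where
  "mult_of s \<tau> i = card {j. j < s \<and> \<tau> j = i}"

text \<open>The multiplicity capped at r; \<open>heavy\<close> is the excess. A frequently drawn
  point contributes to both parts.\<close>

definition light :: "nat \<Rightarrow> nat \<Rightarrow> (nat \<Rightarrow> nat) \<Rightarrow> nat \<Rightarrow> real" where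
  "light r s \<tau> i = real (min (mult_of s \<tau> i) r)"

definition heavy :: "nat \<Rightarrow> nat \<Rightarrow> (nat \<Rightarrow> nat) \<Rightarrow> nat \<Rightarrow> real" where
  "heavy r s \<tau> i = real (mult_of s \<tau> i - r)"

lemma light_heavy: "light r s \<tau> i + heavy r s \<tau> i = real (mult_of s \<tau> i)"
  by (simp add: light_def heavy_def min_def of_nat_diff)

lemma light_nonneg: "0 \<le> light r s \<tau> i" and heavy_nonneg: "0 \<le> heavy r s \<tau> i"
  by (simp_all add: light_def heavy_def)

lemma sum_by_mult:
  fixes F :: "nat \<Rightarrow> real"
  assumes "\<forall>j<s. \<tau> j < n"
  shows "(\<Sum>j<s. F (\<tau> j)) = (\<Sum>i<n. real (mult_of s \<tau> i) * F i)"
proof -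
  have "(\<Sum>i<n. real (mult_of s \<tau> i) * F i) = (\<Sum>i<n. \<Sum>j\<in>{j\<in>{..<s}. \<tau> j = i}. F (\<tau> j))"
    by (intro sum.cong refl) (simp add: mult_of_def)
  also have "\<dots> = (\<Sum>j<s. F (\<tau> j))" using assms by (intro sum.group) auto
  finally show ?thesis ..
qed

text \<open>An upper bound for the operator norm of the sum of g g^T over the sample. It stands in
  for the norm because it is an explicit finite maximum plus a sum, so measurability, monotonicity
  and bounded differences can be read off.\<close>

definition op_bound :: "nat \<Rightarrow> nat \<Rightarrow> nat \<Rightarrow> nat \<Rightarrow> (nat \<Rightarrow> nat) \<Rightarrow> (nat \<Rightarrow> nat \<Rightarrow> real) \<Rightarrow> real" where
  "op_bound d n s r \<tau> g = form_bound d n (2 * real s + 6 * real r * real d) (light r s \<tau>) g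
     + (\<Sum>i<n. heavy r s \<tau> i * dot d (g i) (g i))"

lemma op_bound_nonneg: "0 \<le> op_bound d n s r \<tau> g"
  unfolding op_bound_def
  by (intro add_nonneg_nonneg form_bound_nonneg sum_nonneg mult_nonneg_nonneg heavy_nonneg dot_nonneg) simp_all

lemma sum_dot_le_op_bound:
  assumes d: "0 < d" and \<tau>: "\<forall>j<s. \<tau> j < n"
  shows "(\<Sum>j<s. (dot d v (g (\<tau> j)))\<^sup>2) \<le> op_bound d n s r \<tau> g * dot d v v"
proof -
  have "(\<Sum>j<s. (dot d v (g (\<tau> j)))\<^sup>2) = (\<Sum>i<n. (light r s \<tau> i + heavy r s \<tau> i) * (dot d v (g i))\<^sup>2)"
    unfolding light_heavy using sum_by_mult[OF \<tau>, of "\<lambda>i. (dot d v (g i))\<^sup>2"] .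
  also have "\<dots> = weighted_form d n (light r s \<tau>) g v + (\<Sum>i<n. heavy r s \<tau> i * (dot d v (g i))\<^sup>2)"
    by (simp add: weighted_form_def distrib_right sum.distrib)
  also have "\<dots> \<le> form_bound d n (2 * real s + 6 * real r * real d) (light r s \<tau>) g * dot d v v
       + (\<Sum>i<n. heavy r s \<tau> i * (dot d v v * dot d (g i) (g i)))"
    by (intro add_mono weighted_form_le d sum_mono mult_left_mono dot_Cauchy_Schwarz heavy_nonneg) (auto simp: light_nonneg)
  also have "\<dots> = op_bound d n s r \<tau> g * dot d v v"
    unfolding op_bound_def distrib_right sum_distrib_right by (simp add: mult_ac)
  finally show ?thesis .
qed

section \<open>Monotonicity and stability of the operator norm bound\<close>

lemma form_bound_mono:
  assumes "\<And>v. dot d v v \<le> 9/4 \<Longrightarrow> weighted_form d n w g v \<le> weighted_form d n w g' v + e"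
  shows "form_bound d n L w g \<le> form_bound d n L w g' + e"
proof -
  let ?f = "\<lambda>g z. weighted_form d n w g (grid_point d z) - L * dot d (grid_point d z) (grid_point d z)"
  have "Max (?f g ` grid d) \<le> Max (?f g' ` grid d) + e"
  proof (rule Max.boundedI)
    show "finite (?f g ` grid d)" "?f g ` grid d \<noteq> {}" using finite_grid zero_in_grid by blast+
    fix x assume "x \<in> ?f g ` grid d"
    then obtain z where z: "z \<in> grid d" "x = ?f g z" by blast
    have "?f g' z \<le> Max (?f g' ` grid d)" using z finite_grid by (intro Max_ge) auto
    moreover have "weighted_form d n w g (grid_point d z) \<le> weighted_form d n w g' (grid_point d z) + e"
      using z(1) by (intro assms) (simp add: grid_def)
    ultimately show "x \<le> Max (?f g' ` grid d) + e" using z(2) by linarith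
  qed
  then show ?thesis by (simp add: form_bound_def)
qed

text \<open>Zeroing noise vectors lowers every quadratic form involved; truncation does exactly
  this, so it never increases the bound.\<close>

lemma op_bound_mono:
  assumes "\<And>i. i < n \<Longrightarrow> g i = g' i \<or> g i = (\<lambda>c\<in>{..<d}. 0)"
  shows "op_bound d n s r \<tau> g \<le> op_bound d n s r \<tau> g'"
proof -
  have dz: "dot d v (\<lambda>c\<in>{..<d}. 0) = 0" for v by (simp add: dot_def)
  have sq: "(dot d v (g i))\<^sup>2 \<le> (dot d v (g' i))\<^sup>2" "dot d (g i) (g i) \<le> dot d (g' i) (g' i)" if "i < n" for v i
    using assms[OF that] by (auto simp: dz dot_nonneg)
  have "weighted_form d n (light r s \<tau>) g v \<le> weighted_form d n (light r s \<tau>) g' v + 0" for v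
    unfolding weighted_form_def add_0_right using sq(1) by (intro sum_mono mult_left_mono light_nonneg) auto
  then have "form_bound d n L (light r s \<tau>) g \<le> form_bound d n L (light r s \<tau>) g' + 0" for L
    by (rule form_bound_mono)
  moreover have "(\<Sum>i<n. heavy r s \<tau> i * dot d (g i) (g i)) \<le> (\<Sum>i<n. heavy r s \<tau> i * dot d (g' i) (g' i))"
    using sq by (intro sum_mono mult_left_mono heavy_nonneg) auto
  ultimately show ?thesis unfolding op_bound_def by (intro add_mono) auto
qed

lemma sum_replace_le:
  fixes a a' w :: "nat \<Rightarrow> real"
  assumes "i0 < n" "\<And>i. i < n \<Longrightarrow> i \<noteq> i0 \<Longrightarrow> a i = a' i" "a i0 \<le> b" "0 \<le> a' i0" "0 \<le> w i0"
  shows "(\<Sum>i<n. w i * a i) \<le> (\<Sum>i<n. w i * a' i) + w i0 * b"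
proof -
  have "(\<Sum>i<n. w i * a i) = w i0 * a i0 + (\<Sum>i\<in>{..<n} - {i0}. w i * a i)" using assms(1) by (simp add: sum.remove)
  also have "(\<Sum>i\<in>{..<n} - {i0}. w i * a i) = (\<Sum>i\<in>{..<n} - {i0}. w i * a' i)" using assms(2) by (intro sum.cong) auto
  also have "w i0 * a i0 \<le> w i0 * b" using assms by (intro mult_left_mono)
  also have "(\<Sum>i\<in>{..<n} - {i0}. w i * a' i) = (\<Sum>i<n. w i * a' i) - w i0 * a' i0" using assms(1) by (simp add: sum.remove)
  also have "w i0 * b + ((\<Sum>i<n. w i * a' i) - w i0 * a' i0) \<le> (\<Sum>i<n. w i * a' i) + w i0 * b" using assms by simp
  finally show ?thesis by simp
qed

text \<open>Only the terms of the changed vector differ. On the grid |v|^2 \<le> 9/4, so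
  Cauchy-Schwarz limits each of its copies to 9/4 R; the trace part is covered by the same
  amount.\<close>

lemma op_bound_replace:
  assumes i0: "i0 < n" and eq: "\<And>i. i < n \<Longrightarrow> i \<noteq> i0 \<Longrightarrow> g i = g' i" and R: "dot d (g i0) (g i0) \<le> R" "0 \<le> R"
  shows "op_bound d n s r \<tau> g \<le> op_bound d n s r \<tau> g' + real (mult_of s \<tau> i0) * (9/4 * R)"
proof -
  have fb: "form_bound d n L (light r s \<tau>) g \<le> form_bound d n L (light r s \<tau>) g' + light r s \<tau> i0 * (9/4 * R)" for L
  proof (rule form_bound_mono)
    fix v assume v: "dot d v v \<le> 9/4"
    have "(dot d v (g i0))\<^sup>2 \<le> dot d v v * dot d (g i0) (g i0)" by (rule dot_Cauchy_Schwarz)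
    also have "\<dots> \<le> 9/4 * R" using v R by (intro mult_mono dot_nonneg) auto
    finally show "weighted_form d n (light r s \<tau>) g v \<le> weighted_form d n (light r s \<tau>) g' v + light r s \<tau> i0 * (9/4 * R)"
      unfolding weighted_form_def using eq by (intro sum_replace_le i0 light_nonneg) auto
  qed
  have hv: "(\<Sum>i<n. heavy r s \<tau> i * dot d (g i) (g i)) \<le> (\<Sum>i<n. heavy r s \<tau> i * dot d (g' i) (g' i)) + heavy r s \<tau> i0 * (9/4 * R)"
    using eq R by (intro sum_replace_le i0 heavy_nonneg) (auto simp: dot_nonneg)
  have "op_bound d n s r \<tau> g \<le> op_bound d n s r \<tau> g' + (light r s \<tau> i0 + heavy r s \<tau> i0) * (9/4 * R)"
    unfolding op_bound_def distrib_right using fb[of "2 * real s + 6 * real r * real d"] hv by linarith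
  then show ?thesis by (simp add: light_heavy)
qed

section \<open>Expected multiplicities\<close>

lemma exp3_le: "0 \<le> x \<Longrightarrow> x \<le> 1 \<Longrightarrow> exp (3 * x) - 1 \<le> x * (exp 3 - 1 :: real)"
proof -
  assume x: "0 \<le> x" "x \<le> 1"
  have "exp (3 * ((1 - x) *\<^sub>R 0 + x *\<^sub>R 1)) \<le> (1 - x) * exp (3 * 0) + x * exp (3 * 1 :: real)"
    by (rule convex_onD[OF convex_on_exp]) (use x in auto)
  then show ?thesis by (simp add: algebra_simps)
qed

text \<open>By Bernoulli the excess over r is at most 4^(-r) (4^m - 1), and the mean of 4^m factors
  over the draws into (1 + 3/n)^s. Subtracting 1 matters: it yields a factor s/n, so the sum over
  all n points is of order s rather than n.\<close>

lemma expectation_heavy: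
  assumes n: "0 < n" and s: "s \<le> n" and i: "i < n"
  shows "measure_pmf.expectation (draw n s) (\<lambda>\<tau>. heavy r s \<tau> i) \<le> (1/4) ^ r * (real s / real n * (exp 3 - 1))"
proof -
  have hv: "heavy r s \<tau> i \<le> (1/4) ^ r * (4 ^ mult_of s \<tau> i - 1)" for \<tau>
  proof (cases "mult_of s \<tau> i \<le> r")
    case True
    then show ?thesis by (simp add: heavy_def)
  next
    case False
    define q where "q = mult_of s \<tau> i - r"
    have m: "mult_of s \<tau> i = r + q" "1 \<le> q" using False by (auto simp: q_def)
    have "1 + real q * 3 \<le> (1 + 3) ^ q" by (rule Bernoulli_inequality) simp
    then have "real q + 1 \<le> 4 ^ q" using m(2) by simp
    moreover have "(1/4 :: real) ^ r \<le> 1" by (simp add: power_le_one)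
    moreover have "(1/4 :: real) ^ r * (4 ^ (r + q) - 1) = 4 ^ q - (1/4) ^ r"
      by (simp add: power_add right_diff_distrib power_one_over)
    ultimately show ?thesis unfolding heavy_def m(1) by simp
  qed
  have p4: "4 ^ mult_of s \<tau> i = (\<Prod>j<s. if \<tau> j = i then 4 else (1::real))" for \<tau>
  proof -
    have "(\<Prod>j<s. if \<tau> j = i then 4 else (1::real)) = (\<Prod>j\<in>{j\<in>{..<s}. \<tau> j = i}. 4)"
      by (rule prod.inter_filter[symmetric]) simp
    then show ?thesis by (simp add: mult_of_def)
  qed
  have "measure_pmf.expectation (draw n s) (\<lambda>\<tau>. 4 ^ mult_of s \<tau> i :: real)
      = (\<Prod>j<s. measure_pmf.expectation (pmf_of_set {..<n}) (\<lambda>v. if v = i then 4 else (1::real)))"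
    unfolding p4 draw_def
    by (rule expectation_prod_Pi_pmf) (use n in \<open>auto intro!: integrable_measure_pmf_finite simp: lessThan_empty_iff\<close>)
  also have "measure_pmf.expectation (pmf_of_set {..<n}) (\<lambda>v. if v = i then 4 else (1::real)) = 1 + 3 / real n"
  proof -
    have "(\<Sum>v<n. if v = i then 4 else (1::real)) = (\<Sum>v<n. 1 + (if v = i then 3 else 0))" by (intro sum.cong) auto
    also have "\<dots> = real n + 3" using i by (simp add: sum.distrib)
    finally show ?thesis using n by (subst integral_pmf_of_set) (auto simp: lessThan_empty_iff field_simps)
  qed
  finally have E4: "measure_pmf.expectation (draw n s) (\<lambda>\<tau>. 4 ^ mult_of s \<tau> i :: real) = (1 + 3 / real n) ^ s" by simp
  have "(1 + 3 / real n) ^ s \<le> exp (3 / real n) ^ s" by (intro power_mono exp_ge_add_one_self) simp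
  also have "\<dots> = exp (3 * (real s / real n))" by (simp add: exp_of_nat_mult[symmetric] mult.commute)
  finally have "(1 + 3 / real n) ^ s - 1 \<le> real s / real n * (exp 3 - 1)"
    using exp3_le[of "real s / real n"] s n by (simp add: divide_le_eq_1)
  then have "(1/4) ^ r * ((1 + 3 / real n) ^ s - 1) \<le> (1/4) ^ r * (real s / real n * (exp 3 - 1))"
    by (intro mult_left_mono) auto
  moreover have "measure_pmf.expectation (draw n s) (\<lambda>\<tau>. heavy r s \<tau> i)
     \<le> measure_pmf.expectation (draw n s) (\<lambda>\<tau>. (1/4) ^ r * (4 ^ mult_of s \<tau> i - 1))"
    by (intro expectation_draw_mono n hv)
  moreover have "measure_pmf.expectation (draw n s) (\<lambda>\<tau>. (1/4) ^ r * (4 ^ mult_of s \<tau> i - 1 :: real)) = (1/4) ^ r * ((1 + 3 / real n) ^ s - 1)"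
    by (simp add: E4 Bochner_Integration.integral_diff integrable_draw[OF n])
  ultimately show ?thesis by linarith
qed

lemma expectation_mult_of:
  assumes "0 < n" "i < n"
  shows "measure_pmf.expectation (draw n s) (\<lambda>\<tau>. real (mult_of s \<tau> i)) = real s / real n"
proof -
  have "real (mult_of s \<tau> i) = (\<Sum>j<s. if \<tau> j = i then 1 else 0)" for \<tau>
  proof -
    have "{j. j < s \<and> \<tau> j = i} = {j\<in>{..<s}. \<tau> j = i}" by auto
    then show ?thesis unfolding mult_of_def by (simp add: sum.If_cases Int_def)
  qed
  then show ?thesis using expectation_draw_sum[OF assms(1), of s "\<lambda>v. if v = i then 1 else 0"] assms by simp
qed

definition mean_op_bound :: "nat \<Rightarrow> nat \<Rightarrow> nat \<Rightarrow> nat \<Rightarrow> (nat \<Rightarrow> nat \<Rightarrow> real) \<Rightarrow> real" where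
  "mean_op_bound d n s r g = measure_pmf.expectation (draw n s) (\<lambda>\<tau>. op_bound d n s r \<tau> g)"

lemma expectation_draw_eq_sum:
  fixes f :: "(nat \<Rightarrow> nat) \<Rightarrow> real"
  assumes "0 < n"
  shows "measure_pmf.expectation (draw n s) f = (\<Sum>\<tau>\<in>set_pmf (draw n s). pmf (draw n s) \<tau> * f \<tau>)"
  by (subst integral_measure_pmf_real[OF finite_set_pmf_draw[OF assms]]) (auto simp: mult.commute)

lemma measurable_op_bound: "(\<lambda>\<omega>. op_bound d n s r \<tau> (\<lambda>i. snd (\<omega> i))) \<in> borel_measurable (world d n k)"
  unfolding op_bound_def
proof (intro borel_measurable_add measurable_form_bound borel_measurable_sum)
  fix i assume "i \<in> {..<n}"
  then have [measurable]: "(\<lambda>\<omega>. snd (\<omega> i)) \<in> world d n k \<rightarrow>\<^sub>M noise d" by simp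
  show "(\<lambda>\<omega>. heavy r s \<tau> i * dot d (snd (\<omega> i)) (snd (\<omega> i))) \<in> borel_measurable (world d n k)" by measurable
qed

lemma nn_integral_op_bound:
  assumes d: "0 < d" and r: "0 < r" and \<tau>: "\<forall>j<s. \<tau> j < n"
  shows "(\<integral>\<^sup>+\<omega>. ennreal (op_bound d n s r \<tau> (\<lambda>i. snd (\<omega> i))) \<partial>world d n k)
    \<le> ennreal (17/8 * real s + 6 * real r * real d * (17/16 + 25/18) + real d * (\<Sum>i<n. heavy r s \<tau> i))"
proof -
  let ?L = "2 * real s + 6 * real r * real d" and ?c = "17/8 * real s + 6 * real r * real d * (17/16 + 25/18)"
  have m: "(\<lambda>\<omega>. dot d (snd (\<omega> i)) (snd (\<omega> i))) \<in> borel_measurable (world d n k)" if "i < n" for i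
  proof -
    have [measurable]: "(\<lambda>\<omega>. snd (\<omega> i)) \<in> world d n k \<rightarrow>\<^sub>M noise d" using that by simp
    show ?thesis by measurable
  qed
  have "(\<integral>\<^sup>+\<omega>. ennreal (op_bound d n s r \<tau> (\<lambda>i. snd (\<omega> i))) \<partial>world d n k)
     = (\<integral>\<^sup>+\<omega>. ennreal (form_bound d n ?L (light r s \<tau>) (\<lambda>i. snd (\<omega> i)))
         + (\<Sum>i<n. ennreal (heavy r s \<tau> i) * ennreal (dot d (snd (\<omega> i)) (snd (\<omega> i)))) \<partial>world d n k)"
    unfolding op_bound_def
    by (intro nn_integral_cong, subst ennreal_plus)
       (auto intro!: form_bound_nonneg sum_nonneg mult_nonneg_nonneg heavy_nonneg dot_nonneg
         simp: ennreal_mult[symmetric] heavy_nonneg dot_nonneg)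
  also have "\<dots> = (\<integral>\<^sup>+\<omega>. ennreal (form_bound d n ?L (light r s \<tau>) (\<lambda>i. snd (\<omega> i))) \<partial>world d n k)
     + (\<Sum>i<n. ennreal (heavy r s \<tau> i) * (\<integral>\<^sup>+\<omega>. ennreal (dot d (snd (\<omega> i)) (snd (\<omega> i))) \<partial>world d n k))"
  proof -
    have hm: "(\<lambda>\<omega>. ennreal (heavy r s \<tau> i) * ennreal (dot d (snd (\<omega> i)) (snd (\<omega> i)))) \<in> borel_measurable (world d n k)" if "i \<in> {..<n}" for i
      using m[of i] that by simp
    have "(\<integral>\<^sup>+\<omega>. (\<Sum>i<n. ennreal (heavy r s \<tau> i) * ennreal (dot d (snd (\<omega> i)) (snd (\<omega> i)))) \<partial>world d n k)
       = (\<Sum>i<n. \<integral>\<^sup>+\<omega>. ennreal (heavy r s \<tau> i) * ennreal (dot d (snd (\<omega> i)) (snd (\<omega> i))) \<partial>world d n k)"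
      by (rule nn_integral_sum) (rule hm)
    also have "\<dots> = (\<Sum>i<n. ennreal (heavy r s \<tau> i) * (\<integral>\<^sup>+\<omega>. ennreal (dot d (snd (\<omega> i)) (snd (\<omega> i))) \<partial>world d n k))"
      using m by (intro sum.cong refl nn_integral_cmult) simp
    finally show ?thesis
      using measurable_form_bound[of d n ?L "light r s \<tau>" k] hm by (subst nn_integral_add) (simp_all add: borel_measurable_sum)
  qed
  also have "\<dots> \<le> ennreal ?c + (\<Sum>i<n. ennreal (heavy r s \<tau> i) * ennreal (real d))"
  proof (intro add_mono sum_mono)
    have "(\<Sum>i<n. light r s \<tau> i) \<le> (\<Sum>i<n. real (mult_of s \<tau> i) * 1)"
      by (intro sum_mono) (simp add: light_def)
    also have "\<dots> = real s" using sum_by_mult[OF \<tau>, of "\<lambda>_. 1"] by simp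
    finally show "(\<integral>\<^sup>+\<omega>. ennreal (form_bound d n ?L (light r s \<tau>) (\<lambda>i. snd (\<omega> i))) \<partial>world d n k) \<le> ennreal ?c"
      by (intro nn_integral_form_bound d r) (auto simp: light_def)
    fix i assume "i \<in> {..<n}"
    then show "ennreal (heavy r s \<tau> i) * (\<integral>\<^sup>+\<omega>. ennreal (dot d (snd (\<omega> i)) (snd (\<omega> i))) \<partial>world d n k) \<le> ennreal (heavy r s \<tau> i) * ennreal (real d)"
      using nn_integral_world_component[of i n "\<lambda>g. ennreal (dot d g g)" d k] by (simp add: nn_integral_noise_norm)
  qed
  also have "\<dots> = ennreal (?c + real d * (\<Sum>i<n. heavy r s \<tau> i))"
    by (simp add: ennreal_mult[symmetric] heavy_nonneg sum_nonneg sum_distrib_left mult.commute flip: ennreal_plus)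
  finally show ?thesis .
qed

section \<open>Truncated noise and concentration of the mean bound\<close>

text \<open>Bounded differences must hold at every point of the sample space, hence a deterministic
  cut. The zero vector is restricted to the first d coordinates so that it lies in the product
  space.\<close>

definition trunc_site :: "nat \<Rightarrow> real \<Rightarrow> nat \<times> (nat \<Rightarrow> real) \<Rightarrow> nat \<times> (nat \<Rightarrow> real)" where
  "trunc_site d R w = (fst w, if dot d (snd w) (snd w) < R then snd w else (\<lambda>c\<in>{..<d}. 0))"

definition trunc_world :: "nat \<Rightarrow> nat \<Rightarrow> real \<Rightarrow> (nat \<Rightarrow> nat \<times> (nat \<Rightarrow> real)) \<Rightarrow> nat \<Rightarrow> nat \<times> (nat \<Rightarrow> real)" where
  "trunc_world d n R \<omega> = (\<lambda>i\<in>{..<n}. trunc_site d R (\<omega> i))"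

lemma dot_trunc_le: "0 \<le> R \<Longrightarrow> dot d (snd (trunc_site d R w)) (snd (trunc_site d R w)) \<le> R"
  by (simp add: trunc_site_def) (simp add: dot_def)

lemma measurable_trunc_site: "trunc_site d R \<in> site d k \<rightarrow>\<^sub>M site d k"
proof -
  have [measurable]: "(\<lambda>c\<in>{..<d}. 0) \<in> space (noise d)" by (simp add: noise_def space_PiM)
  have [measurable]: "fst \<in> site d k \<rightarrow>\<^sub>M measure_pmf (pmf_of_set {..<k})" unfolding site_def by measurable
  have "(\<lambda>w. (fst w, if dot d (snd w) (snd w) < R then snd w else (\<lambda>c\<in>{..<d}. 0)))
     \<in> site d k \<rightarrow>\<^sub>M measure_pmf (pmf_of_set {..<k}) \<Otimes>\<^sub>M noise d" by measurable
  then show ?thesis unfolding trunc_site_def[abs_def] by (simp add: site_def)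
qed

lemma measurable_trunc_world: "trunc_world d n R \<in> world d n k \<rightarrow>\<^sub>M world d n k"
  unfolding trunc_world_def[abs_def] world_def
proof (rule measurable_restrict)
  fix i assume "i \<in> {..<n}"
  then have "(\<lambda>\<omega>. \<omega> i) \<in> Pi\<^sub>M {..<n} (\<lambda>_. site d k) \<rightarrow>\<^sub>M site d k" by (rule measurable_component_singleton)
  then show "(\<lambda>\<omega>. trunc_site d R (\<omega> i)) \<in> Pi\<^sub>M {..<n} (\<lambda>_. site d k) \<rightarrow>\<^sub>M site d k"
    by (rule measurable_compose[OF _ measurable_trunc_site])
qed

definition sampled_norm :: "nat \<Rightarrow> nat \<Rightarrow> nat \<Rightarrow> nat \<Rightarrow> real \<Rightarrow> (nat \<Rightarrow> nat \<times> (nat \<Rightarrow> real)) \<Rightarrow> real" where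
  "sampled_norm d n s r R \<omega> = mean_op_bound d n s r (\<lambda>i. snd (trunc_world d n R \<omega> i))"

lemma measurable_sampled_norm:
  assumes "0 < n"
  shows "sampled_norm d n s r R \<in> borel_measurable (world d n k)"
proof -
  have "(\<lambda>\<omega>. mean_op_bound d n s r (\<lambda>i. snd (\<omega> i))) \<in> borel_measurable (world d n k)"
    unfolding mean_op_bound_def expectation_draw_eq_sum[OF assms]
    by (intro borel_measurable_sum borel_measurable_times borel_measurable_const measurable_op_bound)
  then show ?thesis
    unfolding sampled_norm_def[abs_def] by (rule measurable_compose[OF measurable_trunc_world])
qed

text \<open>For a single draw the change is proportional to the multiplicity, which can be s.
  Averaging over the draws replaces it by its mean s/n; this is why concentration is applied to the
  averaged bound.\<close>

lemma sampled_norm_bounded_diff: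
  assumes n: "0 < n" and i: "i < n" and R: "0 \<le> R"
  shows "\<bar>sampled_norm d n s r R x - sampled_norm d n s r R (x(i := y))\<bar> \<le> real s / real n * (9/4 * R)"
proof -
  define g g' where "g = (\<lambda>j. snd (trunc_world d n R x j))" and "g' = (\<lambda>j. snd (trunc_world d n R (x(i := y)) j))"
  have eq: "g j = g' j" if "j < n" "j \<noteq> i" for j using that by (simp add: g_def g'_def trunc_world_def)
  have gR: "dot d (g i) (g i) \<le> R" "dot d (g' i) (g' i) \<le> R"
    unfolding g_def g'_def trunc_world_def using i dot_trunc_le[OF R] by simp_all
  have E: "measure_pmf.expectation (draw n s) (\<lambda>\<tau>. op_bound d n s r \<tau> h + real (mult_of s \<tau> i) * (9/4 * R))
     = mean_op_bound d n s r h + real s / real n * (9/4 * R)" for h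
    unfolding mean_op_bound_def
    by (simp add: Bochner_Integration.integral_add[OF integrable_draw[OF n] integrable_draw[OF n]] expectation_mult_of[OF n i])
  have "mean_op_bound d n s r g \<le> mean_op_bound d n s r g' + real s / real n * (9/4 * R)"
    unfolding E[symmetric] unfolding mean_op_bound_def
    by (intro expectation_draw_mono n op_bound_replace i eq gR R)
  moreover have "mean_op_bound d n s r g' \<le> mean_op_bound d n s r g + real s / real n * (9/4 * R)"
    unfolding E[symmetric] unfolding mean_op_bound_def
    by (intro expectation_draw_mono n op_bound_replace i eq[symmetric] gR R)
  ultimately show ?thesis unfolding sampled_norm_def g_def g'_def by linarith
qed

lemma nn_integral_sampled_norm:
  assumes d: "0 < d" and r: "0 < r" and n: "0 < n" and s: "s \<le> n"
  shows "(\<integral>\<^sup>+\<omega>. ennreal (sampled_norm d n s r R \<omega>) \<partial>world d n k)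
    \<le> ennreal (17/8 * real s + 6 * real r * real d * (17/16 + 25/18) + real d * (real s * ((1/4) ^ r * (exp 3 - 1))))"
proof -
  let ?c = "17/8 * real s + 6 * real r * real d * (17/16 + 25/18)"
  let ?S = "set_pmf (draw n s)" and ?p = "pmf (draw n s)"
  have cnn: "0 \<le> ?c" by simp
  have "(\<integral>\<^sup>+\<omega>. ennreal (sampled_norm d n s r R \<omega>) \<partial>world d n k)
     \<le> (\<integral>\<^sup>+\<omega>. (\<Sum>\<tau>\<in>?S. ennreal (?p \<tau>) * ennreal (op_bound d n s r \<tau> (\<lambda>i. snd (\<omega> i)))) \<partial>world d n k)"
  proof (rule nn_integral_mono)
    fix \<omega>
    have "sampled_norm d n s r R \<omega> \<le> mean_op_bound d n s r (\<lambda>i. snd (\<omega> i))"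
      unfolding sampled_norm_def mean_op_bound_def
      by (intro expectation_draw_mono n op_bound_mono) (auto simp: trunc_world_def trunc_site_def)
    then have "ennreal (sampled_norm d n s r R \<omega>) \<le> ennreal (\<Sum>\<tau>\<in>?S. ?p \<tau> * op_bound d n s r \<tau> (\<lambda>i. snd (\<omega> i)))"
      unfolding mean_op_bound_def expectation_draw_eq_sum[OF n] by (rule ennreal_leI)
    also have "\<dots> = (\<Sum>\<tau>\<in>?S. ennreal (?p \<tau> * op_bound d n s r \<tau> (\<lambda>i. snd (\<omega> i))))"
      by (rule sum_ennreal[symmetric]) (simp add: op_bound_nonneg)
    also have "\<dots> = (\<Sum>\<tau>\<in>?S. ennreal (?p \<tau>) * ennreal (op_bound d n s r \<tau> (\<lambda>i. snd (\<omega> i))))"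
      by (simp add: ennreal_mult op_bound_nonneg)
    finally show "ennreal (sampled_norm d n s r R \<omega>) \<le> (\<Sum>\<tau>\<in>?S. ennreal (?p \<tau>) * ennreal (op_bound d n s r \<tau> (\<lambda>i. snd (\<omega> i))))" .
  qed
  also have "\<dots> = (\<Sum>\<tau>\<in>?S. ennreal (?p \<tau>) * (\<integral>\<^sup>+\<omega>. ennreal (op_bound d n s r \<tau> (\<lambda>i. snd (\<omega> i))) \<partial>world d n k))"
    using measurable_op_bound[of d n s r _ k] by (subst nn_integral_sum) (simp_all add: nn_integral_cmult)
  also have "\<dots> \<le> (\<Sum>\<tau>\<in>?S. ennreal (?p \<tau>) * ennreal (?c + real d * (\<Sum>i<n. heavy r s \<tau> i)))"
    using draw_less[OF _ n] by (intro sum_mono mult_left_mono nn_integral_op_bound d r) auto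
  also have "\<dots> = (\<Sum>\<tau>\<in>?S. ennreal (?p \<tau> * (?c + real d * (\<Sum>i<n. heavy r s \<tau> i))))"
    using cnn by (intro sum.cong refl ennreal_mult[symmetric] add_nonneg_nonneg mult_nonneg_nonneg sum_nonneg heavy_nonneg) auto
  also have "\<dots> = ennreal (\<Sum>\<tau>\<in>?S. ?p \<tau> * (?c + real d * (\<Sum>i<n. heavy r s \<tau> i)))"
    using cnn by (intro sum_ennreal add_nonneg_nonneg mult_nonneg_nonneg sum_nonneg heavy_nonneg) auto
  also have "(\<Sum>\<tau>\<in>?S. ?p \<tau> * (?c + real d * (\<Sum>i<n. heavy r s \<tau> i)))
     = measure_pmf.expectation (draw n s) (\<lambda>\<tau>. ?c + real d * (\<Sum>i<n. heavy r s \<tau> i))"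
    by (rule expectation_draw_eq_sum[OF n, symmetric])
  also have "\<dots> = ?c + real d * (\<Sum>i<n. measure_pmf.expectation (draw n s) (\<lambda>\<tau>. heavy r s \<tau> i))"
    by (simp add: Bochner_Integration.integral_add[OF integrable_draw[OF n] integrable_draw[OF n]]
        Bochner_Integration.integral_sum integrable_draw[OF n])
  also have "ennreal \<dots> \<le> ennreal (?c + real d * (real s * ((1/4) ^ r * (exp 3 - 1))))"
  proof (intro ennreal_leI add_left_mono mult_left_mono)
    have "(\<Sum>i<n. measure_pmf.expectation (draw n s) (\<lambda>\<tau>. heavy r s \<tau> i)) \<le> (\<Sum>i<n. (1/4) ^ r * (real s / real n * (exp 3 - 1)))"
      by (intro sum_mono expectation_heavy n s) auto
    also have "\<dots> = real s * ((1/4) ^ r * (exp 3 - 1))" using n by simp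
    finally show "(\<Sum>i<n. measure_pmf.expectation (draw n s) (\<lambda>\<tau>. heavy r s \<tau> i)) \<le> real s * ((1/4) ^ r * (exp 3 - 1))" .
  qed simp
  finally show ?thesis .
qed

text \<open>From r \<le> 2 ln d and s \<ge> 15 d ln d follows 6 r d \<le> 4/5 s. Conversely d \<le>
  exp((r + 1)/2) gives d 4^(-r) \<le> 1.65 (1.65/4)^r, and r \<ge> 5 because d \<ge> 14 exceeds
  exp(5/2), so the excess term is at most 2/5 s. In total 17/8 + 4/5 (17/16 + 25/18) + 2/5 is just
  below 9/2.\<close>

lemma sampled_norm_constants:
  assumes d: "14 \<le> d" and s: "real s \<ge> 15 * real d * ln (real d)"
  defines "r \<equiv> nat \<lfloor>2 * ln (real d)\<rfloor>"
  shows "0 < r" "17/8 * real s + 6 * real r * real d * (17/16 + 25/18) + real d * (real s * ((1/4) ^ r * (exp 3 - 1))) \<le> 9/2 * real s"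
proof -
  have e1: "exp 1 \<le> (272/100 :: real)" using e_less_272 by simp
  have eh: "exp (1/2) \<le> (165/100 :: real)"
  proof (rule power2_le_imp_le)
    have "(exp (1/2 :: real))\<^sup>2 = exp 1" by (simp add: exp_double[symmetric])
    then show "(exp (1/2 :: real))\<^sup>2 \<le> (165/100)\<^sup>2" using e1 by (simp add: power2_eq_square)
  qed simp
  have e3: "exp 3 \<le> (272/100 :: real) ^ 3"
  proof -
    have "exp (3::real) = exp 1 ^ 3" by (simp add: exp_of_nat_mult[symmetric])
    then show ?thesis using power_mono[OF e1, of 3] by simp
  qed
  have "exp (5 * (1/2)) = exp (1/2 :: real) ^ 5" using exp_of_nat_mult[of 5 "1/2 :: real"] by simp
  also have "\<dots> \<le> (165/100) ^ 5" by (intro power_mono eh) simp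
  also have "\<dots> \<le> 14" by (simp add: power_divide)
  finally have "exp (5/2) \<le> real d" using d by simp
  then have ln5: "5/2 \<le> ln (real d)" using d by (subst ln_ge_iff) auto
  have rr: "real r \<le> 2 * ln (real d)" "2 * ln (real d) < real r + 1" unfolding r_def using ln5 by linarith+
  have "5 \<le> 2 * ln (real d)" using ln5 by simp
  then have r5: "5 \<le> r" unfolding r_def by linarith
  then show "0 < r" by simp
  have snn: "0 \<le> real s" by simp
  have "6 * real r * real d \<le> 12 * ln (real d) * real d" using rr(1) by (intro mult_right_mono) auto
  also have "\<dots> \<le> 4/5 * real s" using s by (simp add: mult_ac)
  finally have A: "6 * real r * real d * (17/16 + 25/18) \<le> 4/5 * real s * (17/16 + 25/18)" by (rule mult_right_mono) simp
  have "real d = exp (ln (real d))" using d by simp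
  also have "\<dots> \<le> exp (1/2 + real r * (1/2))" using rr(2) by simp
  also have "\<dots> = exp (1/2) * exp (1/2) ^ r" by (simp add: exp_add exp_of_nat_mult[symmetric])
  also have "\<dots> \<le> (165/100) * (165/100) ^ r" by (intro mult_mono power_mono eh) auto
  finally have "real d * (1/4) ^ r \<le> (165/100) * (165/100) ^ r * (1/4) ^ r" by (rule mult_right_mono) simp
  also have "\<dots> = (165/100) * (165/400) ^ r" by (simp add: power_mult_distrib[symmetric])
  also have "\<dots> \<le> (165/100) * (165/400) ^ 5" using r5 by (intro mult_left_mono power_decreasing) auto
  finally have dr: "real d * (1/4) ^ r \<le> (165/100) * (165/400) ^ 5" .
  have "real d * (1/4) ^ r * (exp 3 - 1) \<le> (165/100) * (165/400) ^ 5 * ((272/100) ^ 3 - 1)"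
    using e3 by (intro mult_mono dr) auto
  also have "\<dots> \<le> 2/5" by (simp add: power_divide)
  finally have "real d * (1/4) ^ r * (exp 3 - 1) * real s \<le> 2/5 * real s" by (intro mult_right_mono) auto
  then have B: "real d * (real s * ((1/4) ^ r * (exp 3 - 1))) \<le> 2/5 * real s" by (simp only: mult_ac)
  show "17/8 * real s + 6 * real r * real d * (17/16 + 25/18) + real d * (real s * ((1/4) ^ r * (exp 3 - 1))) \<le> 9/2 * real s"
  proof -
    have "x \<le> 4/5 * t * (17/16 + 25/18) \<Longrightarrow> y \<le> 2/5 * t \<Longrightarrow> 0 \<le> t \<Longrightarrow> 17/8 * t + x + y \<le> 9/2 * t" for x y t :: real
      by (simp add: field_simps)
    from this[OF A B snn] show ?thesis .
  qed
qed

text \<open>The threshold 19/4 s exceeds the mean bound 9/2 s by s/4. Markov gives (9/2) / (19/4) =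
  18/19. McDiarmid with t = s/4 and differences 9 s R / (4 n) gives the exponent n / (162
  R^2).\<close>

lemma sampled_norm_tail:
  fixes k :: nat
  assumes d: "14 \<le> d" and s: "real s \<ge> 15 * real d * ln (real d)" "0 < s" "s \<le> n" and R: "0 < R"
  defines "r \<equiv> nat \<lfloor>2 * ln (real d)\<rfloor>"
  defines "p \<equiv> measure (world d n k) {\<omega>\<in>space (world d n k). 19/4 * real s \<le> sampled_norm d n s r R \<omega>}"
  shows "p \<le> 18/19" "p \<le> exp (- real n / (162 * R\<^sup>2))"
proof -
  interpret prob_space "world d n k" by (rule prob_space_world)
  have n: "0 < n" using s by simp
  have d0: "0 < d" using d by simp
  note r0 = sampled_norm_constants(1)[OF d s(1), folded r_def]
  note meas = measurable_sampled_norm[OF n, where d = d and s = s and r = r and R = R and k = k]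
  have nn: "(\<integral>\<^sup>+\<omega>. ennreal (sampled_norm d n s r R \<omega>) \<partial>world d n k) \<le> ennreal (9/2 * real s)"
    using nn_integral_sampled_norm[OF d0 r0 n s(3), where R = R and k = k] sampled_norm_constants(2)[OF d s(1), folded r_def]
    by (meson ennreal_leI order_trans)
  then have E: "(\<integral>\<omega>. sampled_norm d n s r R \<omega> \<partial>world d n k) \<le> 9/2 * real s"
    by (intro integral_real_bounded) auto
  have "emeasure (world d n k) {\<omega>\<in>space (world d n k). 1 \<le> ennreal (4 / (19 * real s)) * ennreal (sampled_norm d n s r R \<omega>)}
     \<le> ennreal (4 / (19 * real s)) * (\<integral>\<^sup>+\<omega>. ennreal (sampled_norm d n s r R \<omega>) * indicator (space (world d n k)) \<omega> \<partial>world d n k)"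
    using meas by (intro nn_integral_Markov_inequality) auto
  also have "(\<integral>\<^sup>+\<omega>. ennreal (sampled_norm d n s r R \<omega>) * indicator (space (world d n k)) \<omega> \<partial>world d n k)
     = (\<integral>\<^sup>+\<omega>. ennreal (sampled_norm d n s r R \<omega>) \<partial>world d n k)" by (intro nn_integral_cong) auto
  also have "ennreal (4 / (19 * real s)) * \<dots> \<le> ennreal (4 / (19 * real s)) * ennreal (9/2 * real s)"
    using nn by (rule mult_left_mono) simp
  also have "\<dots> = ennreal (18/19)" using s by (simp add: ennreal_mult'[symmetric])
  also have "{\<omega>\<in>space (world d n k). 1 \<le> ennreal (4 / (19 * real s)) * ennreal (sampled_norm d n s r R \<omega>)}
     = {\<omega>\<in>space (world d n k). 19/4 * real s \<le> sampled_norm d n s r R \<omega>}"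
  proof -
    have "1 \<le> ennreal (4 / (19 * real s)) * ennreal x \<longleftrightarrow> 19/4 * real s \<le> x" for x
    proof -
      have "ennreal (4 / (19 * real s)) * ennreal x = ennreal (4 / (19 * real s) * x)" using s by (simp add: ennreal_mult'[symmetric])
      moreover have "1 \<le> ennreal (4 / (19 * real s) * x) \<longleftrightarrow> 1 \<le> 4 / (19 * real s) * x"
        using ennreal_le_iff2[of 1 "4 / (19 * real s) * x"] by simp
      ultimately show ?thesis using s by (simp add: field_simps)
    qed
    then show ?thesis by simp
  qed
  finally show "p \<le> 18/19" unfolding p_def by (simp add: emeasure_eq_measure)
  have "p \<le> measure (world d n k) {\<omega>\<in>space (world d n k). (\<integral>\<omega>. sampled_norm d n s r R \<omega> \<partial>world d n k) + real s / 4 \<le> sampled_norm d n s r R \<omega>}"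
    unfolding p_def
  proof (rule finite_measure_mono)
    show "{\<omega>\<in>space (world d n k). (\<integral>\<omega>. sampled_norm d n s r R \<omega> \<partial>world d n k) + real s / 4 \<le> sampled_norm d n s r R \<omega>} \<in> events"
      by (intro borel_measurable_le borel_measurable_const meas)
  qed (use E in auto)
  also have "\<dots> \<le> exp (- (real s / 4)\<^sup>2 / (2 * real n * (real s / real n * (9/4 * R))\<^sup>2))"
    unfolding world_def
    by (rule McDiarmid[OF prob_space_site n]) (use s n R meas sampled_norm_bounded_diff[OF n] in \<open>auto simp: world_def\<close>)
  also have "- (real s / 4)\<^sup>2 / (2 * real n * (real s / real n * (9/4 * R))\<^sup>2) = - real n / (162 * R\<^sup>2)"
    using s n R by (simp add: field_simps power2_eq_square)
  finally show "p \<le> exp (- real n / (162 * R\<^sup>2))" .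
qed

subsection \<open>High dimension\<close>

text \<open>Averaging over the draw turns sums over the batch into sums over the data, which have
  Chernoff bounds; only the operator norm term keeps its mean over the draws.\<close>

lemma expectation_SDP_ge:
  assumes k: "0 < k" "k \<le> s" and n: "0 < n" and d: "0 < d" and T: "\<forall>i<n. fst (\<omega> i) < k"
    and on: "orthonormal d q u" and span: "\<forall>t<k. \<forall>i<d. residual d q u (mu t) i = 0"
  shows "(\<Sum>i<n. dot d (snd (\<omega> i)) (snd (\<omega> i))) / real n - (\<Sum>a<q. \<Sum>i<n. (dot d (u a) (snd (\<omega> i)))\<^sup>2) / real n
       - real k * mean_op_bound d n s r (\<lambda>i. snd (\<omega> i)) / real s
     \<le> measure_pmf.expectation (draw n s) (\<lambda>\<tau>. SDP d (\<lambda>j. cloud d n mu \<omega> (\<tau> j)) s k)"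
proof -
  let ?g = "\<lambda>i. snd (\<omega> i)"
  define h where "h i = dot d (?g i) (?g i) - (\<Sum>a<q. (dot d (u a) (?g i))\<^sup>2)" for i
  have s0: "0 < real s" using k by simp
  have "(1 / real s) * ((\<Sum>j<s. h (\<tau> j)) - real k * op_bound d n s r \<tau> ?g) \<le> SDP d (\<lambda>j. cloud d n mu \<omega> (\<tau> j)) s k"
    if \<tau>: "\<tau> \<in> set_pmf (draw n s)" for \<tau>
  proof -
    have \<tau>n: "\<forall>j<s. \<tau> j < n" using draw_less[OF \<tau> n] by blast
    have "(1 / real s) * ((\<Sum>j<s. dot d (?g (\<tau> j)) (?g (\<tau> j))) - (\<Sum>j<s. \<Sum>a<q. (dot d (?g (\<tau> j)) (u a))\<^sup>2) - real k * op_bound d n s r \<tau> ?g)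
       \<le> SDP d (\<lambda>j. cloud d n mu \<omega> (\<tau> j)) s k"
    proof (rule SDP_ge_noise[OF k _ _ on span])
      show "cloud d n mu \<omega> (\<tau> j) i = mu (fst (\<omega> (\<tau> j))) i + ?g (\<tau> j) i" if "j < s" "i < d" for j i
        using that \<tau>n by (simp add: cloud_pos pos_def)
      show "fst (\<omega> (\<tau> j)) < k" if "j < s" for j using that \<tau>n T by blast
      show "(\<Sum>j<s. (dot d v (?g (\<tau> j)))\<^sup>2) \<le> op_bound d n s r \<tau> ?g * dot d v v" for v
        by (rule sum_dot_le_op_bound[OF d \<tau>n, where g = "?g"])
      show "0 \<le> op_bound d n s r \<tau> ?g" by (rule op_bound_nonneg)
    qed
    then show ?thesis unfolding h_def sum_subtractf by (simp only: dot_commute[of d "u _"])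
  qed
  then have "measure_pmf.expectation (draw n s) (\<lambda>\<tau>. (1 / real s) * ((\<Sum>j<s. h (\<tau> j)) - real k * op_bound d n s r \<tau> ?g))
     \<le> measure_pmf.expectation (draw n s) (\<lambda>\<tau>. SDP d (\<lambda>j. cloud d n mu \<omega> (\<tau> j)) s k)"
    by (rule expectation_draw_mono[OF n])
  moreover have "measure_pmf.expectation (draw n s) (\<lambda>\<tau>. (1 / real s) * ((\<Sum>j<s. h (\<tau> j)) - real k * op_bound d n s r \<tau> ?g))
     = (1 / real s) * (measure_pmf.expectation (draw n s) (\<lambda>\<tau>. \<Sum>j<s. h (\<tau> j)) - real k * mean_op_bound d n s r ?g)"
    unfolding mean_op_bound_def
    by (simp only: Bochner_Integration.integral_mult_right_zero
       Bochner_Integration.integral_diff[OF integrable_draw[OF n] integrable_draw[OF n]])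
  moreover have "\<dots> = (\<Sum>i<n. h i) / real n - real k * mean_op_bound d n s r ?g / real s"
    unfolding expectation_draw_sum[OF n] using s0 by (simp add: right_diff_distrib diff_divide_distrib)
  moreover have "(\<Sum>i<n. h i) / real n = (\<Sum>i<n. dot d (?g i) (?g i)) / real n - (\<Sum>a<q. \<Sum>i<n. (dot d (u a) (?g i))\<^sup>2) / real n"
    unfolding h_def sum_subtractf diff_divide_distrib by (subst (2) sum.swap) (rule refl)
  ultimately show ?thesis by linarith
qed

theorem B_H_lower_bound_high_dim:
  assumes k: "2 \<le> k" "6 * k + 2 \<le> d" and s: "d \<le> s" "s \<le> n" "real s \<ge> 15 * real d * ln (real d)"
    and \<epsilon>: "0 < \<epsilon>" "\<epsilon> < 1" and l: "real l \<ge> 128 * (real d + 3 * ln (real n))\<^sup>2 * ln (1 / \<epsilon>)"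
    and p5: "measure (world d n k) {\<omega>\<in>space (world d n k).
         19/4 * real s \<le> sampled_norm d n s (nat \<lfloor>2 * ln (real d)\<rfloor>) (2 * real d + 6 * ln (real n)) \<omega>} \<le> p"
  shows "1 - (1 / real n + 2 * exp (- real n / (16 * real d)) + real k * exp (- real n / 256) + p) - \<epsilon>
     \<le> measure (gmm_data d n k mu \<Otimes>\<^sub>M measure_pmf (sampler n s l))
               {p \<in> space (gmm_data d n k mu \<Otimes>\<^sub>M measure_pmf (sampler n s l)).
                  \<forall>idx. kmpp_init d n k (fst p) idx \<longrightarrow>
                    B_H d n k s l \<epsilon> (fst p) idx (snd p)
                      \<ge> (real d - 6 * real k - 2) / (real d + 1) * IP d (fst p) n k}"
proof -
  let ?W = "world d n k" and ?R = "2 * real d + 6 * ln (real n)" and ?r = "nat \<lfloor>2 * ln (real d)\<rfloor>"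
  let ?Q = "real d + 3 * ln (real n)"
  interpret W: prob_space ?W by (rule prob_space_world)
  have kn: "0 < k" "k \<le> s" "k \<le> n" "0 < n" "0 < d" "0 < s" using k s by auto
  have Q: "0 < ?Q" using kn by (intro add_pos_nonneg) auto
  obtain q u where q: "q \<le> k" and on: "orthonormal d q u" and span: "\<forall>t<k. \<forall>i<d. residual d q u (mu t) i = 0"
    using Gram_Schmidt[of k d mu] by blast
  define A1 where "A1 = {\<omega>\<in>space ?W. \<exists>i<n. ?R \<le> dot d (snd (\<omega> i)) (snd (\<omega> i))}"
  define A2 where "A2 = {\<omega>\<in>space ?W. real n * (real d + 1) \<le> (\<Sum>i<n. dot d (snd (\<omega> i)) (snd (\<omega> i)))}"
  define A3 where "A3 = {\<omega>\<in>space ?W. (\<Sum>i<n. dot d (snd (\<omega> i)) (snd (\<omega> i))) \<le> real n * (real d - 1)}"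
  define A4 where "A4 a = {\<omega>\<in>space ?W. real n * (5/4) \<le> (\<Sum>i<n. (dot d (u a) (snd (\<omega> i)))\<^sup>2)}" for a
  define A5 where "A5 = {\<omega>\<in>space ?W. 19/4 * real s \<le> sampled_norm d n s ?r ?R \<omega>}"
  have m: "(\<lambda>\<omega>. \<Sum>i<n. dot d (snd (\<omega> i)) (snd (\<omega> i))) \<in> borel_measurable ?W"
    "(\<lambda>\<omega>. \<Sum>i<n. (dot d v (snd (\<omega> i)))\<^sup>2) \<in> borel_measurable ?W" for v
  proof -
    have [measurable]: "(\<lambda>\<omega>. snd (\<omega> i)) \<in> ?W \<rightarrow>\<^sub>M noise d" if "i \<in> {..<n}" for i using that by simp
    show "(\<lambda>\<omega>. \<Sum>i<n. dot d (snd (\<omega> i)) (snd (\<omega> i))) \<in> borel_measurable ?W"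
      "(\<lambda>\<omega>. \<Sum>i<n. (dot d v (snd (\<omega> i)))\<^sup>2) \<in> borel_measurable ?W" by measurable
  qed
  have ev: "A1 \<in> W.events" "A2 \<in> W.events" "A3 \<in> W.events" "A5 \<in> W.events"
    unfolding A1_def A2_def A3_def A5_def
    by (intro sets_norm_max borel_measurable_le borel_measurable_const m measurable_sampled_norm kn)+
  have ev4: "A4 a \<in> W.events" for a
    unfolding A4_def by (intro borel_measurable_le borel_measurable_const m)
  define A4' where "A4' = (\<Union>a\<in>{..<q}. A4 a)"
  have ev4': "A4' \<in> W.events" unfolding A4'_def using ev4 by (intro sets.finite_UN) auto
  have p1: "W.prob A1 \<le> 1 / real n" unfolding A1_def by (rule world_norm_max[OF kn(4)])
  have p2: "W.prob A2 \<le> exp (- real n / (16 * real d))" unfolding A2_def by (rule world_norm_sum_upper[OF kn(5)])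
  have p3: "W.prob A3 \<le> exp (- real n / (16 * real d))" unfolding A3_def by (rule world_norm_sum_lower[OF kn(5)])
  have p4: "W.prob A4' \<le> real k * exp (- real n / 256)"
  proof -
    have "W.prob A4' \<le> (\<Sum>a<q. W.prob (A4 a))"
      unfolding A4'_def using ev4 by (intro W.finite_measure_subadditive_finite) auto
    also have "\<dots> \<le> (\<Sum>a<q. exp (- real n / 256))"
      unfolding A4_def using on by (intro sum_mono world_dot_sum_upper) (auto simp: orthonormal_def)
    also have "\<dots> \<le> real k * exp (- real n / 256)" using q by (simp add: mult_right_mono)
    finally show ?thesis .
  qed
  let ?A = "A1 \<union> A2 \<union> A3 \<union> A4' \<union> A5"
  have "W.prob ?A \<le> W.prob (A1 \<union> A2 \<union> A3 \<union> A4') + W.prob A5" by (intro measure_Un_le sets.Un ev ev4')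
  moreover have "W.prob (A1 \<union> A2 \<union> A3 \<union> A4') \<le> W.prob (A1 \<union> A2 \<union> A3) + W.prob A4'" by (intro measure_Un_le sets.Un ev ev4')
  moreover have "W.prob (A1 \<union> A2 \<union> A3) \<le> W.prob (A1 \<union> A2) + W.prob A3" by (intro measure_Un_le sets.Un ev)
  moreover have "W.prob (A1 \<union> A2) \<le> W.prob A1 + W.prob A2" by (intro measure_Un_le ev)
  ultimately have "W.prob ?A \<le> 1 / real n + 2 * exp (- real n / (16 * real d)) + real k * exp (- real n / 256) + p"
    using p1 p2 p3 p4 p5[folded A5_def] by linarith
  moreover have evA: "?A \<in> W.events" by (intro sets.Un ev ev4')
  ultimately have G: "1 - (1 / real n + 2 * exp (- real n / (16 * real d)) + real k * exp (- real n / 256) + p) \<le> W.prob (space ?W - ?A)"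
    by (intro W.prob_diff_ge)
  show ?thesis
  proof (rule joint_prob_ge[OF kn(1-3) _ _ _ G])
    fix \<omega> assume \<omega>: "\<omega> \<in> space ?W - ?A" and T: "\<forall>i<n. fst (\<omega> i) < k"
    let ?X = "cloud d n mu \<omega>" and ?g = "\<lambda>i. snd (\<omega> i)"
    have norm: "\<forall>i<n. dot d (?g i) (?g i) < ?R" using \<omega> by (auto simp: A1_def not_le)
    have up: "(\<Sum>i<n. dot d (?g i) (?g i)) / real n \<le> real d + 1"
      using \<omega> kn by (auto simp: A2_def divide_le_eq mult.commute)
    have lo: "real d - 1 \<le> (\<Sum>i<n. dot d (?g i) (?g i)) / real n"
      using \<omega> kn by (auto simp: A3_def le_divide_eq mult.commute)
    have du: "(\<Sum>a<q. \<Sum>i<n. (dot d (u a) (?g i))\<^sup>2) / real n \<le> 5/4 * real k"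
    proof -
      have "(\<Sum>a<q. \<Sum>i<n. (dot d (u a) (?g i))\<^sup>2) \<le> (\<Sum>a<q. real n * (5/4))"
      proof (rule sum_mono)
        fix a assume "a \<in> {..<q}"
        then have "\<omega> \<notin> A4 a" using \<omega> unfolding A4'_def by blast
        then show "(\<Sum>i<n. (dot d (u a) (?g i))\<^sup>2) \<le> real n * (5/4)" using \<omega> unfolding A4_def by force
      qed
      also have "\<dots> = real q * (real n * (5/4))" by simp
      also have "\<dots> \<le> real k * (real n * (5/4))" using q by (intro mult_right_mono) auto
      finally show ?thesis using kn by (simp add: divide_le_eq mult_ac)
    qed
    \<comment> \<open>Outside \<open>A1\<close> no noise vector is truncated, so the estimate for
      truncated data holds for the actual data.\<close>
    have fn: "mean_op_bound d n s ?r ?g / real s \<le> 19/4"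
    proof -
      have "op_bound d n s ?r \<tau> (\<lambda>i. snd (trunc_world d n ?R \<omega> i)) = op_bound d n s ?r \<tau> ?g" for \<tau>
        using norm by (intro antisym op_bound_mono) (simp_all add: trunc_world_def trunc_site_def)
      then have "sampled_norm d n s ?r ?R \<omega> = mean_op_bound d n s ?r ?g"
        by (simp add: sampled_norm_def mean_op_bound_def)
      moreover have "sampled_norm d n s ?r ?R \<omega> \<le> 19/4 * real s" using \<omega> by (auto simp: A5_def)
      ultimately show ?thesis using kn by (simp add: divide_le_eq)
    qed
    let ?f = "\<lambda>\<tau>. SDP d (\<lambda>j. ?X (\<tau> j)) s k"
    let ?E = "measure_pmf.expectation (draw n s) ?f"
    have "real k * mean_op_bound d n s ?r ?g / real s \<le> real k * (19/4)"
      using mult_left_mono[OF fn, of "real k"] by simp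
    then have E: "real d - 1 - 6 * real k \<le> ?E"
      using expectation_SDP_ge[OF kn(1,2,4,5) T on span, where r = ?r] lo du by linarith
    have IP: "(real d - 6 * real k - 2) / (real d + 1) * IP d ?X n k \<le> real d - 6 * real k - 2"
    proof -
      have "IP d ?X n k \<le> (1 / real n) * (\<Sum>j<n. sqdist d (?X j) (mu (fst (\<omega> j))))"
        using T kn by (intro IP_le_assignment) auto
      also have "\<dots> = (\<Sum>i<n. dot d (?g i) (?g i)) / real n" by (simp add: cloud_sqdist)
      finally have "IP d ?X n k \<le> real d + 1" using up by simp
      moreover have "0 \<le> real d - 6 * real k - 2" using k by linarith
      ultimately have "(real d - 6 * real k - 2) / (real d + 1) * IP d ?X n k \<le> (real d - 6 * real k - 2) / (real d + 1) * (real d + 1)"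
        by (intro mult_left_mono divide_nonneg_nonneg) auto
      then show ?thesis by simp
    qed
    have R0: "0 \<le> ?R" using Q by simp
    \<comment> \<open>With the true means as centres the range is R, against 4 R for the
      initialization points; hence the deviation 1/8 instead of 1/2.\<close>
    have bd: "?f \<tau> \<in> {0..?R}" if \<tau>: "\<tau> \<in> set_pmf (draw n s)" for \<tau>
    proof -
      have \<tau>n: "\<tau> j < n" if "j < s" for j using draw_less[OF \<tau> kn(4) that] .
      have "?f \<tau> \<le> (1 / real s) * (\<Sum>j<s. sqdist d (?X (\<tau> j)) (mu (fst (\<omega> (\<tau> j)))))"
        using T kn \<tau>n by (intro SDP_le_assignment) auto
      also have "\<dots> \<le> (1 / real s) * (\<Sum>j<s. ?R)"
        using \<tau>n norm by (intro mult_left_mono sum_mono) (auto simp: cloud_sqdist less_imp_le)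
      finally show ?thesis using SDP_nonneg[OF kn(1,2)] kn by simp
    qed
    have l0: "0 < l"
    proof -
      have "0 < 128 * ?Q\<^sup>2 * ln (1 / \<epsilon>)" using Q \<epsilon> by (intro mult_pos_pos) auto
      then have "0 < real l" using l by linarith
      then show ?thesis by simp
    qed
    let ?t = "sqrt (?R\<^sup>2 / (2 * real l) * ln (1 / \<epsilon>))"
    have t: "?t \<le> 1/8"
    proof -
      have "?t \<le> ?R / (16 * ?Q)" by (rule deviation_le[OF \<epsilon> Q l R0])
      also have "\<dots> = 2 * ?Q / (16 * ?Q)" by simp
      also have "\<dots> = 1/8" using Q by (simp del: distrib_left_numeral)
      finally show ?thesis .
    qed
    have "measure_pmf.prob (sampler n s l) {\<sigma>. (1 / real l) * (\<Sum>i<l. ?f (\<sigma> i)) < ?E - ?t} \<le> \<epsilon>"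
      using sampler_concentration(2)[of n s ?f ?R l \<epsilon>, OF bd l0 \<epsilon>(1) less_imp_le[OF \<epsilon>(2)] R0] by simp
    then show "1 - \<epsilon> \<le> measure_pmf.prob (sampler n s l) {\<sigma>. \<forall>idx. kmpp_init d n k ?X idx \<longrightarrow>
         (real d - 6 * real k - 2) / (real d + 1) * IP d ?X n k \<le> B_H d n k s l \<epsilon> ?X idx \<sigma>}"
    proof (rule prob_pmf_ge_compl, intro subsetI CollectI allI impI)
      fix \<sigma> idx assume "\<sigma> \<in> - {\<sigma>. (1 / real l) * (\<Sum>i<l. ?f (\<sigma> i)) < ?E - ?t} \<inter> set_pmf (sampler n s l)"
        and i: "kmpp_init d n k ?X idx"
      then have "?E - ?t \<le> (1 / real l) * (\<Sum>i<l. ?f (\<sigma> i))" by auto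
      then show "(real d - 6 * real k - 2) / (real d + 1) * IP d ?X n k \<le> B_H d n k s l \<epsilon> ?X idx \<sigma>"
        unfolding B_H_def using kmpp_b_deviation[OF kn(1,3) T norm kn(5) \<epsilon> l i] E IP t by linarith
    qed
  qed (use \<epsilon> evA in auto)
qed

section \<open>Combining the failure probabilities\<close>

text \<open>Here n^2 \<le> (3200 d)^2, about 1.03 * 10^7 d^2, so the exponent is at most 1/n in
  absolute value and exp(-x) \<ge> 1 - x closes the gap. This calls for a constant as small as
  1/20000000.\<close>

lemma small_sample_vacuous:
  assumes d: "0 < d" and n: "n < 3200 * d" "0 < n"
  shows "1 - 1 / real n - exp (- (1/20000000) * real n / (real d + ln (real n))\<^sup>2) \<le> 0"
proof -
  define D where "D = real d + ln (real n)"
  have D: "real d \<le> D" using n by (simp add: D_def)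
  have dpos: "0 < real d" using d by simp
  have "1 + (- (1/20000000) * real n / D\<^sup>2) \<le> exp (- (1/20000000) * real n / D\<^sup>2)" by (rule exp_ge_add_one_self)
  moreover have "(1/20000000) * real n / D\<^sup>2 \<le> 1 / real n"
  proof -
    have "real n \<le> 3200 * real d" using n by linarith
    then have "real n * real n \<le> (3200 * real d) * (3200 * real d)" by (intro mult_mono) auto
    also have "\<dots> \<le> 20000000 * (real d * real d)" using dpos by simp
    also have "\<dots> \<le> 20000000 * (D * D)" using D dpos by (intro mult_left_mono mult_mono) auto
    finally have "real n * real n \<le> 20000000 * (D * D)" .
    moreover have "0 < D * D" using D dpos by (intro mult_pos_pos) auto
    moreover have "0 < real n" using n by simp
    ultimately show ?thesis by (simp add: field_simps power2_eq_square)
  qed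
  ultimately show ?thesis unfolding D_def by simp
qed

lemma failure_probabilities_combine:
  assumes k: "k \<le> d" and d: "1 \<le> d" and n: "3200 * d \<le> n" and D: "real d \<le> D"
    and p: "p \<le> 18/19" "p \<le> exp (- real n / (5832 * D\<^sup>2))"
  shows "2 * exp (- real n / (16 * real d)) + real k * exp (- real n / 256) + p \<le> exp (- (1/20000000) * real n / D\<^sup>2)"
proof -
  have dpos: "1 \<le> real d" "0 < real d" using d by auto
  have n0: "0 \<le> real n" by simp
  have nd: "3200 * real d \<le> real n" using n by linarith
  \<comment> \<open>A common bound for the three Chernoff terms: half of n/256 absorbs the factor k
    \<le> d \<le> n/3200.\<close>
  define z where "z = exp (- real n / (512 * real d))"
  have "- real n / (16 * real d) \<le> - real n / (512 * real d)"
    using dpos by (simp add: field_simps)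
  then have z1: "exp (- real n / (16 * real d)) \<le> z" by (simp add: z_def)
  have z2: "real k * exp (- real n / 256) \<le> z"
  proof -
    have "real k \<le> exp (real k)" using exp_ge_add_one_self[of "real k"] by linarith
    also have "\<dots> \<le> exp (real n / 512)" using k nd dpos by simp
    finally have "real k * exp (- real n / 256) \<le> exp (real n / 512) * exp (- real n / 256)" by (intro mult_right_mono) auto
    also have "\<dots> = exp (- real n / 512)" by (simp add: exp_add[symmetric])
    also have "\<dots> \<le> z"
    proof -
      have "real n * 1 \<le> real n * real d" using dpos by (intro mult_left_mono) auto
      then show ?thesis unfolding z_def using dpos by (simp add: field_simps)
    qed
    finally show ?thesis .
  qed
  have eq2: "(5/2 :: real) \<le> exp 1" using exp_lower_Taylor_quadratic[of 1] by (simp add: power2_eq_square)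
  have Dpos: "0 < D\<^sup>2" "real d \<le> D\<^sup>2"
  proof -
    have "real d * 1 \<le> D * D" using D dpos by (intro mult_mono) auto
    then show "real d \<le> D\<^sup>2" by (simp add: power2_eq_square)
    then show "0 < D\<^sup>2" using dpos by linarith
  qed
  have "2 * exp (- real n / (16 * real d)) + real k * exp (- real n / 256) + p \<le> 3 * z + p" using z1 z2 by linarith
  also have "\<dots> \<le> exp (- (1/20000000) * real n / D\<^sup>2)"
  \<comment> \<open>Below the split the right-hand side is close to 1, and 3 z \<le> 1/38 with p
    \<le> 18/19 keeps the left below 37/38. Above it n / D^2 exceeds twice 5832 with room to spare,
    so slowing the rate from 1/5832 to 1/20000000 gains a factor exp 2, enough for four equal
    exponentials.\<close>
  proof (cases "real n / D\<^sup>2 \<le> 16400")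
    case True
    have "z \<le> exp (- 6)" unfolding z_def using nd dpos by (simp add: field_simps)
    also have "\<dots> = 1 / exp 1 ^ 6" using exp_of_nat_mult[of 6 "1::real"] by (simp add: exp_minus inverse_eq_divide)
    also have "\<dots> \<le> 1 / (5/2) ^ 6" by (intro divide_left_mono power_mono eq2) auto
    finally have "3 * z \<le> 1/38" by (simp add: power_divide)
    then have "3 * z + p \<le> 37/38" using p(1) by linarith
    also have "\<dots> \<le> 1 + (- (1/20000000) * real n / D\<^sup>2)" using True by simp
    also have "\<dots> \<le> exp (- (1/20000000) * real n / D\<^sup>2)" by (rule exp_ge_add_one_self)
    finally show ?thesis .
  next
    case False
    define x where "x = real n / D\<^sup>2"
    have x: "16400 < x" using False by (simp add: x_def)
    have zx: "z \<le> exp (- x / 5832)"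
    proof -
      have "512 * real d \<le> 5832 * D\<^sup>2" using Dpos(2) dpos by linarith
      then have "real n / (5832 * D\<^sup>2) \<le> real n / (512 * real d)" using dpos Dpos by (intro divide_left_mono) auto
      then show ?thesis unfolding z_def x_def by simp
    qed
    have px: "p \<le> exp (- x / 5832)" using p(2) by (simp add: x_def mult.commute)
    have "(4::real) \<le> (5/2) * (5/2)" by simp
    also have "\<dots> \<le> exp 1 * exp 1" using eq2 by (intro mult_mono) auto
    also have "\<dots> = exp 2" by (simp add: exp_add[symmetric])
    also have "\<dots> \<le> exp (x / 5832 - x / 20000000)" using x by simp
    finally have "4 * exp (- x / 5832) \<le> exp (x / 5832 - x / 20000000) * exp (- x / 5832)" by (intro mult_right_mono) auto
    also have "\<dots> = exp (- (1/20000000) * real n / D\<^sup>2)" by (simp add: exp_add[symmetric] x_def)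
    finally show ?thesis using zx px by linarith
  qed
  finally show ?thesis .
qed

theorem theorem4:
  shows "(\<forall>(d::nat) (n::nat) (k::nat) (s::nat) (l::nat) (\<epsilon>::real) (X :: nat \<Rightarrow> nat \<Rightarrow> real).
            2 \<le> k \<and> k \<le> s \<and> k \<le> n \<and> 0 < \<epsilon> \<longrightarrow>
            measure_pmf.prob (sampler n s l)
              {\<sigma>. \<forall>idx. kmpp_init d n k X idx \<longrightarrow> B_H d n k s l \<epsilon> X idx \<sigma> \<le> IP d X n k}
            \<ge> 1 - \<epsilon>)
       \<and>
       (\<exists>C::real. 0 < C \<and>
          (\<forall>(d::nat) (n::nat) (k::nat) (s::nat) (l::nat) (\<epsilon>::real) (mu :: nat \<Rightarrow> nat \<Rightarrow> real).
             2 \<le> k \<and> k \<le> d \<and> d \<le> s \<and> s \<le> n \<and> 0 < \<epsilon> \<and>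
             real s \<ge> 15 * real d * ln (real d) \<and>
             real l \<ge> 128 * (real d + 3 * ln (real n))^2 * ln (1 / \<epsilon>) \<longrightarrow>
             measure (gmm_data d n k mu \<Otimes>\<^sub>M measure_pmf (sampler n s l))
               {p \<in> space (gmm_data d n k mu \<Otimes>\<^sub>M measure_pmf (sampler n s l)).
                  \<forall>idx. kmpp_init d n k (fst p) idx \<longrightarrow>
                    B_H d n k s l \<epsilon> (fst p) idx (snd p)
                      \<ge> (real d - 6 * real k - 2) / (real d + 1) * IP d (fst p) n k}
             \<ge> 1 - 1 / real n - exp (- C * real n / (real d + ln (real n))^2) - \<epsilon>))"
proof (intro conjI exI[of _ "1/20000000 :: real"] allI impI)
  fix d n k s l :: nat and \<epsilon> :: real and X :: "nat \<Rightarrow> nat \<Rightarrow> real"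
  assume "2 \<le> k \<and> k \<le> s \<and> k \<le> n \<and> 0 < \<epsilon>"
  then show "1 - \<epsilon> \<le> measure_pmf.prob (sampler n s l)
      {\<sigma>. \<forall>idx. kmpp_init d n k X idx \<longrightarrow> B_H d n k s l \<epsilon> X idx \<sigma> \<le> IP d X n k}"
    by (intro B_H_le_IP) auto
next
  fix d n k s l :: nat and \<epsilon> :: real and mu :: "nat \<Rightarrow> nat \<Rightarrow> real"
  let ?P = "measure (gmm_data d n k mu \<Otimes>\<^sub>M measure_pmf (sampler n s l))
               {p \<in> space (gmm_data d n k mu \<Otimes>\<^sub>M measure_pmf (sampler n s l)).
                  \<forall>idx. kmpp_init d n k (fst p) idx \<longrightarrow>
                    B_H d n k s l \<epsilon> (fst p) idx (snd p)
                      \<ge> (real d - 6 * real k - 2) / (real d + 1) * IP d (fst p) n k}"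
  let ?D = "real d + ln (real n)"
  let ?e = "exp (- (1/20000000) * real n / ?D\<^sup>2)"
  assume "2 \<le> k \<and> k \<le> d \<and> d \<le> s \<and> s \<le> n \<and> 0 < \<epsilon> \<and>
             real s \<ge> 15 * real d * ln (real d) \<and>
             real l \<ge> 128 * (real d + 3 * ln (real n))^2 * ln (1 / \<epsilon>)"
  then have k: "2 \<le> k" "k \<le> d" and s: "d \<le> s" "s \<le> n" "real s \<ge> 15 * real d * ln (real d)"
    and \<epsilon>: "0 < \<epsilon>" and l: "real l \<ge> 128 * (real d + 3 * ln (real n))^2 * ln (1 / \<epsilon>)" by auto
  have n0: "0 < n" "0 < d" "1 \<le> d" using k s by auto
  have lnn: "0 \<le> ln (real n)" using n0 by simp
  have P0: "0 \<le> ?P" by simp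
  have e0: "0 < ?e" by simp
  have inv: "0 \<le> 1 / real n" by simp
  consider "1 \<le> \<epsilon>" | "\<epsilon> < 1" "n < 3200 * d" | "\<epsilon> < 1" "3200 * d \<le> n" "d \<le> 6 * k + 1" | "\<epsilon> < 1" "3200 * d \<le> n" "6 * k + 2 \<le> d"
    by linarith
  then show "1 - 1 / real n - ?e - \<epsilon> \<le> ?P"
  proof cases
    case 1
    then show ?thesis using P0 e0 inv by linarith
  next
    case 2
    then show ?thesis using small_sample_vacuous[OF n0(2) 2(2) n0(1)] P0 \<epsilon> by linarith
  next
    case 3
    have "1 - (1 / real n + exp (- real n / 10)) - \<epsilon> \<le> ?P"
      by (rule B_H_lower_bound_low_dim[OF k 3(3) s(1,2) 3(2) \<epsilon> 3(1) l])
    moreover have "exp (- real n / 10) \<le> ?e"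
    proof -
      have "1 \<le> ?D" using n0 lnn by linarith
      then have "1 \<le> ?D\<^sup>2" by simp
      then have "real n / (20000000 * ?D\<^sup>2) \<le> real n / 10" by (intro divide_left_mono) auto
      then show ?thesis by simp
    qed
    ultimately show ?thesis by linarith
  next
    case 4
    \<comment> \<open>This is where k \<ge> 2 gives 2 ln d \<ge> 5, on which the choice of r
      relies.\<close>
    have d14: "14 \<le> d" using k 4(3) by linarith
    let ?R = "2 * real d + 6 * ln (real n)"
    let ?p = "measure (world d n k) {\<omega>\<in>space (world d n k). 19/4 * real s \<le> sampled_norm d n s (nat \<lfloor>2 * ln (real d)\<rfloor>) ?R \<omega>}"
    have R: "0 < ?R" using n0 lnn by linarith
    have s0: "0 < s" using n0 s by linarith
    note tail = sampled_norm_tail[OF d14 s(3) s0 s(2) R, of k]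
    \<comment> \<open>Passing from R to d + ln n costs 6^2, and 36 * 162 = 5832.\<close>
    have "?R \<le> 6 * ?D" by simp
    then have "?R\<^sup>2 \<le> (6 * ?D)\<^sup>2" using R by (intro power_mono) auto
    moreover have "(6 * x)\<^sup>2 = 36 * x\<^sup>2" for x :: real by (simp add: power2_eq_square)
    ultimately have "162 * ?R\<^sup>2 \<le> 5832 * ?D\<^sup>2" by (simp only:)
    moreover have "0 < ?R\<^sup>2" using R by simp
    ultimately have "real n / (5832 * ?D\<^sup>2) \<le> real n / (162 * ?R\<^sup>2)"
      by (intro divide_left_mono mult_pos_pos) linarith+
    then have "exp (- real n / (162 * ?R\<^sup>2)) \<le> exp (- real n / (5832 * ?D\<^sup>2))" by simp
    then have p: "?p \<le> exp (- real n / (5832 * ?D\<^sup>2))" using tail(2) by (rule order_trans[rotated])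
    have "real d \<le> ?D" using lnn by simp
    then have "2 * exp (- real n / (16 * real d)) + real k * exp (- real n / 256) + ?p \<le> ?e"
      by (rule failure_probabilities_combine[OF k(2) n0(3) 4(2) _ tail(1) p])
    moreover have "1 - (1 / real n + 2 * exp (- real n / (16 * real d)) + real k * exp (- real n / 256) + ?p) - \<epsilon> \<le> ?P"
      by (rule B_H_lower_bound_high_dim[OF k(1) 4(3) s \<epsilon> 4(1) l order_refl])
    ultimately show ?thesis by linarith
  qed
qed simp

end
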